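(* Let $\alpha=(\alpha_1,\ldots,\alpha_k)$ be a strong composition of $n$. The collection of equivariant Springer monomials $\{P_\Upsilon(\mathbf z,\mathbf x)\mid \Upsilon\in \mathrm{RSCT}_n(\alpha)\}$ (more precisely, of their images in $\mathcal A$ under $\pi$) is an $S(\mathfrak s^* )$-module basis of $\mathcal A\simeq H_S^*(\mathcal B^\alpha)$.
   Context: Ring. A strong composition $\alpha=(\alpha_1,\dots,\alpha_k)$ of $n$ is a sequence of positive integers with sum $n$. Let $W=S_n$ and $\mathfrak t=\{(t_1,\dots,t_n)\in\mathbb C^n:\sum t_i=0\}$ (diagonal matrices, trace-zero normalization), with $W$ acting by $(w\cdot t)_{w(i)}=t_i$. Let $\mathfrak s\subseteq\mathfrak t$ be the subspace of vectors $((z_1)^{\alpha_1},\dots,(z_k)^{\alpha_k})$, where $(z_i)^{\alpha_i}$ means $z_i$ repeated $\alpha_i$ times. Thus $S(\mathfrak s^* )=\mathbb C[z_1,\dots,z_k]/\langle\sum\alpha_iz_i\rangle$ and $\mathbb C[\mathfrak s\times\mathfrak t]=\mathbb C[z_1,\dots,z_k;x_1,\dots,x_n]/\langle\sum\alpha_iz_i,\sum x_i\rangle$. Let $Z_\alpha=\{(h,w\cdot h): h\in\mathfrak s,w\in W\}\subseteq\mathfrak s\times\mathfrak t$ (a reduced closed subvariety), and let $\mathcal A=\mathbb C[Z_\alpha]$ be its coordinate ring, i.e. the quotient of $\mathbb C[\mathfrak s\times\mathfrak t]$ by the vanishing ideal of $Z_\alpha$, with quotient map $\pi:\mathbb C[\mathfrak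 s\times\mathfrak t]\to\mathcal A$; it is an $S(\mathfrak s^* )$-algebra via projection to the first factor. Geometry. Let $L\subseteq GL_n(\mathbb C)$ be the block diagonal Levi subgroup with block sizes $\alpha_1,\dots,\alpha_k$, $X_\alpha$ a principal nilpotent element of $\mathrm{Lie}(L)$ (one nilpotent Jordan block per diagonal block), $B$ the upper triangular matrices, $\mathfrak b=\mathrm{Lie}(B)$, $\mathcal B=GL_n(\mathbb C)/B$, and $\mathcal B^\alpha=\{gB\in\mathcal B: g^{-1}X_\alpha g\in\mathfrak b\}$ the Springer fiber. The torus $S$ with Lie algebra $\mathfrak s$ (identity component of the centralizer of $L$) acts on $\mathcal B^\alpha$ by left multiplication. Cohomology has complex coefficients. By a theorem of Kumar and Procesi there is a graded $S(\mathfrak s^* )$-algebra isomorphism $\mathcal A\simeq H_S^*(\mathcal B^\alpha)$ (doubling degrees) sending $x_i$ to the restriction of $-c_1(\mathcal L_i)$, where $\mathcal L_i$ is the equivariant line bundle on $\mathcal B$ with fiber $V_i/V_{i-1}$ over a flag $V_\bullet$. Tableaux. $\mathrm{RSCT}_n(\alpha)$ is the set of row-strict composition tableaux: fillings of the diagram with $\alpha_i$ left-justified boxes in row $i$ (rows numbered from top to bottom) by $1,\dots,n$, each used once, with entries decreasing from left to right in each row. A pair $(i,j)$ is a Springer inversion of $\Upsilon$ if there is an entry $j'$ in row $j$ with $i<j'$ such that either $j'$ appears above $i$ in the same column, or $j'$ appears in a column strictly to the right of the column containing $i$. $\mathrm{Inv}(\Upsilon)$ is the set of Springer inversions. The equivariant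 Springer monomial of $\Upsilon$ is $P_\Upsilon(\mathbf z,\mathbf x)=\prod_{(i,j)\in\mathrm{Inv}(\Upsilon)}(x_i-z_j)\in\mathbb C[\mathfrak s\times\mathfrak t]$ (equal to $1$ if there are no inversions); its image in $\mathcal A$ is denoted by the same symbol. *)

theory Defs
  imports
    Complex_Main
    "HOL-Algebra.QuotRing"
    "HOL-Algebra.Module"
    "HOL-Library.Poly_Mapping"
    "HOL-Combinatorics.Permutations"
begin

section \<open>Free modules\<close>

text \<open>
  A finite family \<open>b\<close> indexed by \<open>I\<close> is a basis of the \<open>R\<close>-module \<open>M\<close> if it spans \<open>M\<close> and is
  linearly independent over \<open>R\<close>. Linear independence is that of the family, so over a nontrivial
  ring it includes injectivity of \<open>b\<close> on \<open>I\<close>.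
\<close>

definition finite_module_basis ::
  "('r, 'c) ring_scheme \<Rightarrow> ('r, 'm, 'd) module_scheme \<Rightarrow> ('i \<Rightarrow> 'm) \<Rightarrow> 'i set \<Rightarrow> bool" where
  "finite_module_basis R M b I \<longleftrightarrow>
     module R M \<and> finite I \<and> b \<in> I \<rightarrow> carrier M \<and>
     (\<forall>a\<in>carrier M. \<exists>c\<in>I \<rightarrow> carrier R. a = (\<Oplus>\<^bsub>M\<^esub>i\<in>I. c i \<odot>\<^bsub>M\<^esub> b i)) \<and>
     (\<forall>c\<in>I \<rightarrow> carrier R. (\<Oplus>\<^bsub>M\<^esub>i\<in>I. c i \<odot>\<^bsub>M\<^esub> b i) = \<zero>\<^bsub>M\<^esub> \<longrightarrow> (\<forall>i\<in>I. c i = \<zero>\<^bsub>R\<^esub>))"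


section \<open>Polynomials\<close>

datatype indet = Zvar nat | Xvar nat

type_synonym polynomial = "(indet \<Rightarrow>\<^sub>0 nat) \<Rightarrow>\<^sub>0 complex"

definition Var :: "indet \<Rightarrow> polynomial" where
  "Var v = Poly_Mapping.single (Poly_Mapping.single v 1) 1"

definition indets :: "polynomial \<Rightarrow> indet set" where
  "indets p = (\<Union>m\<in>Poly_Mapping.keys p. Poly_Mapping.keys m)"

definition eval_poly :: "(indet \<Rightarrow> complex) \<Rightarrow> polynomial \<Rightarrow> complex" where
  "eval_poly a p =
     (\<Sum>m\<in>Poly_Mapping.keys p. Poly_Mapping.lookup p m *
        (\<Prod>v\<in>Poly_Mapping.keys m. a v ^ Poly_Mapping.lookup m v))"

definition poly_ring :: "indet set \<Rightarrow> polynomial ring" where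
  "poly_ring V =
     \<lparr>carrier = {p. indets p \<subseteq> V}, monoid.mult = (*), one = 1, zero = 0, add = (+)\<rparr>"


section \<open>The variety \<open>Z\<^sub>\<alpha>\<close>\<close>

text \<open>
  Compositions are lists; parts, blocks, rows and coordinates are numbered from 1, so that the
  \<open>i\<close>-th part is \<open>\<alpha> ! (i - 1)\<close>.
\<close>

definition strong_composition :: "nat \<Rightarrow> nat list \<Rightarrow> bool" where
  "strong_composition n \<alpha> \<longleftrightarrow> (\<forall>a\<in>set \<alpha>. 0 < a) \<and> sum_list \<alpha> = n"

definition part :: "nat list \<Rightarrow> nat \<Rightarrow> nat" where
  "part \<alpha> i = \<alpha> ! (i - 1)"

text \<open>The positions \<open>\<alpha>\<^sub>1 + \<dots> + \<alpha>\<^sub>i\<^sub>-\<^sub>1 + 1, \<dots>, \<alpha>\<^sub>1 + \<dots> + \<alpha>\<^sub>i\<close>.\<close>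

definition block :: "nat list \<Rightarrow> nat \<Rightarrow> nat set" where
  "block \<alpha> i = {sum_list (take (i - 1) \<alpha>) <.. sum_list (take i \<alpha>)}"

text \<open>Vectors in \<open>\<complex>\<^sup>n\<close> are functions that vanish outside \<open>{1..n}\<close>.\<close>

definition tt :: "nat \<Rightarrow> (nat \<Rightarrow> complex) set" where
  "tt n = {t. (\<forall>i. i \<notin> {1..n} \<longrightarrow> t i = 0) \<and> (\<Sum>i=1..n. t i) = 0}"

definition ss :: "nat \<Rightarrow> nat list \<Rightarrow> (nat \<Rightarrow> complex) set" where
  "ss n \<alpha> = {h \<in> tt n. \<exists>z :: nat \<Rightarrow> complex. \<forall>i\<in>{1..length \<alpha>}. \<forall>p\<in>block \<alpha> i. h p = z i}"

text \<open>The coordinate \<open>z\<^sub>i\<close> of \<open>h \<in> \<ss>\<close> is the common value on block \<open>i\<close>, read off at its last position.\<close>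

definition z_coord :: "nat list \<Rightarrow> (nat \<Rightarrow> complex) \<Rightarrow> nat \<Rightarrow> complex" where
  "z_coord \<alpha> h i = h (sum_list (take i \<alpha>))"

text \<open>\<open>(w \<cdot> t)\<^sub>w\<^sub>(\<^sub>i\<^sub>) = t\<^sub>i\<close>\<close>

definition perm_act :: "(nat \<Rightarrow> nat) \<Rightarrow> (nat \<Rightarrow> complex) \<Rightarrow> nat \<Rightarrow> complex" where
  "perm_act w t = (\<lambda>j. t (inv_into UNIV w j))"

definition Z_var :: "nat \<Rightarrow> nat list \<Rightarrow> ((nat \<Rightarrow> complex) \<times> (nat \<Rightarrow> complex)) set" where
  "Z_var n \<alpha> = {(h, perm_act w h) | h w. h \<in> ss n \<alpha> \<and> w permutes {1..n}}"

text \<open>The value of a polynomial in the \<open>z\<^sub>i\<close> and \<open>x\<^sub>j\<close> at a point \<open>(h, t)\<close> of \<open>\<ss> \<times> \<tt>\<close>.\<close>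

definition eval_at :: "nat list \<Rightarrow> (nat \<Rightarrow> complex) \<times> (nat \<Rightarrow> complex) \<Rightarrow> polynomial \<Rightarrow> complex" where
  "eval_at \<alpha> P = eval_poly (case_indet (z_coord \<alpha> (fst P)) (snd P))"


section \<open>Coordinate rings\<close>

definition poly_z :: "nat list \<Rightarrow> polynomial ring" where
  "poly_z \<alpha> = poly_ring (Zvar ` {1..length \<alpha>})"

definition poly_zx :: "nat \<Rightarrow> nat list \<Rightarrow> polynomial ring" where
  "poly_zx n \<alpha> = poly_ring (Zvar ` {1..length \<alpha>} \<union> Xvar ` {1..n})"

definition z_relation :: "nat list \<Rightarrow> polynomial" where
  "z_relation \<alpha> = (\<Sum>i=1..length \<alpha>. of_nat (part \<alpha> i) * Var (Zvar i))"

definition x_relation :: "nat \<Rightarrow> polynomial" where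
  "x_relation n = (\<Sum>i=1..n. Var (Xvar i))"

text \<open>\<open>S(\<ss>\<^sup>*) = \<complex>[z\<^sub>1, \<dots>, z\<^sub>k] / \<langle>\<Sum> \<alpha>\<^sub>i z\<^sub>i\<rangle>\<close>\<close>

definition Sym_s :: "nat list \<Rightarrow> polynomial set ring" where
  "Sym_s \<alpha> = poly_z \<alpha> Quot (Idl\<^bsub>poly_z \<alpha>\<^esub> {z_relation \<alpha>})"

text \<open>\<open>\<complex>[\<ss> \<times> \<tt>] = \<complex>[z\<^sub>1, \<dots>, z\<^sub>k; x\<^sub>1, \<dots>, x\<^sub>n] / \<langle>\<Sum> \<alpha>\<^sub>i z\<^sub>i, \<Sum> x\<^sub>i\<rangle>\<close>\<close>

definition st_ideal :: "nat \<Rightarrow> nat list \<Rightarrow> polynomial set" where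
  "st_ideal n \<alpha> = Idl\<^bsub>poly_zx n \<alpha>\<^esub> {z_relation \<alpha>, x_relation n}"

definition coord_st :: "nat \<Rightarrow> nat list \<Rightarrow> polynomial set ring" where
  "coord_st n \<alpha> = poly_zx n \<alpha> Quot st_ideal n \<alpha>"

definition st_class :: "nat \<Rightarrow> nat list \<Rightarrow> polynomial \<Rightarrow> polynomial set" where
  "st_class n \<alpha> p = st_ideal n \<alpha> +>\<^bsub>poly_zx n \<alpha>\<^esub> p"

text \<open>
  Elements of \<open>\<complex>[\<ss> \<times> \<tt>]\<close> are cosets; all representatives of a coset have the same value at each
  point of \<open>\<ss> \<times> \<tt>\<close>, since both generators of the ideal vanish there.
\<close>

definition vanishing_ideal_Z :: "nat \<Rightarrow> nat list \<Rightarrow> polynomial set set" where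
  "vanishing_ideal_Z n \<alpha> =
     {f \<in> carrier (coord_st n \<alpha>). \<forall>p\<in>f. \<forall>P\<in>Z_var n \<alpha>. eval_at \<alpha> P p = 0}"

definition A_ring :: "nat \<Rightarrow> nat list \<Rightarrow> polynomial set set ring" where
  "A_ring n \<alpha> = coord_st n \<alpha> Quot vanishing_ideal_Z n \<alpha>"

definition A_proj :: "nat \<Rightarrow> nat list \<Rightarrow> polynomial set \<Rightarrow> polynomial set set" where
  "A_proj n \<alpha> f = vanishing_ideal_Z n \<alpha> +>\<^bsub>coord_st n \<alpha>\<^esub> f"

text \<open>
  The structure map \<open>S(\<ss>\<^sup>*) \<rightarrow> \<A>\<close> is pullback along the first projection: it sends the class of
  \<open>p(z)\<close> to the class of \<open>p(z)\<close>. The image of a coset under \<open>p \<mapsto> \<pi>[p]\<close> is a singleton.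
\<close>

definition A_structure_map :: "nat \<Rightarrow> nat list \<Rightarrow> polynomial set \<Rightarrow> polynomial set set" where
  "A_structure_map n \<alpha> c = the_elem ((\<lambda>p. A_proj n \<alpha> (st_class n \<alpha> p)) ` c)"

definition A_module :: "nat \<Rightarrow> nat list \<Rightarrow> (polynomial set, polynomial set set) module" where
  "A_module n \<alpha> =
     \<lparr>carrier = carrier (A_ring n \<alpha>), monoid.mult = monoid.mult (A_ring n \<alpha>), one = one (A_ring n \<alpha>),
      zero = zero (A_ring n \<alpha>), add = add (A_ring n \<alpha>),
      smult = (\<lambda>c a. A_structure_map n \<alpha> c \<otimes>\<^bsub>A_ring n \<alpha>\<^esub> a)\<rparr>"


section \<open>Row-strict composition tableaux and Springer monomials\<close>

text \<open>Boxes are pairs (row, column), with rows numbered from top to bottom.\<close>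

definition diagram :: "nat list \<Rightarrow> (nat \<times> nat) set" where
  "diagram \<alpha> = {(r, c). r \<in> {1..length \<alpha>} \<and> c \<in> {1..part \<alpha> r}}"

definition RSCT :: "nat \<Rightarrow> nat list \<Rightarrow> (nat \<times> nat \<Rightarrow> nat) set" where
  "RSCT n \<alpha> =
     {T \<in> extensional (diagram \<alpha>). bij_betw T (diagram \<alpha>) {1..n} \<and>
        (\<forall>r c c'. (r, c) \<in> diagram \<alpha> \<and> (r, c') \<in> diagram \<alpha> \<and> c < c' \<longrightarrow> T (r, c') < T (r, c))}"

text \<open>
  In a Springer inversion \<open>(i, j)\<close>, \<open>i\<close> is an entry and \<open>j\<close> is a row. Below, \<open>(r, c)\<close> is the box of
  \<open>i\<close> and \<open>(j, c')\<close> is the box of the entry \<open>j'\<close>.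
\<close>

definition springer_inversions :: "nat list \<Rightarrow> (nat \<times> nat \<Rightarrow> nat) \<Rightarrow> (nat \<times> nat) set" where
  "springer_inversions \<alpha> T =
     {(i, j). \<exists>r c c'. (r, c) \<in> diagram \<alpha> \<and> T (r, c) = i \<and> (j, c') \<in> diagram \<alpha> \<and>
        i < T (j, c') \<and> (c' = c \<and> j < r \<or> c < c')}"

definition springer_monomial_poly :: "nat list \<Rightarrow> (nat \<times> nat \<Rightarrow> nat) \<Rightarrow> polynomial" where
  "springer_monomial_poly \<alpha> T =
     (\<Prod>(i, j)\<in>springer_inversions \<alpha> T. Var (Xvar i) - Var (Zvar j))"

definition springer_monomial :: "nat \<Rightarrow> nat list \<Rightarrow> (nat \<times> nat \<Rightarrow> nat) \<Rightarrow> polynomial set" where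
  "springer_monomial n \<alpha> T = st_class n \<alpha> (springer_monomial_poly \<alpha> T)"

end

theory Submission
  imports Defs "HOL-Computational_Algebra.Polynomial"
begin

text \<open>
Over a point \<open>z\<close> of \<open>\<ss>\<close>, a point of \<open>Z\<^sub>\<alpha>\<close> assigns to each \<open>x\<^sub>i\<close> one of the values \<open>z\<^sub>j\<close>, each \<open>z\<^sub>j\<close>
being used \<open>\<alpha>\<^sub>j\<close> times. So \<open>Z\<^sub>\<alpha>\<close> is a union of copies of \<open>\<ss>\<close> indexed by the words
\<open>g : {1..n} \<rightarrow> {1..k}\<close> of content \<open>\<alpha>\<close>. Such words correspond to row-strict composition tableaux:
\<open>g i\<close> is the row of the entry \<open>i\<close>. Since rows decrease, the number of entries \<open>\<ge> i\<close> in row \<open>j\<close>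
tells how far the boxes with such entries reach, and the inversions of \<open>i\<close> can be read off the word:
they are the rows that have more remaining letters than the row of \<open>i\<close>, or equally many and a smaller
index (\<open>springer_inversions_eq\<close>). In particular the factors of the smallest entry depend only on
\<open>\<alpha>\<close> and its row \<open>r\<close>. If the rows are sorted by decreasing length, they are the Newton product
\<open>N\<^sub>Q(x) = \<Prod>\<^sub>j\<^sub>\<in>\<^sub>Q (x - z\<^sub>j)\<close>, where \<open>x\<close> is the variable of that entry and \<open>Q\<close> consists of the rows
before \<open>r\<close>; the remaining factors form the monomial of a word for \<open>\<alpha>\<close> with row \<open>r\<close> shortened by one.

Spanning is proved by induction on the number of variables (\<open>springer_prods_span\<close>). A polynomial is
expanded in Newton form with respect to the first variable, and its coefficients are expanded by the
induction hypothesis for the shortened composition. The coefficients matter only up to those \<open>q\<close> for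
which \<open>N\<^sub>Q(x) q\<close> is a multiple of the next Newton product modulo the relations, and it has to be shown
that the relations of the shortened composition have this property. This is done for explicit
relations of Tanisaki type, which hold on \<open>Z\<^sub>\<alpha>\<close>: if \<open>S\<close> is a set of variables with \<open>c\<close> variables in
its complement, then \<open>\<Prod>\<^sub>i\<^sub>\<in>\<^sub>S (t - x\<^sub>i)\<close> is divisible by \<open>\<Prod>\<^sub>j (t - z\<^sub>j)\<^bsup>\<alpha>\<^sub>j - c\<^esup>\<close>, with exponents
truncated at \<open>0\<close>. They are inherited by the ideal of the admissible errors \<open>q\<close>
(\<open>tanisaki_descends\<close>), because rows are processed in order of decreasing length. The Newton product
over all rows is itself a consequence of them (\<open>leading_newton_product_in_ideal\<close>), so that the
expansion stops. Spanning therefore holds modulo every ideal that contains the Tanisaki relations, and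
the vanishing ideal of \<open>Z\<^sub>\<alpha>\<close> is one of them.

Independence is a triangularity argument. At a point with pairwise distinct \<open>z\<^sub>j\<close> and with word \<open>g\<close>,
the monomial of a word \<open>f\<close> vanishes unless \<open>f = g\<close> or, at the first position where they differ, \<open>g\<close>
uses a later row than \<open>f\<close> in the order used there; it does not vanish for \<open>f = g\<close>
(\<open>row_code_less\<close>, \<open>springer_polys_pointwise_independent\<close>). Hence the coefficients of a linear relation
vanish at all points of \<open>\<ss>\<close> with distinct coordinates, and a polynomial with this property is a
multiple of \<open>\<Sum> \<alpha>\<^sub>i z\<^sub>i\<close> (\<open>vanishing_on_generic_trace_zero\<close>).
\<close>


section \<open>Subrings, ideals and polynomials modulo an ideal\<close>

definition is_subring :: "'a::comm_ring_1 set \<Rightarrow> bool" where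
  "is_subring C \<longleftrightarrow> 1 \<in> C \<and> (\<forall>a\<in>C. \<forall>b\<in>C. a - b \<in> C \<and> a * b \<in> C)"

text \<open>
Subrings and ideals are sets inside a type-class ring, so that polynomials in a further variable \<open>t\<close>
over them are elements of a \<open>poly\<close> type, where subrings and ideals can be formed again.
\<close>

definition is_ideal :: "'a::comm_ring_1 set \<Rightarrow> 'a set \<Rightarrow> bool" where
  "is_ideal C I \<longleftrightarrow>
     is_subring C \<and> I \<subseteq> C \<and> 0 \<in> I \<and> (\<forall>a\<in>I. \<forall>b\<in>I. a - b \<in> I) \<and> (\<forall>c\<in>C. \<forall>a\<in>I. c * a \<in> I)"

definition polys_over :: "'a::comm_ring_1 set \<Rightarrow> 'a poly set" where
  "polys_over C = {F. \<forall>i. coeff F i \<in> C}"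

lemma subring_one: "is_subring C \<Longrightarrow> 1 \<in> C"
  and subring_diff: "is_subring C \<Longrightarrow> a \<in> C \<Longrightarrow> b \<in> C \<Longrightarrow> a - b \<in> C"
  and subring_mult: "is_subring C \<Longrightarrow> a \<in> C \<Longrightarrow> b \<in> C \<Longrightarrow> a * b \<in> C"
  by (auto simp: is_subring_def)

lemma subring_zero: "is_subring C \<Longrightarrow> 0 \<in> C"
  using subring_diff[of C 1 1] subring_one[of C] by simp

lemma subring_uminus: "is_subring C \<Longrightarrow> a \<in> C \<Longrightarrow> - a \<in> C"
  using subring_diff[of C 0 a] subring_zero[of C] by simp

lemma subring_add: "is_subring C \<Longrightarrow> a \<in> C \<Longrightarrow> b \<in> C \<Longrightarrow> a + b \<in> C"
  using subring_diff[of C a "- b"] subring_uminus[of C b] by simp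

lemma subring_sum: "is_subring C \<Longrightarrow> (\<And>i. i \<in> A \<Longrightarrow> f i \<in> C) \<Longrightarrow> sum f A \<in> C"
  by (induction A rule: infinite_finite_induct) (auto simp: subring_zero subring_add)

lemma subring_prod: "is_subring C \<Longrightarrow> (\<And>i. i \<in> A \<Longrightarrow> f i \<in> C) \<Longrightarrow> prod f A \<in> C"
  by (induction A rule: infinite_finite_induct) (auto simp: subring_one subring_mult)

lemma subring_power: "is_subring C \<Longrightarrow> a \<in> C \<Longrightarrow> a ^ n \<in> C"
  by (induction n) (auto simp: subring_one subring_mult)

lemmas subring_intros =
  subring_zero subring_one subring_diff subring_mult subring_uminus subring_add
  subring_sum subring_prod subring_power

lemma ideal_subring: "is_ideal C I \<Longrightarrow> is_subring C"
  and ideal_subset: "is_ideal C I \<Longrightarrow> a \<in> I \<Longrightarrow> a \<in> C"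
  and ideal_zero: "is_ideal C I \<Longrightarrow> 0 \<in> I"
  and ideal_diff: "is_ideal C I \<Longrightarrow> a \<in> I \<Longrightarrow> b \<in> I \<Longrightarrow> a - b \<in> I"
  and ideal_mult: "is_ideal C I \<Longrightarrow> c \<in> C \<Longrightarrow> a \<in> I \<Longrightarrow> c * a \<in> I"
  by (auto simp: is_ideal_def)

lemma ideal_mult_right: "is_ideal C I \<Longrightarrow> c \<in> C \<Longrightarrow> a \<in> I \<Longrightarrow> a * c \<in> I"
  using ideal_mult[of C I c a] by (simp add: mult.commute)

lemma ideal_uminus: "is_ideal C I \<Longrightarrow> a \<in> I \<Longrightarrow> - a \<in> I"
  using ideal_diff[of C I 0 a] ideal_zero[of C I] by simp

lemma ideal_add: "is_ideal C I \<Longrightarrow> a \<in> I \<Longrightarrow> b \<in> I \<Longrightarrow> a + b \<in> I"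
  using ideal_diff[of C I a "- b"] ideal_uminus[of C I b] by simp

lemma ideal_sum: "is_ideal C I \<Longrightarrow> (\<And>i. i \<in> A \<Longrightarrow> f i \<in> I) \<Longrightarrow> sum f A \<in> I"
  by (induction A rule: infinite_finite_induct) (auto simp: ideal_zero ideal_add)

lemma polys_over_iff: "F \<in> polys_over C \<longleftrightarrow> (\<forall>i. coeff F i \<in> C)"
  by (simp add: polys_over_def)

lemma subring_polys_over: "is_subring C \<Longrightarrow> is_subring (polys_over C)"
  unfolding is_subring_def[of "polys_over C"]
  by (auto simp: polys_over_iff coeff_mult coeff_1 intro!: subring_intros)

lemma ideal_polys_over: "is_ideal C I \<Longrightarrow> is_ideal (polys_over C) (polys_over I)"
  using subring_polys_over[OF ideal_subring, of C I] unfolding is_ideal_def[of "polys_over C"]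
  by (auto simp: polys_over_iff coeff_mult ideal_zero ideal_diff ideal_subset
      intro!: ideal_sum[of C] ideal_mult[of C])

lemma const_in_polys_over: "is_subring C \<Longrightarrow> [:a:] \<in> polys_over C \<longleftrightarrow> a \<in> C"
  by (auto simp: polys_over_iff coeff_pCons subring_zero split: nat.splits)

lemma pCons_in_polys_over: "pCons a F \<in> polys_over C \<longleftrightarrow> a \<in> C \<and> F \<in> polys_over C"
  by (auto simp: polys_over_iff coeff_pCons split: nat.splits)

lemma linear_in_polys_over: "is_subring C \<Longrightarrow> a \<in> C \<Longrightarrow> [:- a, 1:] \<in> polys_over C"
  by (simp add: pCons_in_polys_over subring_intros) (auto simp: polys_over_iff subring_zero)

text \<open>
By descending induction on the index: as \<open>D\<close> is monic, a coefficient of \<open>K\<close> differs from one of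
\<open>D * K\<close> by a combination of higher coefficients of \<open>K\<close>. The next two lemmas use the two
ways in which the premise on the high coefficients of \<open>D * K\<close> can arise.
\<close>

lemma monic_cofactor_in_ideal:
  assumes I: "is_ideal C I" and D: "D \<in> polys_over C" "lead_coeff D = 1"
    and top: "\<And>i. degree D \<le> i \<Longrightarrow> coeff (D * K) i \<in> I"
  shows "K \<in> polys_over I"
proof -
  have "coeff K i \<in> I" for i
  proof (induction "Suc (degree K) - i" arbitrary: i rule: less_induct)
    case (less i)
    show ?case
    proof (cases "degree K < i")
      case True
      then show ?thesis by (simp add: coeff_eq_0 ideal_zero[OF I])
    next
      case False
      have IH: "coeff K j \<in> I" if "i < j" for j
        using less[of j] that False by auto
      let ?d = "degree D"
      have "coeff (D * K) (?d + i) = (\<Sum>a\<le>?d + i. coeff D a * coeff K (?d + i - a))"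
        by (rule coeff_mult)
      also have "\<dots> = coeff K i + (\<Sum>a\<in>{..?d + i} - {?d}. coeff D a * coeff K (?d + i - a))"
        using D(2) by (subst sum.remove[of _ ?d]) auto
      finally have "coeff K i = coeff (D * K) (?d + i)
          - (\<Sum>a\<in>{..?d + i} - {?d}. coeff D a * coeff K (?d + i - a))"
        by simp
      moreover have "(\<Sum>a\<in>{..?d + i} - {?d}. coeff D a * coeff K (?d + i - a)) \<in> I"
      proof (rule ideal_sum[OF I])
        fix a assume a: "a \<in> {..?d + i} - {?d}"
        show "coeff D a * coeff K (?d + i - a) \<in> I"
        proof (cases "a < ?d")
          case True
          then show ?thesis
            using D(1) by (intro ideal_mult[OF I] IH) (auto simp: polys_over_iff)
        next
          case False
          then show ?thesis using a by (simp add: coeff_eq_0 ideal_zero[OF I])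
        qed
      qed
      ultimately show ?thesis
        using top[of "?d + i"] ideal_diff[OF I] by simp
    qed
  qed
  then show ?thesis by (simp add: polys_over_iff)
qed

lemma cancel_monic:
  assumes "is_ideal C I" "D \<in> polys_over C" "lead_coeff D = 1" "D * K \<in> polys_over I"
  shows "K \<in> polys_over I"
  using assms(4) by (intro monic_cofactor_in_ideal[OF assms(1-3)]) (auto simp: polys_over_iff)

text \<open>
With this lemma a divisibility modulo an ideal, which only asserts that some cofactor exists, becomes a
statement about the coefficients of the actual remainder.
\<close>

lemma remainder_unique:
  assumes I: "is_ideal C I" and D: "D \<in> polys_over C" "lead_coeff D = 1"
    and low: "\<And>i. degree D \<le> i \<Longrightarrow> coeff M i = 0" and cong: "M - D * K \<in> polys_over I"
  shows "M \<in> polys_over I"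
proof -
  have "coeff (D * K) i \<in> I" if "degree D \<le> i" for i
    using cong low[OF that] ideal_uminus[OF I, of "- coeff (D * K) i"]
    by (auto simp: polys_over_iff dest: spec[of _ i])
  then have "K \<in> polys_over I" by (rule monic_cofactor_in_ideal[OF I D])
  then have "D * K \<in> polys_over I"
    by (rule ideal_mult[OF ideal_polys_over[OF I] D(1)])
  from ideal_add[OF ideal_polys_over[OF I] cong this] show ?thesis by simp
qed

text \<open>
Long division by a monic polynomial never leaves the subring generated by the coefficients.
\<close>

lemma monic_division:
  assumes C: "is_subring C" and D: "D \<in> polys_over C" "lead_coeff D = 1"
    and F: "F \<in> polys_over C"
  obtains G M where "G \<in> polys_over C" "M \<in> polys_over C" "F = D * G + M"
    "\<And>i. degree D \<le> i \<Longrightarrow> coeff M i = 0"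
proof -
  have "\<exists>G\<in>polys_over C. \<exists>M\<in>polys_over C. F = D * G + M \<and> (\<forall>i\<ge>degree D. coeff M i = 0)"
    using F
  proof (induction F)
    case 0
    then show ?case by (intro bexI[of _ 0]) auto
  next
    case (pCons a F)
    then obtain G M where GM: "G \<in> polys_over C" "M \<in> polys_over C" "F = D * G + M"
      "\<forall>i\<ge>degree D. coeff M i = 0"
      by (auto simp: pCons_in_polys_over)
    have a: "a \<in> C" using pCons.prems by (simp add: pCons_in_polys_over)
    define N where "N = pCons a M"
    define c where "c = coeff N (degree D)"
    have N: "N \<in> polys_over C" using a GM by (simp add: N_def pCons_in_polys_over)
    then have c: "[:c:] \<in> polys_over C"
      unfolding const_in_polys_over[OF C] by (simp add: c_def polys_over_iff)
    note PC = subring_polys_over[OF C]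
    have "N - D * [:c:] \<in> polys_over C"
      by (intro subring_intros PC N D c)
    moreover have "pCons 0 G + [:c:] \<in> polys_over C"
      using GM(1) by (intro subring_add[OF PC] c) (simp add: pCons_in_polys_over subring_zero[OF C])
    moreover have "pCons a F = D * (pCons 0 G + [:c:]) + (N - D * [:c:])"
      using GM(3) by (simp add: N_def algebra_simps)
    moreover have "coeff (N - D * [:c:]) i = 0" if "degree D \<le> i" for i
    proof (cases "i = degree D")
      case True
      then show ?thesis using D(2) by (simp add: c_def mult.commute)
    next
      case False
      then have "degree D < i" using that by simp
      then show ?thesis
        using GM(4) by (cases i) (auto simp: N_def coeff_eq_0 mult.commute)
    qed
    ultimately show ?case by blast
  qed
  then show ?thesis using that by blast
qed

text \<open>
The coefficient ring may have zero divisors, so degrees of products are additive only because the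
leading coefficients are \<open>1\<close>.
\<close>

lemma monic_prod_linear_powers:
  fixes z :: "'b \<Rightarrow> 'a::comm_ring_1"
  assumes "finite K"
  shows "lead_coeff (\<Prod>j\<in>K. [:- z j, 1:] ^ e j) = 1 \<and>
         degree (\<Prod>j\<in>K. [:- z j, 1:] ^ e j) = (\<Sum>j\<in>K. e j)"
proof -
  have step: "lead_coeff (F * G) = 1 \<and> degree (F * G) = degree F + degree G"
    if "lead_coeff F = 1" "lead_coeff G = 1" for F G :: "'a poly"
  proof -
    have *: "coeff (F * G) (degree F + degree G) = 1"
      using that by (simp add: coeff_mult_degree_sum)
    then have "degree F + degree G \<le> degree (F * G)" by (intro le_degree) simp
    with degree_mult_le[of F G] have "degree (F * G) = degree F + degree G" by simp
    with * show ?thesis by simp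
  qed
  have pow: "lead_coeff ([:- a, 1:] ^ m) = 1 \<and> degree ([:- a, 1:] ^ m) = m" for a :: 'a and m
  proof (induction m)
    case (Suc m)
    have "lead_coeff [:- a, 1:] = 1" "degree [:- a, 1:] = 1" by simp_all
    with step[OF this(1) conjunct1[OF Suc]] Suc show ?case
      unfolding power_Suc by (metis plus_1_eq_Suc)
  qed simp
  show ?thesis using assms
  proof (induction K)
    case (insert j K)
    show ?case
      unfolding prod.insert[OF insert.hyps] sum.insert[OF insert.hyps]
      using step[OF conjunct1[OF pow] conjunct1[OF insert.IH], of "z j" "e j"]
        pow[of "z j" "e j"] insert.IH by metis
  qed simp
qed

lemma linear_prod_in_polys_over:
  assumes "is_subring C" "\<And>j. j \<in> K \<Longrightarrow> z j \<in> C"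
  shows "(\<Prod>j\<in>K. [:- z j, 1:] ^ e j) \<in> polys_over C"
  using assms by (intro subring_prod subring_power subring_polys_over linear_in_polys_over)

lemma poly_in_subring:
  assumes "is_subring C" "F \<in> polys_over C" "a \<in> C"
  shows "poly F a \<in> C"
  using assms unfolding poly_altdef
  by (intro subring_sum subring_mult subring_power) (auto simp: polys_over_iff)

lemma poly_in_ideal:
  assumes "is_ideal C I" "F \<in> polys_over I" "a \<in> C"
  shows "poly F a \<in> I"
  using assms unfolding poly_altdef
  by (intro ideal_sum[OF assms(1)] ideal_mult_right[OF assms(1)] subring_power[OF ideal_subring])
     (auto simp: polys_over_iff)

inductive_set adjoin :: "'a::comm_ring_1 set \<Rightarrow> 'a set" for X where
  adjoin_base: "a \<in> X \<Longrightarrow> a \<in> adjoin X"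
| adjoin_one: "1 \<in> adjoin X"
| adjoin_diff: "a \<in> adjoin X \<Longrightarrow> b \<in> adjoin X \<Longrightarrow> a - b \<in> adjoin X"
| adjoin_mult: "a \<in> adjoin X \<Longrightarrow> b \<in> adjoin X \<Longrightarrow> a * b \<in> adjoin X"

lemma subring_adjoin: "is_subring (adjoin X)"
  by (simp add: is_subring_def adjoin_one adjoin_diff adjoin_mult)

lemma adjoin_subset: "is_subring C \<Longrightarrow> X \<subseteq> C \<Longrightarrow> adjoin X \<subseteq> C"
proof
  fix a assume "is_subring C" "X \<subseteq> C" "a \<in> adjoin X"
  from this(3,1,2) show "a \<in> C" by induction (auto simp: subring_intros)
qed

lemma adjoin_mono: "X \<subseteq> Y \<Longrightarrow> adjoin X \<subseteq> adjoin Y"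
  by (intro adjoin_subset subring_adjoin) (auto intro: adjoin_base)

lemma adjoin_insert_poly:
  assumes "h \<in> adjoin (insert a X)"
  shows "\<exists>Q\<in>polys_over (adjoin X). h = poly Q a"
  using assms
proof induction
  case (adjoin_base h)
  show ?case
  proof (cases "h = a")
    case True
    then show ?thesis using linear_in_polys_over[OF subring_adjoin subring_zero[OF subring_adjoin], of X]
      by (intro bexI[of _ "[:0, 1:]"]) auto
  next
    case False
    then show ?thesis using adjoin_base adjoin.adjoin_base[of h X]
      by (intro bexI[of _ "[:h:]"]) (auto simp: const_in_polys_over[OF subring_adjoin])
  qed
next
  case adjoin_one
  show ?case
    by (intro bexI[of _ 1]) (auto intro: subring_one subring_polys_over subring_adjoin)
next
  case (adjoin_diff g h)
  then show ?case by (metis poly_diff subring_diff subring_polys_over subring_adjoin)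
next
  case (adjoin_mult g h)
  then show ?case by (metis poly_mult subring_mult subring_polys_over subring_adjoin)
qed

text \<open>
One step of Newton expansion in the variable \<open>a\<close> at the node \<open>b\<close>.
\<close>

lemma adjoin_insert_split:
  assumes b: "b \<in> adjoin X" and h: "h \<in> adjoin (insert a X)"
  shows "\<exists>h0\<in>adjoin X. \<exists>h1\<in>adjoin (insert a X). h = h0 + (a - b) * h1"
proof -
  note C = subring_adjoin[of X]
  obtain Q where Q: "Q \<in> polys_over (adjoin X)" "h = poly Q a"
    using adjoin_insert_poly[OF h] by blast
  obtain G M where GM: "G \<in> polys_over (adjoin X)" "M \<in> polys_over (adjoin X)"
    "Q = [:- b, 1:] * G + M" "\<And>i. degree [:- b, 1:] \<le> i \<Longrightarrow> coeff M i = 0"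
    using monic_division[OF C linear_in_polys_over[OF C b] _ Q(1)] by auto
  have "degree M \<le> 0" using GM(4) by (intro degree_le) auto
  then obtain m where m: "M = [:m:]" by (metis degree_eq_zeroE le_zero_eq)
  then have "m \<in> adjoin X" using GM(2) by (simp add: const_in_polys_over[OF C])
  moreover have "poly G a \<in> adjoin (insert a X)"
  proof (rule poly_in_subring[OF subring_adjoin])
    have "adjoin X \<subseteq> adjoin (insert a X)" by (intro adjoin_mono) auto
    then show "G \<in> polys_over (adjoin (insert a X))" using GM(1) by (auto simp: polys_over_iff)
  qed (auto intro: adjoin_base)
  moreover have "h = m + (a - b) * poly G a" by (simp add: Q(2) GM(3) m algebra_simps)
  ultimately show ?thesis by blast
qed


section \<open>Tanisaki divisibilities\<close>

text \<open>
The order in which rows of lengths \<open>\<beta>\<close> are processed: longer rows first, and rows of equal length from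
top to bottom. The smallest entry of a tableau stands at the end of its row \<open>r\<close>, and all other entries
are larger, so its inversions are exactly the rows that precede \<open>r\<close>.
\<close>

definition precedes :: "(nat \<Rightarrow> nat) \<Rightarrow> nat \<Rightarrow> nat \<Rightarrow> bool" where
  "precedes \<beta> j r \<longleftrightarrow> \<beta> r < \<beta> j \<or> \<beta> j = \<beta> r \<and> j < r"

text \<open>
The exponents use truncated subtraction. If \<open>t - z\<^sub>j\<close> occurs \<open>\<beta>\<^sub>j\<close> times among the factors \<open>t - x\<^sub>i\<close>,
then at least \<open>\<beta>\<^sub>j - c\<close> of them survive when \<open>c\<close> factors are removed.
\<close>

definition divisor_poly ::
  "(nat \<Rightarrow> 'a::comm_ring_1) \<Rightarrow> nat set \<Rightarrow> (nat \<Rightarrow> nat) \<Rightarrow> nat \<Rightarrow> 'a poly" where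
  "divisor_poly z K \<beta> c = (\<Prod>j\<in>K. [:- z j, 1:] ^ (\<beta> j - c))"

definition variable_poly :: "(nat \<Rightarrow> 'a::comm_ring_1) \<Rightarrow> nat set \<Rightarrow> 'a poly" where
  "variable_poly x S = (\<Prod>i\<in>S. [:- x i, 1:])"

text \<open>
An equivariant form of Tanisaki's relations, modulo an ideal \<open>I\<close> of \<open>C\<close>. It is a property of an
arbitrary ideal, not the definition of one by generators, because the induction passes to ideals
for which no generators are known.
\<close>

definition tanisaki ::
  "'a::comm_ring_1 set \<Rightarrow> 'a set \<Rightarrow> (nat \<Rightarrow> 'a) \<Rightarrow> nat set \<Rightarrow> (nat \<Rightarrow> 'a) \<Rightarrow> (nat \<Rightarrow> nat) \<Rightarrow> nat set \<Rightarrow> bool"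
  where
  "tanisaki C I z K x \<beta> A \<longleftrightarrow>
     (\<forall>S\<subseteq>A. \<exists>G\<in>polys_over C.
        variable_poly x S - divisor_poly z K \<beta> (card (A - S)) * G \<in> polys_over I)"

lemma divisor_poly_monic: "finite K \<Longrightarrow> lead_coeff (divisor_poly z K \<beta> c) = 1"
  and degree_divisor_poly: "finite K \<Longrightarrow> degree (divisor_poly z K \<beta> c) = (\<Sum>j\<in>K. \<beta> j - c)"
  unfolding divisor_poly_def
  by (fact conjunct1[OF monic_prod_linear_powers], fact conjunct2[OF monic_prod_linear_powers])

lemma variable_poly_monic: "finite S \<Longrightarrow> lead_coeff (variable_poly x S) = 1"
  and degree_variable_poly: "finite S \<Longrightarrow> degree (variable_poly x S) = card S"
  using monic_prod_linear_powers[of S x "\<lambda>_. 1"]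
  unfolding variable_poly_def power_one_right by (metis, simp)

lemma divisor_poly_over:
  "is_subring C \<Longrightarrow> (\<And>j. j \<in> K \<Longrightarrow> z j \<in> C) \<Longrightarrow> divisor_poly z K \<beta> c \<in> polys_over C"
  unfolding divisor_poly_def by (rule linear_prod_in_polys_over)

lemma variable_poly_over:
  "is_subring C \<Longrightarrow> (\<And>i. i \<in> S \<Longrightarrow> x i \<in> C) \<Longrightarrow> variable_poly x S \<in> polys_over C"
  unfolding variable_poly_def by (intro subring_prod subring_polys_over linear_in_polys_over)

lemma power_diff_Suc: "L ^ (b - c) = L ^ (b - Suc c) * (if c < b then L else 1)"
  for L :: "'a::comm_ring_1"
proof (cases "c < b")
  case True
  then have "b - c = Suc (b - Suc c)" by simp
  then show ?thesis using True by (simp only: power_Suc2 if_True)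
qed simp

lemma divisor_poly_Suc:
  assumes "finite K"
  shows "divisor_poly z K \<beta> c =
    divisor_poly z K \<beta> (Suc c) * (\<Prod>j\<in>{j\<in>K. c < \<beta> j}. [:- z j, 1:])"
proof -
  have "(\<Prod>j\<in>{j\<in>K. c < \<beta> j}. [:- z j, 1:]) = (\<Prod>j\<in>K. if c < \<beta> j then [:- z j, 1:] else 1)"
    using assms by (simp add: prod.inter_filter)
  then show ?thesis
    unfolding divisor_poly_def by (simp only: prod.distrib[symmetric] power_diff_Suc[of _ _ c])
qed

lemma divisor_poly_decrement:
  assumes K: "finite K" "r \<in> K"
  shows "divisor_poly z K (\<beta>(r := \<beta> r - 1)) c =
    (if c < \<beta> r
     then divisor_poly z K \<beta> (Suc c) * (\<Prod>j\<in>{j\<in>K. c < \<beta> j} - {r}. [:- z j, 1:])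
     else divisor_poly z K \<beta> c)"
proof (cases "c < \<beta> r")
  case False
  then have "(\<beta>(r := \<beta> r - 1)) j - c = \<beta> j - c" for j by auto
  then show ?thesis using False by (simp only: divisor_poly_def if_False)
next
  case True
  have "{j\<in>K. c < \<beta> j} - {r} = {j\<in>K. c < \<beta> j \<and> j \<noteq> r}" by auto
  then have "(\<Prod>j\<in>{j\<in>K. c < \<beta> j} - {r}. [:- z j, 1:])
      = (\<Prod>j\<in>K. if c < \<beta> j \<and> j \<noteq> r then [:- z j, 1:] else 1)"
    using K by (simp only: prod.inter_filter)
  moreover have "L ^ ((\<beta>(r := \<beta> r - 1)) j - c)
      = L ^ (\<beta> j - Suc c) * (if c < \<beta> j \<and> j \<noteq> r then L else 1)" for L :: "'a poly" and j
    by (cases "j = r") (use power_diff_Suc[of L "\<beta> j" c] in auto)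
  ultimately show ?thesis
    using True by (simp only: divisor_poly_def prod.distrib[symmetric] if_True)
qed

text \<open>
The relations for \<open>S\<close> and for \<open>insert a S\<close> are compared. The polynomial of the second set is \<open>t - x\<^sub>a\<close>
times that of the first, and its divisor is that of the first times \<open>\<Prod>(t - z\<^sub>j)\<close> over the rows longer
than \<open>c\<close>. Cancelling the common monic divisor leaves a congruence between the cofactors.
\<close>

lemma cofactor_congruence:
  assumes I: "is_ideal C I" and K: "finite K" "\<And>j. j \<in> K \<Longrightarrow> z j \<in> C"
    and A: "finite A" "a \<notin> A" and a: "x a \<in> C"
    and T: "tanisaki C I z K x \<beta> (insert a A)" and S: "S \<subseteq> A"
    and H: "H \<in> polys_over C"
      "variable_poly x (insert a S) - divisor_poly z K \<beta> (card (A - S)) * H \<in> polys_over I"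
  shows "\<exists>G\<in>polys_over C.
     variable_poly x S - divisor_poly z K \<beta> (Suc (card (A - S))) * G \<in> polys_over I \<and>
     [:- x a, 1:] * G - (\<Prod>j\<in>{j\<in>K. card (A - S) < \<beta> j}. [:- z j, 1:]) * H \<in> polys_over I"
proof -
  note C = ideal_subring[OF I] and PI = ideal_polys_over[OF I]
  define c where "c = card (A - S)"
  define D where "D = divisor_poly z K \<beta> (Suc c)"
  define E where "E = (\<Prod>j\<in>{j\<in>K. c < \<beta> j}. [:- z j, 1:])"
  have fin: "finite S" using S A by (auto intro: finite_subset)
  have "card (insert a A - S) = Suc c"
    using S A by (auto simp: c_def insert_Diff_if)
  moreover have "S \<subseteq> insert a A" using S by auto
  ultimately obtain G where G: "G \<in> polys_over C" "variable_poly x S - D * G \<in> polys_over I"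
    using T unfolding tanisaki_def D_def by metis
  have F: "variable_poly x (insert a S) = [:- x a, 1:] * variable_poly x S"
    using S A fin unfolding variable_poly_def by (subst prod.insert) auto
  have DE: "divisor_poly z K \<beta> c = D * E"
    unfolding D_def E_def by (rule divisor_poly_Suc[OF K(1)])
  have "[:- x a, 1:] * (variable_poly x S - D * G) \<in> polys_over I"
    by (intro ideal_mult[OF PI] linear_in_polys_over C a G)
  moreover have "variable_poly x (insert a S) - D * E * H \<in> polys_over I"
    using H(2) unfolding DE c_def[symmetric] .
  ultimately have "(variable_poly x (insert a S) - D * E * H)
      - [:- x a, 1:] * (variable_poly x S - D * G) \<in> polys_over I"
    using ideal_diff[OF PI] by blast
  also have "(variable_poly x (insert a S) - D * E * H) - [:- x a, 1:] * (variable_poly x S - D * G)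
      = D * ([:- x a, 1:] * G - E * H)"
    unfolding F by (simp only: algebra_simps)
  finally have "[:- x a, 1:] * G - E * H \<in> polys_over I"
    using cancel_monic[OF I] divisor_poly_over[OF C, of K z] divisor_poly_monic[OF K(1)] K(2)
    unfolding D_def by blast
  then show ?thesis using G unfolding D_def E_def c_def by blast
qed

text \<open>
When \<open>S\<close> contains all variables, the polynomial and its divisor are monic of the same degree, so they
are congruent and the cofactor is \<open>1\<close>. The congruence of cofactors, evaluated at \<open>t = x\<^sub>a\<close>, then says
that the Newton product over all nonempty rows lies in \<open>I\<close>.
\<close>

lemma leading_newton_product_in_ideal:
  assumes I: "is_ideal C I" and K: "finite K" "\<And>j. j \<in> K \<Longrightarrow> z j \<in> C"
    and A: "finite A" "a \<notin> A" and x: "x a \<in> C" "\<And>i. i \<in> A \<Longrightarrow> x i \<in> C"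
    and T: "tanisaki C I z K x \<beta> (insert a A)"
    and size: "(\<Sum>j\<in>K. \<beta> j) = card (insert a A)"
  shows "(\<Prod>j\<in>{j\<in>K. 0 < \<beta> j}. x a - z j) \<in> I"
proof -
  note C = ideal_subring[OF I] and PI = ideal_polys_over[OF I]
  define D where "D = divisor_poly z K \<beta> 0"
  define F where "F = variable_poly x (insert a A)"
  have D: "D \<in> polys_over C" "lead_coeff D = 1" "degree D = card (insert a A)"
    using K size C unfolding D_def
    by (blast intro: divisor_poly_over divisor_poly_monic, blast intro: divisor_poly_monic,
        simp add: degree_divisor_poly)
  have F: "lead_coeff F = 1" "degree F = card (insert a A)"
    using A variable_poly_monic[of "insert a A" x] degree_variable_poly[of "insert a A" x]
    by (auto simp only: F_def finite_insert)
  obtain H where H: "H \<in> polys_over C" "F - D * H \<in> polys_over I"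
    using T unfolding tanisaki_def F_def D_def by (metis Diff_cancel card.empty subset_refl)
  \<comment> \<open>\<open>F - D\<close> is its own remainder modulo \<open>D\<close>, and it is congruent to \<open>D * (H - 1)\<close>.\<close>
  have "F - D \<in> polys_over I"
  proof (rule remainder_unique[OF I D(1,2)])
    show "coeff (F - D) i = 0" if "degree D \<le> i" for i
      using that D F by (cases "i = degree D") (auto simp: coeff_eq_0)
    have "F - D - D * (H - 1) = F - D * H" by (simp add: algebra_simps)
    then show "F - D - D * (H - 1) \<in> polys_over I" using H(2) by (simp only:)
  qed
  then have "variable_poly x (insert a A) - divisor_poly z K \<beta> (card (A - A)) * 1 \<in> polys_over I"
    by (simp add: F_def D_def)
  from cofactor_congruence[OF I K A x(1) T subset_refl subring_one[OF subring_polys_over[OF C]] this]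
  obtain G where
    "[:- x a, 1:] * G - (\<Prod>j\<in>{j\<in>K. 0 < \<beta> j}. [:- z j, 1:]) \<in> polys_over I"
    by auto
  from poly_in_ideal[OF I this x(1)]
  have "- (\<Prod>j\<in>{j\<in>K. 0 < \<beta> j}. x a - z j) \<in> I"
    by (simp add: poly_prod)
  from ideal_uminus[OF I this] show ?thesis by simp
qed

text \<open>
The ideal of those \<open>q\<close> whose product with \<open>u\<close> is a multiple of \<open>v\<close> modulo \<open>I\<close>. With \<open>u\<close> a Newton
product and \<open>v\<close> the next one, it consists of the coefficients that a step of the Newton expansion can
discard.
\<close>

lemma is_ideal_colon:
  assumes I: "is_ideal C I" and C': "is_subring C'" "C' \<subseteq> C" and u: "u \<in> C" "v \<in> C"
  shows "is_ideal C' {q \<in> C'. \<exists>h\<in>C. u * q - v * h \<in> I}"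
proof -
  note C = ideal_subring[OF I]
  have "\<exists>h\<in>C. u * (p - q) - v * h \<in> I" 
    if "g \<in> C" "u * p - v * g \<in> I" "h \<in> C" "u * q - v * h \<in> I" for p q g h
  proof
    have "(u * p - v * g) - (u * q - v * h) \<in> I" using that ideal_diff[OF I] by blast
    then show "u * (p - q) - v * (g - h) \<in> I" by (simp add: algebra_simps)
    show "g - h \<in> C" using that C by (simp add: subring_diff)
  qed
  moreover have "\<exists>h\<in>C. u * (c * q) - v * h \<in> I" 
    if "h \<in> C" "u * q - v * h \<in> I" "c \<in> C" for c q h
  proof
    have "c * (u * q - v * h) \<in> I" using that ideal_mult[OF I] by blast
    then show "u * (c * q) - v * (c * h) \<in> I" by (simp add: algebra_simps)
    show "c * h \<in> C" using that C by (simp add: subring_mult)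
  qed
  moreover have "\<exists>h\<in>C. u * 0 - v * h \<in> I"
    by (intro bexI[of _ 0]) (auto simp: ideal_zero[OF I] subring_zero[OF C])
  ultimately show ?thesis unfolding is_ideal_def using C'
    by (auto simp: subring_intros) 
qed


text \<open>
The heart of the spanning argument. Let \<open>u\<close> be the Newton product over the rows before \<open>r\<close>, let
\<open>v = u (x\<^sub>a - z\<^sub>r)\<close>, and let \<open>F\<close> be the polynomial of \<open>S\<close>. It suffices to show that \<open>u F\<close> is divisible
by the divisor \<open>D'\<close> of the shortened composition modulo the ideal \<open>I'\<close> generated by \<open>I\<close> and \<open>v\<close>:
then \<open>u\<close> times the remainder of \<open>F\<close> modulo \<open>D'\<close> vanishes modulo \<open>I'\<close>, and the coefficients of this
remainder lie in \<open>J\<close>.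

In the congruence \<open>(t - x\<^sub>a) G = E H\<close> of cofactors, \<open>E\<close> is the product of \<open>t - z\<^sub>j\<close> over the rows longer
than \<open>c\<close>. If row \<open>r\<close> is one of them, multiplication by \<open>u\<close> allows \<open>x\<^sub>a\<close> to be replaced by \<open>z\<^sub>r\<close>, and the
factor \<open>t - z\<^sub>r\<close> cancels from both sides. Otherwise all these rows precede \<open>r\<close>, so that \<open>E(x\<^sub>a)\<close>
divides \<open>u\<close>; and \<open>E(x\<^sub>a) G\<close> is divisible by \<open>E\<close>, since \<open>E - E(x\<^sub>a)\<close> is a multiple of \<open>t - x\<^sub>a\<close>.
\<close>

lemma tanisaki_descends:
  assumes I: "is_ideal C I" and C': "is_subring C'" "C' \<subseteq> C"
    and K: "finite K" "\<And>j. j \<in> K \<Longrightarrow> z j \<in> C'"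
    and A: "finite A" "a \<notin> A" and x: "x a \<in> C" "\<And>i. i \<in> A \<Longrightarrow> x i \<in> C'"
    and T: "tanisaki C I z K x \<beta> (insert a A)"
    and r: "r \<in> K"
    and u: "u = (\<Prod>j\<in>{j\<in>K. precedes \<beta> j r}. x a - z j)"
    and J: "J = {q \<in> C'. \<exists>h\<in>C. u * q - u * (x a - z r) * h \<in> I}"
  shows "tanisaki C' J z K x (\<beta>(r := \<beta> r - 1)) A"
  unfolding tanisaki_def
proof (intro allI impI)
  fix S assume S: "S \<subseteq> A"
  note C = ideal_subring[OF I] and PI = ideal_polys_over[OF I]
  note PC = subring_polys_over[OF C] and PC' = subring_polys_over[OF C'(1)]
  have zC: "z j \<in> C" if "j \<in> K" for j using K(2) C'(2) that by blast
  have uC: "u \<in> C" unfolding u using x zC by (intro subring_intros C) auto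
  define v where "v = u * (x a - z r)"
  have vC: "v \<in> C" unfolding v_def using x zC r uC by (intro subring_intros C) auto
  define I' where "I' = {q \<in> C. \<exists>h\<in>C. 1 * q - v * h \<in> I}"
  have I': "is_ideal C I'"
    unfolding I'_def using vC subring_one[OF C] by (intro is_ideal_colon I C) auto
  note PI' = ideal_polys_over[OF I']
  have II': "I \<subseteq> I'"
    unfolding I'_def using ideal_subset[OF I] subring_zero[OF C] by (auto intro!: bexI[of _ 0])
  then have PII': "polys_over I \<subseteq> polys_over I'" by (auto simp: polys_over_def)
  have v: "[:v:] * X \<in> polys_over I'" if "X \<in> polys_over C" for X
  proof -
    have "v * b \<in> I'" if "b \<in> C" for b
      unfolding I'_def using that vC ideal_zero[OF I]
      by (auto intro!: bexI[of _ b] subring_mult[OF C])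
    then show ?thesis using that by (auto simp: polys_over_iff)
  qed
  define c where "c = card (A - S)"
  define D where "D = divisor_poly z K \<beta> (Suc c)"
  define E where "E = (\<Prod>j\<in>{j\<in>K. c < \<beta> j}. [:- z j, 1:])"
  define D' where "D' = divisor_poly z K (\<beta>(r := \<beta> r - 1)) c"
  define F where "F = variable_poly x S"
  have F: "F \<in> polys_over C'" unfolding F_def using S x by (intro variable_poly_over C') auto
  have D'C': "D' \<in> polys_over C'" unfolding D'_def by (intro divisor_poly_over C' K)
  have D'1: "lead_coeff D' = 1" unfolding D'_def by (rule divisor_poly_monic[OF K(1)])
  have over: "polys_over C' \<subseteq> polys_over C" using C'(2) by (auto simp: polys_over_def)
  have DC: "D \<in> polys_over C" unfolding D_def using zC by (intro divisor_poly_over C)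
  have EC: "E \<in> polys_over C" unfolding E_def
    using zC by (intro subring_prod PC linear_in_polys_over C) auto
  have uP: "[:u:] \<in> polys_over C" using uC by (simp add: const_in_polys_over[OF C])
  have "insert a A - insert a S = A - S" using A by auto
  moreover have "insert a S \<subseteq> insert a A" using S by auto
  ultimately obtain H where H: "H \<in> polys_over C"
    "variable_poly x (insert a S) - divisor_poly z K \<beta> (card (A - S)) * H \<in> polys_over I"
    using T unfolding tanisaki_def by metis
  obtain G where G: "G \<in> polys_over C" "F - D * G \<in> polys_over I"
    "[:- x a, 1:] * G - E * H \<in> polys_over I"
    using cofactor_congruence[OF I K(1) zC A x(1) T S H]
    unfolding F_def[symmetric] D_def[symmetric] E_def[symmetric] c_def[symmetric] by blast
  have lin: "[:- x a, 1:] \<in> polys_over C" by (intro linear_in_polys_over C x)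
  have "\<exists>L\<in>polys_over C. [:u:] * F - D' * L \<in> polys_over I'"
  proof (cases "c < \<beta> r")
    case True
    define E' where "E' = (\<Prod>j\<in>{j\<in>K. c < \<beta> j} - {r}. [:- z j, 1:])"
    have E: "E = [:- z r, 1:] * E'"
      unfolding E_def E'_def using r True K(1) by (intro prod.remove) auto
    have D': "D' = D * E'"
      unfolding D'_def D_def E'_def by (rule trans[OF divisor_poly_decrement[OF K(1) r, of z \<beta> c] if_P[OF True]])
    have E'C: "E' \<in> polys_over C" unfolding E'_def
      using zC by (intro subring_prod PC linear_in_polys_over C) auto
    have "[:u:] * ([:- x a, 1:] * G - E * H) + [:v:] * G \<in> polys_over I'"
      using G PII' by (intro ideal_add[OF PI'] ideal_mult[OF PI'] v uP) auto
    \<comment> \<open>Adding \<open>v G\<close> exchanges \<open>x a\<close> for \<open>z r\<close> in the linear factor.\<close>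
    also have "[:u:] * ([:- x a, 1:] * G - E * H) + [:v:] * G
        = [:- z r, 1:] * ([:u:] * (G - E' * H))"
    proof -
      have v: "[:v:] = [:u:] * ([:- z r, 1:] - [:- x a, 1:])" by (simp add: v_def)
      have "U * (X * G - E * H) + V * G = L * (U * (G - E' * H))"
        if "E = L * E'" "V = U * (L - X)" for U V X L :: "'a poly"
        unfolding that by (simp only: algebra_simps)
      from this[OF E v] show ?thesis .
    qed
    finally have "[:- z r, 1:] * ([:u:] * (G - E' * H)) \<in> polys_over I'" .
    moreover have "lead_coeff [:- z r, 1:] = 1" by simp
    ultimately have "[:u:] * (G - E' * H) \<in> polys_over I'"
      using cancel_monic[OF I' linear_in_polys_over[OF C zC[OF r]]] by blast
    from ideal_add[OF PI' ideal_mult[OF PI' uP subsetD[OF PII' G(2)]] ideal_mult[OF PI' DC this]]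
    have "[:u:] * (F - D * G) + D * ([:u:] * (G - E' * H)) \<in> polys_over I'" .
    also have "[:u:] * (F - D * G) + D * ([:u:] * (G - E' * H)) = [:u:] * F - D' * ([:u:] * H)"
      unfolding D' by (simp only: algebra_simps)
    finally show ?thesis using H(1) uP by (intro bexI[of _ "[:u:] * H"] subring_mult[OF PC])
  next
    case False
    have D': "D' = D * E"
      unfolding D'_def D_def E_def divisor_poly_Suc[OF K(1), of z \<beta> c, symmetric]
      by (rule trans[OF divisor_poly_decrement[OF K(1) r, of z \<beta> c] if_not_P[OF False]])
    obtain Q M where Q: "Q \<in> polys_over C" "M \<in> polys_over C" "E = [:- x a, 1:] * Q + M"
      "\<And>i. degree [:- x a, 1:] \<le> i \<Longrightarrow> coeff M i = 0"
      using monic_division[OF C lin _ EC] by auto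
    have "degree M \<le> 0" using Q(4) by (intro degree_le) auto
    then have "degree M = 0" by simp
    then obtain m where m: "M = [:m:]" by (rule degree_eq_zeroE)
    have "m = (\<Prod>j\<in>{j\<in>K. c < \<beta> j}. x a - z j)"
      using arg_cong[OF Q(3), of "\<lambda>p. poly p (x a)"] by (simp add: E_def poly_prod m)
    \<comment> \<open>As \<open>\<beta> r \<le> c\<close>, every row longer than \<open>c\<close> precedes \<open>r\<close>.\<close>
    moreover have "{j\<in>K. c < \<beta> j} \<subseteq> {j\<in>K. precedes \<beta> j r}"
      using False by (auto simp: precedes_def)
    moreover define w where
      "w = (\<Prod>j\<in>{j\<in>K. precedes \<beta> j r} - {j\<in>K. c < \<beta> j}. x a - z j)"
    ultimately have um: "u = w * m"
      unfolding u using K(1) by (subst prod.subset_diff[of "{j\<in>K. c < \<beta> j}"]) auto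
    have "w \<in> C" unfolding w_def using x zC by (intro subring_intros C) auto
    then have wP: "[:w:] \<in> polys_over C" by (simp add: const_in_polys_over[OF C])
    have "[:w:] * (M * (F - D * G) - D * (Q * ([:- x a, 1:] * G - E * H))) \<in> polys_over I"
      by (intro ideal_diff[OF PI] ideal_mult[OF PI] wP G Q DC)
    also have "[:w:] * (M * (F - D * G) - D * (Q * ([:- x a, 1:] * G - E * H)))
        = [:u:] * F - D' * ([:w:] * (G - Q * H))"
    proof -
      have uw: "[:u:] = [:w:] * M" by (simp add: um m mult.commute)
      have M: "M = E - [:- x a, 1:] * Q" using Q(3) by (metis add_diff_cancel_left')
      have "W * (N * (F - D * G) - D * (Q * (X * G - E * H))) = U * F - D * E * (W * (G - Q * H))"
        if "U = W * N" "N = E - X * Q" for U W N X :: "'a poly"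
        unfolding that by (simp only: algebra_simps)
      from this[OF uw M] show ?thesis unfolding D' .
    qed
    finally have "[:u:] * F - D' * ([:w:] * (G - Q * H)) \<in> polys_over I'" using PII' by auto
    moreover have "[:w:] * (G - Q * H) \<in> polys_over C"
      by (intro subring_mult[OF PC] subring_diff[OF PC] wP G Q H)
    ultimately show ?thesis by blast
  qed
  then obtain L where L: "L \<in> polys_over C" "[:u:] * F - D' * L \<in> polys_over I'" by blast
  obtain G' M where GM: "G' \<in> polys_over C'" "M \<in> polys_over C'" "F = D' * G' + M"
    "\<And>i. degree D' \<le> i \<Longrightarrow> coeff M i = 0"
    using monic_division[OF C'(1) D'C' D'1 F] by blast
  have "[:u:] * M \<in> polys_over I'"
  proof (rule remainder_unique[OF I' _ D'1])
    show "D' \<in> polys_over C" using D'C' over by blast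
    show "coeff ([:u:] * M) i = 0" if "degree D' \<le> i" for i using GM(4)[OF that] by simp
    have "[:u:] * M - D' * (L - [:u:] * G') = [:u:] * F - D' * L"
      unfolding GM(3) by (simp only: algebra_simps)
    then show "[:u:] * M - D' * (L - [:u:] * G') \<in> polys_over I'" using L by simp
  qed
  then have "u * coeff M i \<in> I'" for i by (simp add: polys_over_iff)
  then have "M \<in> polys_over J"
    using GM(2) by (auto simp: J I'_def v_def polys_over_iff)
  then show "\<exists>G\<in>polys_over C'. variable_poly x S
      - divisor_poly z K (\<beta>(r := \<beta> r - 1)) (card (A - S)) * G \<in> polys_over J"
    using GM(1,3) unfolding F_def D'_def c_def by (intro bexI[of _ G']) auto
qed


section \<open>The Springer products span\<close>

inductive_set lin_span :: "'a::comm_ring_1 set \<Rightarrow> 'a set \<Rightarrow> 'a set" for R X where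
  span_zero: "0 \<in> lin_span R X"
| span_step: "v \<in> lin_span R X \<Longrightarrow> c \<in> R \<Longrightarrow> b \<in> X \<Longrightarrow> v + c * b \<in> lin_span R X"

lemma span_add: "w \<in> lin_span R X \<Longrightarrow> v \<in> lin_span R X \<Longrightarrow> v + w \<in> lin_span R X"
proof (induction rule: lin_span.induct)
  case (span_step w c b)
  then show ?case using lin_span.span_step[of "v + w" R X c b] by (simp add: add.assoc)
qed simp

lemma span_image:
  assumes "v \<in> lin_span R X" "\<And>b. b \<in> X \<Longrightarrow> u * b \<in> Y"
  shows "u * v \<in> lin_span R Y"
  using assms(1)
proof induction
  case (span_step v c b)
  then show ?case using lin_span.span_step[OF span_step.IH span_step.hyps(2) assms(2)]
    by (simp add: algebra_simps)
qed (simp add: span_zero)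

lemma span_eq_sum:
  assumes R: "is_subring R" and F: "finite F" and v: "v \<in> lin_span R (P ` F)"
  shows "\<exists>c\<in>F \<rightarrow> R. v = (\<Sum>f\<in>F. c f * P f)"
  using v
proof induction
  case span_zero
  show ?case using subring_zero[OF R] by (intro bexI[of _ "\<lambda>_. 0"]) auto
next
  case (span_step v d b)
  then obtain c f where c: "c \<in> F \<rightarrow> R" "v = (\<Sum>f\<in>F. c f * P f)" and f: "f \<in> F" "b = P f" by auto
  show ?case
  proof (intro bexI[of _ "\<lambda>g. c g + (if g = f then d else 0)"])
    have "(\<Sum>g\<in>F. (if g = f then d else 0) * P g) = (\<Sum>g\<in>F. if g = f then d * P g else 0)"
      by (intro sum.cong) auto
    also have "\<dots> = d * P f" using f F by simp
    finally show "v + d * b = (\<Sum>g\<in>F. (c g + (if g = f then d else 0)) * P g)"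
      using f c by (simp add: distrib_right sum.distrib)
    show "(\<lambda>g. c g + (if g = f then d else 0)) \<in> F \<rightarrow> R"
      using c(1) span_step.hyps(2) subring_zero[OF R] by (intro Pi_I subring_add[OF R]) auto
  qed
qed

text \<open>
Only the values on \<open>{m<..n}\<close> matter; words are not made extensional, so that a letter can be prepended
by a plain function update.
\<close>

definition words :: "nat set \<Rightarrow> (nat \<Rightarrow> nat) \<Rightarrow> nat \<Rightarrow> nat \<Rightarrow> (nat \<Rightarrow> nat) set" where
  "words K \<beta> m n =
     {f. (\<forall>i\<in>{m<..n}. f i \<in> K) \<and> (\<forall>j\<in>K. card {i\<in>{m<..n}. f i = j} = \<beta> j)}"

text \<open>
For the word of a tableau this is the number of entries \<open>\<ge> i\<close> in row \<open>j\<close>.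
\<close>

definition remaining :: "nat \<Rightarrow> (nat \<Rightarrow> nat) \<Rightarrow> nat \<Rightarrow> nat \<Rightarrow> nat" where
  "remaining n f i j = card {p\<in>{i..n}. f p = j}"

definition springer_rows :: "nat set \<Rightarrow> nat \<Rightarrow> (nat \<Rightarrow> nat) \<Rightarrow> nat \<Rightarrow> nat set" where
  "springer_rows K n f i = {j\<in>K. precedes (remaining n f i) j (f i)}"

definition springer_prod ::
  "(nat \<Rightarrow> 'a::comm_ring_1) \<Rightarrow> nat set \<Rightarrow> (nat \<Rightarrow> 'a) \<Rightarrow> nat \<Rightarrow> nat \<Rightarrow> (nat \<Rightarrow> nat) \<Rightarrow> 'a" where
  "springer_prod z K x n m f = (\<Prod>i\<in>{m<..n}. \<Prod>j\<in>springer_rows K n f i. x i - z j)"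

lemma greaterThanAtMost_insert: "m < n \<Longrightarrow> {m<..n} = insert (Suc m) {Suc m<..n}"
  by auto

lemma words_prepend:
  assumes f: "f \<in> words K (\<beta>(r := \<beta> r - 1)) (Suc m) n" and r: "r \<in> K" "0 < \<beta> r" and mn: "m < n"
  shows "f(Suc m := r) \<in> words K \<beta> m n"
proof -
  have "card {i \<in> {m<..n}. (f(Suc m := r)) i = j} = \<beta> j" if "j \<in> K" for j
  proof -
    have *: "card {i \<in> {Suc m<..n}. f i = j} = (\<beta>(r := \<beta> r - 1)) j"
      using f that unfolding words_def by blast
    have "{i \<in> {m<..n}. (f(Suc m := r)) i = j}
        = (if j = r then insert (Suc m) else id) {i \<in> {Suc m<..n}. f i = j}"
      using mn by auto
    also have "card \<dots> = \<beta> j" using * r by (auto simp: card_insert_if)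
    finally show ?thesis .
  qed
  then show ?thesis using f r mn unfolding words_def greaterThanAtMost_insert[OF mn] by auto
qed

lemma springer_prod_prepend:
  assumes f: "f(Suc m := r) \<in> words K \<beta> m n" and r: "r \<in> K" and mn: "m < n"
  shows "springer_prod z K x n m (f(Suc m := r)) =
     (\<Prod>j\<in>{j\<in>K. precedes \<beta> j r}. x (Suc m) - z j) * springer_prod z K x n (Suc m) f"
proof -
  let ?g = "f(Suc m := r)"
  have "{Suc m..n} = {m<..n}" by auto
  then have "remaining n ?g (Suc m) j = \<beta> j" if "j \<in> K" for j
    using f that by (simp add: remaining_def words_def)
  then have first: "springer_rows K n ?g (Suc m) = {j\<in>K. precedes \<beta> j r}"
    using r by (auto simp: springer_rows_def precedes_def)
  have "{p\<in>{i..n}. ?g p = j} = {p\<in>{i..n}. f p = j}" if "Suc m < i" for i j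
    using that by auto
  then have "springer_rows K n ?g i = springer_rows K n f i" if "Suc m < i" for i
    using that by (auto simp: springer_rows_def precedes_def remaining_def)
  then show ?thesis
    unfolding springer_prod_def greaterThanAtMost_insert[OF mn]
    by (subst prod.insert) (auto simp: first intro!: prod.cong)
qed

text \<open>
Among the rows of maximal length, take the topmost one.
\<close>

lemma exists_minimal_row:
  assumes "finite X" "X \<noteq> {}"
  shows "\<exists>r\<in>X. \<forall>j\<in>X. \<not> precedes \<beta> j r"
proof -
  define b where "b = Max (\<beta> ` X)"
  define Y where "Y = {j\<in>X. \<beta> j = b}"
  have "b \<in> \<beta> ` X" unfolding b_def using assms by (intro Max_in) auto
  then have Y: "finite Y" "Y \<noteq> {}" using assms by (auto simp: Y_def)
  have "\<not> precedes \<beta> j (Min Y)" if j: "j \<in> X" for j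
  proof -
    have "\<beta> j \<le> b" unfolding b_def using assms j by (intro Max_ge) auto
    moreover have "\<beta> (Min Y) = b" using Min_in[OF Y] by (auto simp: Y_def)
    moreover have "Min Y \<le> j" if "\<beta> j = b" using Y j that by (intro Min_le) (auto simp: Y_def)
    ultimately show ?thesis by (auto simp: precedes_def)
  qed
  moreover have "Min Y \<in> X" using Min_in[OF Y] by (auto simp: Y_def)
  ultimately show ?thesis by blast
qed

lemma precedes_total: "j \<noteq> r \<Longrightarrow> precedes \<beta> j r \<or> precedes \<beta> r j"
  by (auto simp: precedes_def)

text \<open>
The outer induction is on the number of variables, with arbitrary \<open>\<beta>\<close> and \<open>I\<close>. The inner induction
shows, for every initial segment \<open>Q\<close> of the nonempty rows, that all multiples of the Newton product of
\<open>Q\<close> lie in the span modulo \<open>I\<close>; it starts with the set of all nonempty rows and ends with \<open>Q = {}\<close>.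
In the step, \<open>r\<close> is the first row outside \<open>Q\<close>. A multiplier \<open>g\<close> is split as \<open>g0 + (x - z\<^sub>r) g1\<close> with \<open>g0\<close>
free of the first variable \<open>x\<close>. By the outer induction hypothesis for the ideal \<open>J\<close>, the part \<open>g0\<close> is a combination
of products for the shortened composition, up to an error in \<open>J\<close>, and both this error and \<open>g1\<close>
contribute multiples of the Newton product of \<open>insert r Q\<close>.
\<close>

theorem springer_prods_span:
  fixes x z :: "nat \<Rightarrow> 'a::comm_ring_1"
  assumes R: "is_subring R" and K: "finite K" "\<And>j. j \<in> K \<Longrightarrow> z j \<in> R"
    and "m \<le> n" "is_ideal (adjoin (R \<union> x ` {m<..n})) I"
    and "tanisaki (adjoin (R \<union> x ` {m<..n})) I z K x \<beta> {m<..n}"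
    and "(\<Sum>j\<in>K. \<beta> j) = n - m" and "h \<in> adjoin (R \<union> x ` {m<..n})"
  shows "\<exists>v\<in>lin_span R (springer_prod z K x n m ` words K \<beta> m n). h - v \<in> I"
  using assms(4-)
proof (induction "n - m" arbitrary: m \<beta> I h)
  case 0
  then have mn: "m = n" by simp
  have "h \<in> R" using 0 adjoin_subset[OF R, of "R \<union> x ` {m<..n}"] by (auto simp: mn)
  have "(\<lambda>_. 0) \<in> words K \<beta> m n" using 0 K by (auto simp: words_def mn)
  then have "1 \<in> springer_prod z K x n m ` words K \<beta> m n"
    by (rule rev_image_eqI) (simp add: springer_prod_def mn)
  from span_step[OF span_zero \<open>h \<in> R\<close> this] show ?case
    using ideal_zero[OF 0(3)] by (intro bexI[of _ h]) auto
next
  case (Suc d)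
  then have mn: "m < n" by simp
  define X where "X = R \<union> x ` {Suc m<..n}"
  define C where "C = adjoin (insert (x (Suc m)) X)"
  define C' where "C' = adjoin X"
  have C_eq: "adjoin (R \<union> x ` {m<..n}) = C"
    unfolding C_def X_def greaterThanAtMost_insert[OF mn] by simp
  have I: "is_ideal C I" and h: "h \<in> C" using Suc.prems C_eq by auto
  have T: "tanisaki C I z K x \<beta> (insert (Suc m) {Suc m<..n})"
    using Suc.prems(3)[unfolded C_eq] unfolding greaterThanAtMost_insert[OF mn] .
  have size: "(\<Sum>j\<in>K. \<beta> j) = card (insert (Suc m) {Suc m<..n})"
    using Suc.prems(4) unfolding greaterThanAtMost_insert[OF mn, symmetric] by simp
  note CR = ideal_subring[OF I]
  have C'R: "is_subring C'" unfolding C'_def by (rule subring_adjoin)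
  have C'C: "C' \<subseteq> C" unfolding C'_def C_def by (intro adjoin_mono) auto
  have zC': "z j \<in> C'" if "j \<in> K" for j
    using K(2)[OF that] by (auto simp: C'_def X_def intro: adjoin_base)
  have zC: "z j \<in> C" if "j \<in> K" for j using zC'[OF that] C'C by blast
  have x: "x (Suc m) \<in> C" "\<And>i. i \<in> {Suc m<..n} \<Longrightarrow> x i \<in> C'"
    by (auto simp: C_def C'_def X_def intro: adjoin_base)
  have xC: "x i \<in> C" if "i \<in> {Suc m<..n}" for i using x(2)[OF that] C'C by blast
  define N where "N = (\<lambda>Q. \<Prod>j\<in>Q. x (Suc m) - z j)"
  define B where "B = lin_span R (springer_prod z K x n m ` words K \<beta> m n)"
  define pos where "pos = {j\<in>K. 0 < \<beta> j}"
  have fin: "finite pos" using K by (simp add: pos_def)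
  have "\<exists>v\<in>B. N Q * g - v \<in> I"
    if "Q \<subseteq> pos" "\<And>j r. r \<in> Q \<Longrightarrow> j \<in> K \<Longrightarrow> precedes \<beta> j r \<Longrightarrow> j \<in> Q" "g \<in> C" for Q g
    using that
  proof (induction "card (pos - Q)" arbitrary: Q g rule: less_induct)
    case less
    show ?case
    proof (cases "Q = pos")
      case True
      have "N pos \<in> I" unfolding N_def pos_def
        using leading_newton_product_in_ideal[OF I K(1) zC _ _ x(1) xC T size] by auto
      then have "N Q * g \<in> I" using less.prems ideal_mult_right[OF I] True by blast
      then show ?thesis by (intro bexI[of _ 0]) (auto simp: B_def span_zero)
    next
      case False
      then have "pos - Q \<noteq> {}" using less.prems by blast
      then obtain r where r: "r \<in> pos - Q" "\<And>j. j \<in> pos - Q \<Longrightarrow> \<not> precedes \<beta> j r"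
        using exists_minimal_row[of "pos - Q" \<beta>] fin by blast
      have rK: "r \<in> K" "0 < \<beta> r" using r by (auto simp: pos_def)
      have Q: "Q = {j\<in>K. precedes \<beta> j r}"
      proof (intro equalityI subsetI)
        fix j assume j: "j \<in> Q"
        then have "\<not> precedes \<beta> r j" using less.prems(2)[OF j rK(1)] r by blast
        then show "j \<in> {j\<in>K. precedes \<beta> j r}"
          using precedes_total[of j r \<beta>] j r less.prems(1) by (auto simp: pos_def)
      next
        fix j assume j: "j \<in> {j\<in>K. precedes \<beta> j r}"
        then have "j \<in> pos" using rK by (auto simp: pos_def precedes_def)
        then show "j \<in> Q" using r(2)[of j] j by blast
      qed
      define u where "u = (\<Prod>j\<in>{j\<in>K. precedes \<beta> j r}. x (Suc m) - z j)"
      have uN: "u = N Q" by (simp add: u_def N_def Q)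
      have Nr: "N (insert r Q) = u * (x (Suc m) - z r)"
        using r(1) finite_subset[OF less.prems(1) fin] unfolding uN N_def
        by (subst prod.insert) (auto simp: mult.commute)
      define J where "J = {q\<in>C'. \<exists>h\<in>C. u * q - u * (x (Suc m) - z r) * h \<in> I}"
      define \<beta>' where "\<beta>' = \<beta>(r := \<beta> r - 1)"
      have uC: "u \<in> C" unfolding u_def using x zC by (intro subring_intros CR) auto
      have J: "is_ideal C' J" unfolding J_def
        using x zC rK uC by (intro is_ideal_colon I C'R C'C subring_intros CR)
      have TJ: "tanisaki C' J z K x \<beta>' {Suc m<..n}" unfolding \<beta>'_def
        by (rule tanisaki_descends[OF I C'R C'C K(1) zC' _ _ x T rK(1) u_def J_def]) auto
      obtain g0 g1 where g: "g0 \<in> C'" "g1 \<in> C" "g = g0 + (x (Suc m) - z r) * g1"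
        using adjoin_insert_split[of "z r" X g "x (Suc m)"] less.prems(3) zC'[OF rK(1)]
        unfolding C'_def C_def by blast
      have size': "(\<Sum>j\<in>K. \<beta>' j) = n - Suc m"
        using Suc.prems(4) rK K(1) unfolding \<beta>'_def by (simp add: sum.remove[of K r])
      have "d = n - Suc m" "Suc m \<le> n" using Suc.hyps(2) mn by auto
      from Suc.hyps(1)[OF this J[unfolded C'_def X_def] TJ[unfolded C'_def X_def] size'
          g(1)[unfolded C'_def X_def]]
      obtain v where v: "v \<in> lin_span R (springer_prod z K x n (Suc m) ` words K \<beta>' (Suc m) n)"
        "g0 - v \<in> J" by blast
      have uv: "u * v \<in> B" unfolding B_def
      proof (rule span_image[OF v(1)])
        fix b assume "b \<in> springer_prod z K x n (Suc m) ` words K \<beta>' (Suc m) n"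
        then obtain f where f: "f \<in> words K \<beta>' (Suc m) n" "b = springer_prod z K x n (Suc m) f"
          by blast
        have "f(Suc m := r) \<in> words K \<beta> m n"
          using words_prepend[OF f(1)[unfolded \<beta>'_def] rK mn] .
        from this springer_prod_prepend[OF this rK(1) mn, of z x]
        show "u * b \<in> springer_prod z K x n m ` words K \<beta> m n"
          unfolding f(2) u_def by (metis imageI)
      qed
      obtain h1 where h1: "h1 \<in> C" "u * (g0 - v) - u * (x (Suc m) - z r) * h1 \<in> I"
        using v(2) unfolding J_def by blast
      have "card (pos - insert r Q) < card (pos - Q)"
        using r fin by (intro psubset_card_mono) auto
      moreover have "insert r Q \<subseteq> pos" using r less.prems by blast
      moreover have "j \<in> insert r Q" if "r' \<in> insert r Q" "j \<in> K" "precedes \<beta> j r'" for j r'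
        using that less.prems(2) Q by blast
      moreover have "g1 + h1 \<in> C" using g h1 by (intro subring_add[OF CR])
      ultimately obtain w where w: "w \<in> B" "N (insert r Q) * (g1 + h1) - w \<in> I"
        using less.hyps[of "insert r Q" "g1 + h1"] by blast
      have "(u * (g0 - v) - u * (x (Suc m) - z r) * h1) + (N (insert r Q) * (g1 + h1) - w) \<in> I"
        using h1 w ideal_add[OF I] by blast
      also have "(u * (g0 - v) - u * (x (Suc m) - z r) * h1) + (N (insert r Q) * (g1 + h1) - w)
          = N Q * g - (u * v + w)"
        unfolding Nr g(3) uN[symmetric] by (simp add: algebra_simps)
      finally show ?thesis
        using span_add[of w R _ "u * v"] w uv unfolding B_def by blast
    qed
  qed
  from this[of "{}" h] h show ?case by (simp add: N_def B_def)
qed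


section \<open>Evaluation of polynomials in the indeterminates\<close>

definition polys_in :: "indet set \<Rightarrow> polynomial set" where
  "polys_in V = {p. indets p \<subseteq> V}"

definition Const :: "complex \<Rightarrow> polynomial" where
  "Const c = Poly_Mapping.single 0 c"

lemma poly_mapping_eq_sum_single:
  "p = (\<Sum>k\<in>Poly_Mapping.keys p. Poly_Mapping.single k (Poly_Mapping.lookup p k))"
proof (rule poly_mapping_eqI)
  fix k
  have "(\<Sum>l\<in>Poly_Mapping.keys p. Poly_Mapping.lookup p l when l = k)
      = (\<Sum>l\<in>Poly_Mapping.keys p. if l = k then Poly_Mapping.lookup p k else 0)"
    by (intro sum.cong) (auto simp: when_def)
  then show "Poly_Mapping.lookup p k = Poly_Mapping.lookup
      (\<Sum>k\<in>Poly_Mapping.keys p. Poly_Mapping.single k (Poly_Mapping.lookup p k)) k"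
    by (simp add: lookup_sum lookup_single in_keys_iff)
qed

lemma prod_single:
  "(\<Prod>v\<in>V. Poly_Mapping.single (f v) (1::'b::comm_semiring_1))
    = Poly_Mapping.single (\<Sum>v\<in>V. f v :: 'a::comm_monoid_add) 1"
  by (induction V rule: infinite_finite_induct) (auto simp: mult_single)

lemma Var_power: "Var v ^ e = Poly_Mapping.single (Poly_Mapping.single v e) 1"
  by (induction e) (auto simp: Var_def mult_single single_add[symmetric])

lemma single_eq_prod_Var:
  "Poly_Mapping.single m c = Const c * (\<Prod>v\<in>Poly_Mapping.keys m. Var v ^ Poly_Mapping.lookup m v)"
  unfolding Var_power prod_single poly_mapping_eq_sum_single[symmetric]
  by (simp add: Const_def mult_single)

definition eval_monomial :: "(indet \<Rightarrow> complex) \<Rightarrow> (indet \<Rightarrow>\<^sub>0 nat) \<Rightarrow> complex" where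
  "eval_monomial a m = (\<Prod>v\<in>Poly_Mapping.keys m. a v ^ Poly_Mapping.lookup m v)"

lemma eval_monomial_superset:
  "finite V \<Longrightarrow> Poly_Mapping.keys m \<subseteq> V \<Longrightarrow>
    eval_monomial a m = (\<Prod>v\<in>V. a v ^ Poly_Mapping.lookup m v)"
  unfolding eval_monomial_def by (intro prod.mono_neutral_left) (auto simp: in_keys_iff)

lemma eval_monomial_add: "eval_monomial a (m + m') = eval_monomial a m * eval_monomial a m'"
proof -
  let ?V = "Poly_Mapping.keys m \<union> Poly_Mapping.keys m'"
  have "Poly_Mapping.keys (m + m') \<subseteq> ?V" by (rule keys_add)
  then show ?thesis
    by (simp add: eval_monomial_superset[of ?V] lookup_add power_add prod.distrib)
qed

lemma eval_poly_superset:
  "finite M \<Longrightarrow> Poly_Mapping.keys p \<subseteq> M \<Longrightarrow>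
    eval_poly a p = (\<Sum>m\<in>M. Poly_Mapping.lookup p m * eval_monomial a m)"
  unfolding eval_poly_def eval_monomial_def[symmetric]
  by (intro sum.mono_neutral_left) (auto simp: in_keys_iff)

lemma eval_add: "eval_poly a (p + q) = eval_poly a p + eval_poly a q"
proof -
  let ?M = "Poly_Mapping.keys p \<union> Poly_Mapping.keys q"
  have "Poly_Mapping.keys (p + q) \<subseteq> ?M" by (rule keys_add)
  then show ?thesis
    by (simp add: eval_poly_superset[of ?M] lookup_add distrib_right sum.distrib)
qed

lemma eval_zero: "eval_poly a 0 = 0"
  by (simp add: eval_poly_def)

lemma eval_sum: "eval_poly a (\<Sum>i\<in>A. f i) = (\<Sum>i\<in>A. eval_poly a (f i))"
  by (induction A rule: infinite_finite_induct) (auto simp: eval_add eval_zero)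

lemma eval_single: "eval_poly a (Poly_Mapping.single m c) = c * eval_monomial a m"
  by (simp add: eval_poly_def eval_monomial_def)

lemma eval_mult: "eval_poly a (p * q) = eval_poly a p * eval_poly a q"
proof -
  let ?s = "\<lambda>p k. Poly_Mapping.single k (Poly_Mapping.lookup p k) :: polynomial"
  have "p * q = (\<Sum>k\<in>Poly_Mapping.keys p. ?s p k) * (\<Sum>l\<in>Poly_Mapping.keys q. ?s q l)"
    using poly_mapping_eq_sum_single[of p] poly_mapping_eq_sum_single[of q] by simp
  also have "eval_poly a \<dots> = (\<Sum>k\<in>Poly_Mapping.keys p. eval_poly a (?s p k)) *
      (\<Sum>l\<in>Poly_Mapping.keys q. eval_poly a (?s q l))"
    by (simp add: sum_product eval_sum mult_single eval_single eval_monomial_add mult_ac)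
  also have "\<dots> = eval_poly a p * eval_poly a q"
    by (simp only: eval_sum[symmetric] poly_mapping_eq_sum_single[symmetric])
  finally show ?thesis .
qed

lemma eval_one: "eval_poly a 1 = 1"
  using eval_single[of a 0 1] by (simp add: eval_monomial_def)

lemma eval_diff: "eval_poly a (p - q) = eval_poly a p - eval_poly a q"
  using eval_add[of a "p - q" q] by simp

lemma eval_prod: "eval_poly a (\<Prod>i\<in>A. f i) = (\<Prod>i\<in>A. eval_poly a (f i))"
  by (induction A rule: infinite_finite_induct) (auto simp: eval_mult eval_one)

lemma eval_power: "eval_poly a (p ^ n) = eval_poly a p ^ n"
  by (induction n) (auto simp: eval_mult eval_one)

lemma eval_Var: "eval_poly a (Var v) = a v"
  by (simp add: Var_def eval_single eval_monomial_def)

lemma eval_Const: "eval_poly a (Const c) = c"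
  by (simp add: Const_def eval_single eval_monomial_def)

lemmas eval_simps =
  eval_add eval_zero eval_sum eval_mult eval_one eval_diff eval_prod eval_power eval_Var eval_Const

lemma eval_cong: "p \<in> polys_in V \<Longrightarrow> (\<And>v. v \<in> V \<Longrightarrow> a v = b v) \<Longrightarrow> eval_poly a p = eval_poly b p"
  unfolding eval_poly_def polys_in_def indets_def
  by (intro sum.cong prod.cong refl arg_cong2[of _ _ _ _ "(*)"] arg_cong2[of _ _ _ _ "(^)"]) auto

lemma subring_polys_in: "is_subring (polys_in V)"
proof -
  have "indets (p - q) \<subseteq> indets p \<union> indets q" for p q
    using keys_diff[of p q] by (auto simp: indets_def)
  moreover have "indets (p * q) \<subseteq> indets p \<union> indets q" for p q
  proof
    fix v assume "v \<in> indets (p * q)"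
    then obtain m where m: "m \<in> Poly_Mapping.keys (p * q)" "v \<in> Poly_Mapping.keys m"
      by (auto simp: indets_def)
    then obtain k l where "m = k + l" "k \<in> Poly_Mapping.keys p" "l \<in> Poly_Mapping.keys q"
      using keys_mult[of p q] by blast
    then show "v \<in> indets p \<union> indets q"
      using m(2) keys_add[of k l] by (auto simp: indets_def)
  qed
  moreover have "indets 1 = {}" by (simp add: indets_def)
  ultimately show ?thesis unfolding is_subring_def polys_in_def by blast
qed

lemma Const_in_polys: "Const c \<in> polys_in V"
  by (simp add: polys_in_def indets_def Const_def)

lemma Var_in_polys: "v \<in> V \<Longrightarrow> Var v \<in> polys_in V"
  by (simp add: polys_in_def indets_def Var_def)

lemma polys_in_mono: "V \<subseteq> W \<Longrightarrow> polys_in V \<subseteq> polys_in W"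
  by (auto simp: polys_in_def)

lemma polys_in_eq_adjoin: "polys_in V = adjoin (range Const \<union> Var ` V)"
proof
  show "adjoin (range Const \<union> Var ` V) \<subseteq> polys_in V"
    by (intro adjoin_subset subring_polys_in) (auto simp: Const_in_polys Var_in_polys)
  show "polys_in V \<subseteq> adjoin (range Const \<union> Var ` V)"
  proof
    fix p assume "p \<in> polys_in V"
    then have "Poly_Mapping.keys m \<subseteq> V" if "m \<in> Poly_Mapping.keys p" for m
      using that by (auto simp: polys_in_def indets_def)
    then have "(\<Sum>m\<in>Poly_Mapping.keys p. Poly_Mapping.single m (Poly_Mapping.lookup p m))
        \<in> adjoin (range Const \<union> Var ` V)"
      unfolding single_eq_prod_Var
      by (intro subring_sum subring_mult subring_prod subring_power subring_adjoin)
         (auto intro!: adjoin_base)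
    then show "p \<in> adjoin (range Const \<union> Var ` V)"
      unfolding poly_mapping_eq_sum_single[symmetric] .
  qed
qed

lemma polys_in_Un: "polys_in (V \<union> W) = adjoin (polys_in V \<union> Var ` W)"
proof
  show "adjoin (polys_in V \<union> Var ` W) \<subseteq> polys_in (V \<union> W)"
    using polys_in_mono[of V "V \<union> W"]
    by (intro adjoin_subset subring_polys_in) (auto simp: Var_in_polys)
  show "polys_in (V \<union> W) \<subseteq> adjoin (polys_in V \<union> Var ` W)"
    unfolding polys_in_eq_adjoin[of "V \<union> W"]
    by (intro adjoin_mono) (auto simp: Var_in_polys Const_in_polys)
qed

text \<open>
Induction on the indeterminates. With the values of the others fixed, \<open>p\<close> is a univariate polynomial
that vanishes at all but finitely many points; testing only injective assignments thus costs nothing,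
and it is what the triangularity argument provides.
\<close>

lemma polynomial_identity:
  assumes "finite V" "p \<in> polys_in V" "\<And>a. inj_on a V \<Longrightarrow> eval_poly a p = 0"
  shows "p = 0"
  using assms
proof (induction V arbitrary: p)
  case empty
  have p: "p = (\<Sum>m\<in>Poly_Mapping.keys p. Poly_Mapping.single m (Poly_Mapping.lookup p m))"
    by (rule poly_mapping_eq_sum_single)
  have "Poly_Mapping.keys p \<subseteq> {0}"
    using empty(1) by (auto simp: polys_in_def indets_def)
  then have "p = Const (Poly_Mapping.lookup p 0)"
    by (intro poly_mapping_eqI) (auto simp: Const_def lookup_single when_def in_keys_iff)
  moreover have "eval_poly (\<lambda>_. 0) p = 0" using empty(2) by simp
  ultimately show ?case by (metis eval_Const Const_def single_zero)
next
  case (insert v V)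
  have "adjoin (range Const \<union> Var ` insert v V) = adjoin (insert (Var v) (range Const \<union> Var ` V))"
    by (rule arg_cong[of _ _ adjoin]) auto
  then obtain Q where Q: "Q \<in> polys_over (polys_in V)" "p = poly Q (Var v)"
    using adjoin_insert_poly insert.prems(1) unfolding polys_in_eq_adjoin by metis
  have "coeff Q i = 0" for i
  proof (cases "i \<le> degree Q")
    case True
    show ?thesis
    proof (rule insert.IH)
      show "coeff Q i \<in> polys_in V" using Q(1) by (simp add: polys_over_iff)
      fix a :: "indet \<Rightarrow> complex" assume a: "inj_on a V"
      define W where "W = (\<Sum>i\<le>degree Q. monom (eval_poly a (coeff Q i)) i)"
      have root: "poly W t = 0" if t: "t \<notin> a ` V" for t
      proof -
        have "inj_on (a(v := t)) (insert v V)"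
          using a t insert.hyps(2) by (auto simp: inj_on_def)
        then have "eval_poly (a(v := t)) p = 0" by (rule insert.prems)
        moreover have "eval_poly (a(v := t)) (coeff Q i) = eval_poly a (coeff Q i)" for i
          using Q(1) insert.hyps(2) by (intro eval_cong[of _ V]) (auto simp: polys_over_iff)
        ultimately show ?thesis
          by (simp add: Q(2) poly_altdef[of Q] eval_simps W_def poly_sum poly_monom)
      qed
      have "infinite (UNIV - a ` V)"
        using insert.hyps(1) infinite_UNIV_char_0[where 'a = complex] by (intro Diff_infinite_finite) auto
      then have "infinite {t. poly W t = 0}"
        using root infinite_super[of "UNIV - a ` V" "{t. poly W t = 0}"] by auto
      then have "W = 0" using poly_roots_finite by blast
      then have "coeff W i = 0" by simp
      then show "eval_poly a (coeff Q i) = 0"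
        using True by (simp add: W_def coeff_sum)
    qed
  qed (simp add: coeff_eq_0)
  then show ?case by (simp add: Q(2) poly_eq_iff poly_altdef)
qed


section \<open>The points of the variety and independence\<close>

lemma ideal_prod_cong:
  assumes I: "is_ideal C I"
    and "\<And>i. i \<in> S \<Longrightarrow> f i \<in> C" "\<And>i. i \<in> S \<Longrightarrow> g i \<in> C" "\<And>i. i \<in> S \<Longrightarrow> f i - g i \<in> I"
  shows "(\<Prod>i\<in>S. f i) - (\<Prod>i\<in>S. g i) \<in> I"
  using assms(2-)
proof (induction S rule: infinite_finite_induct)
  case (insert a S)
  note C = ideal_subring[OF I]
  have "(f a - g a) * prod f S + g a * (prod f S - prod g S) \<in> I"
    using insert by (intro ideal_add[OF I] ideal_mult[OF I] ideal_mult_right[OF I] subring_prod[OF C]) auto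
  also have "(f a - g a) * prod f S + g a * (prod f S - prod g S) = f a * prod f S - g a * prod g S"
    by (simp add: algebra_simps)
  finally show ?case using insert.hyps by simp
qed (use ideal_zero[OF I] in auto)

definition constrained :: "nat set \<Rightarrow> (nat \<Rightarrow> nat) \<Rightarrow> (nat \<Rightarrow> complex) \<Rightarrow> bool" where
  "constrained K \<beta> z \<longleftrightarrow> (\<Sum>j\<in>K. of_nat (\<beta> j) * z j) = 0"

text \<open>
The point of \<open>Z\<^sub>\<alpha>\<close> over \<open>z\<close> whose \<open>i\<close>-th coordinate is \<open>z\<^sub>g\<^sub>(\<^sub>i\<^sub>)\<close>.
\<close>

definition word_point :: "(nat \<Rightarrow> complex) \<Rightarrow> (nat \<Rightarrow> nat) \<Rightarrow> indet \<Rightarrow> complex" where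
  "word_point z g = case_indet z (\<lambda>i. z (g i))"

definition zx_indets :: "nat set \<Rightarrow> nat \<Rightarrow> indet set" where
  "zx_indets K n = Zvar ` K \<union> Xvar ` {1..n}"

text \<open>
The preimage in \<open>\<complex>[z, x]\<close> of the vanishing ideal of \<open>Z\<^sub>\<alpha>\<close>.
\<close>

definition word_vanishing :: "nat set \<Rightarrow> (nat \<Rightarrow> nat) \<Rightarrow> nat \<Rightarrow> polynomial set" where
  "word_vanishing K \<beta> n = {p \<in> polys_in (zx_indets K n).
     \<forall>z g. constrained K \<beta> z \<longrightarrow> g \<in> words K \<beta> 0 n \<longrightarrow> eval_poly (word_point z g) p = 0}"

lemma ideal_zeros: "is_ideal (polys_in V) {p \<in> polys_in V. \<forall>a\<in>Z. eval_poly a p = 0}"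
  unfolding is_ideal_def using subring_polys_in[of V]
  by (auto simp: eval_simps subring_intros)

lemma word_vanishing_eq_zeros:
  "word_vanishing K \<beta> n = {p \<in> polys_in (zx_indets K n).
     \<forall>a\<in>{word_point z g | z g. constrained K \<beta> z \<and> g \<in> words K \<beta> 0 n}. eval_poly a p = 0}"
  by (auto simp: word_vanishing_def)

lemma ideal_word_vanishing: "is_ideal (polys_in (zx_indets K n)) (word_vanishing K \<beta> n)"
  unfolding word_vanishing_eq_zeros by (rule ideal_zeros)

text \<open>
At a single point the divisibility is clear, since every \<open>t - x\<^sub>i\<close> becomes some \<open>t - z\<^sub>j\<close> and at least
\<open>\<beta>\<^sub>j - c\<close> of the \<open>x\<^sub>i\<close> with \<open>i \<in> S\<close> equal \<open>z\<^sub>j\<close>. The cofactor found there depends on the point.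
A cofactor that works for all points is obtained by dividing over the polynomial ring; the coefficients
of the remainder then vanish at each point by uniqueness of remainders.
\<close>

lemma tanisaki_word_vanishing:
  assumes K: "finite K"
  shows "tanisaki (polys_in (zx_indets K n)) (word_vanishing K \<beta> n)
    (\<lambda>j. Var (Zvar j)) K (\<lambda>i. Var (Xvar i)) \<beta> {0<..n}"
  unfolding tanisaki_def
proof (intro allI impI)
  fix S assume S: "S \<subseteq> {0<..n}"
  define C where "C = polys_in (zx_indets K n)"
  define c where "c = card ({0<..n} - S)"
  let ?z = "\<lambda>j. Var (Zvar j)" and ?x = "\<lambda>i. Var (Xvar i)"
  define D where "D = divisor_poly ?z K \<beta> c"
  define F where "F = variable_poly ?x S"
  have C: "is_subring C" unfolding C_def by (rule subring_polys_in)
  have z: "?z j \<in> C" if "j \<in> K" for j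
    using that by (auto simp: C_def zx_indets_def intro: Var_in_polys)
  have x: "?x i \<in> C" if "i \<in> S" for i
    using that S by (auto simp: C_def zx_indets_def intro!: Var_in_polys)
  have D: "D \<in> polys_over C" "lead_coeff D = 1"
    unfolding D_def by (rule divisor_poly_over[OF C z], assumption) (rule divisor_poly_monic[OF K])
  have F: "F \<in> polys_over C" unfolding F_def using x by (intro variable_poly_over C)
  obtain G M where GM: "G \<in> polys_over C" "M \<in> polys_over C" "F = D * G + M"
    "\<And>i. degree D \<le> i \<Longrightarrow> coeff M i = 0"
    using monic_division[OF C D F] by blast
  have "eval_poly (word_point z g) (coeff M i) = 0" if g: "g \<in> words K \<beta> 0 n" for z g i
  proof -
    define I where "I = {p \<in> C. \<forall>a\<in>{word_point z g}. eval_poly a p = 0}"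
    have I: "is_ideal C I" unfolding I_def C_def by (rule ideal_zeros)
    note PC = subring_polys_over[OF C]
    have gK: "g i \<in> K" if "i \<in> S" for i using that g S by (auto simp: words_def)
    define e where "e = (\<lambda>j. card {i\<in>S. g i = j})"
    have finS: "finite S" using S by (rule finite_subset) simp
    have e: "\<beta> j - c \<le> e j" if "j \<in> K" for j
    proof -
      have "\<beta> j = card {i\<in>{0<..n}. g i = j}" using g that by (simp add: words_def)
      also have "\<dots> \<le> card ({i\<in>S. g i = j} \<union> ({0<..n} - S))"
        using S finS by (intro card_mono) auto
      also have "\<dots> \<le> e j + c" unfolding e_def c_def by (rule card_Un_le)
      finally show ?thesis by simp
    qed
    have "(\<Prod>i\<in>S. [:- ?z (g i), 1:]) = (\<Prod>j\<in>K. \<Prod>i\<in>{i\<in>S. g i = j}. [:- ?z (g i), 1:])"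
      using finS K gK by (intro prod.group[symmetric]) auto
    also have "\<dots> = (\<Prod>j\<in>K. [:- ?z j, 1:] ^ e j)"
      unfolding e_def by (intro prod.cong refl) (simp del: mult_pCons_left)
    also have "\<dots> = (\<Prod>j\<in>K. [:- ?z j, 1:] ^ (\<beta> j - c) * [:- ?z j, 1:] ^ (e j - (\<beta> j - c)))"
      using e by (intro prod.cong refl) (simp only: power_add[symmetric] le_add_diff_inverse)
    also have "\<dots> = D * (\<Prod>j\<in>K. [:- ?z j, 1:] ^ (e j - (\<beta> j - c)))"
      by (simp only: D_def divisor_poly_def prod.distrib)
    finally have split: "(\<Prod>i\<in>S. [:- ?z (g i), 1:])
      = D * (\<Prod>j\<in>K. [:- ?z j, 1:] ^ (e j - (\<beta> j - c)))" .
    have "F - (\<Prod>i\<in>S. [:- ?z (g i), 1:]) \<in> polys_over I"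
      unfolding F_def variable_poly_def
    proof (rule ideal_prod_cong[OF ideal_polys_over[OF I]])
      fix i assume i: "i \<in> S"
      show "[:- ?x i, 1:] \<in> polys_over C" "[:- ?z (g i), 1:] \<in> polys_over C"
        by (intro linear_in_polys_over C x z gK i)+
      have "?z (g i) - ?x i \<in> I"
        unfolding I_def using subring_diff[OF C z[OF gK[OF i]] x[OF i]]
        by (simp add: eval_simps word_point_def)
      then show "[:- ?x i, 1:] - [:- ?z (g i), 1:] \<in> polys_over I"
        by (auto simp: polys_over_iff coeff_pCons ideal_zero[OF I] split: nat.split)
    qed
    then have "M - D * ((\<Prod>j\<in>K. [:- ?z j, 1:] ^ (e j - (\<beta> j - c))) - G) \<in> polys_over I"
      unfolding split GM(3) by (simp add: algebra_simps)
    from remainder_unique[OF I D GM(4) this] show ?thesis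
      by (simp add: polys_over_iff I_def)
  qed
  then have "M \<in> polys_over (word_vanishing K \<beta> n)"
    using GM(2) by (auto simp: polys_over_iff word_vanishing_def C_def)
  moreover have "variable_poly ?x S - divisor_poly ?z K \<beta> (card ({0<..n} - S)) * G = M"
    using GM(3) unfolding F_def D_def c_def by simp
  ultimately show "\<exists>G\<in>polys_over (polys_in (zx_indets K n)).
      variable_poly ?x S - divisor_poly ?z K \<beta> (card ({0<..n} - S)) * G
        \<in> polys_over (word_vanishing K \<beta> n)"
    using GM(1) unfolding C_def by (intro bexI[of _ G]) simp_all
qed

definition springer_poly :: "nat set \<Rightarrow> nat \<Rightarrow> (nat \<Rightarrow> nat) \<Rightarrow> polynomial" where
  "springer_poly K n f = springer_prod (\<lambda>j. Var (Zvar j)) K (\<lambda>i. Var (Xvar i)) n 0 f"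

theorem springer_polys_span:
  assumes K: "finite K" "(\<Sum>j\<in>K. \<beta> j) = n" and p: "p \<in> polys_in (zx_indets K n)"
  shows "\<exists>v\<in>lin_span (polys_in (Zvar ` K)) (springer_poly K n ` words K \<beta> 0 n).
    p - v \<in> word_vanishing K \<beta> n"
proof -
  have "{0<..n} = {1..n}" by auto
  then have eq: "polys_in (zx_indets K n) =
      adjoin (polys_in (Zvar ` K) \<union> (\<lambda>i. Var (Xvar i)) ` {0<..n})"
    unfolding zx_indets_def polys_in_Un by (simp add: image_image)
  show ?thesis
    unfolding springer_poly_def
    by (rule springer_prods_span[where R = "polys_in (Zvar ` K)" and \<beta> = \<beta>])
       (use K p ideal_word_vanishing[of K n \<beta>] tanisaki_word_vanishing[OF K(1), of n \<beta>] eq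
         in \<open>auto intro: subring_polys_in Var_in_polys\<close>)
qed

lemma springer_poly_in_polys: "springer_poly K n f \<in> polys_in (zx_indets K n)"
  unfolding springer_poly_def springer_prod_def
  by (intro subring_prod subring_diff subring_polys_in)
     (auto simp: zx_indets_def springer_rows_def intro!: Var_in_polys)

lemma eval_springer_poly:
  "eval_poly (word_point z g) (springer_poly K n f)
    = (\<Prod>i\<in>{0<..n}. \<Prod>j\<in>springer_rows K n f i. z (g i) - z j)"
  by (simp add: springer_poly_def springer_prod_def eval_simps word_point_def)

lemma eval_springer_poly_nonzero_iff:
  assumes "finite K" "inj_on z K" "g \<in> words K \<beta> 0 n"
  shows "eval_poly (word_point z g) (springer_poly K n f) \<noteq> 0 \<longleftrightarrow>
    (\<forall>i\<in>{0<..n}. g i \<notin> springer_rows K n f i)"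
proof -
  have "finite (springer_rows K n f i)" for i using assms(1) by (simp add: springer_rows_def)
  moreover have "z (g i) = z j \<longleftrightarrow> g i = j" if "i \<in> {0<..n}" "j \<in> springer_rows K n f i" for i j
    using assms that by (auto simp: words_def springer_rows_def inj_on_eq_iff)
  ultimately show ?thesis by (auto simp: eval_springer_poly)
qed

lemma not_own_row: "f i \<notin> springer_rows K n f i"
  by (simp add: springer_rows_def precedes_def)

text \<open>
The letters from position \<open>i\<close> on are what the fixed content leaves after the first \<open>i - 1\<close> letters.
\<close>

lemma remaining_determined_by_prefix:
  assumes f: "f \<in> words K \<beta> 0 n" and g: "g \<in> words K \<beta> 0 n" and j: "j \<in> K"
    and agree: "\<And>p. 0 < p \<Longrightarrow> p < i \<Longrightarrow> f p = g p" and i: "i \<in> {0<..n}"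
  shows "remaining n f i j = remaining n g i j"
proof -
  have split: "card {p\<in>{0<..n}. h p = j} = card {p\<in>{0<..<i}. h p = j} + remaining n h i j"
    for h :: "nat \<Rightarrow> nat"
  proof -
    have *: "{p\<in>{0<..n}. h p = j} = {p\<in>{0<..<i}. h p = j} \<union> {p\<in>{i..n}. h p = j}"
      using i by auto
    show ?thesis unfolding remaining_def * by (rule card_Un_disjoint) auto
  qed
  have "{p\<in>{0<..<i}. f p = j} = {p\<in>{0<..<i}. g p = j}" using agree by auto
  then show ?thesis using split[of f] split[of g] f g j by (simp add: words_def)
qed

text \<open>
The number of springer rows of position \<open>i\<close> is the rank of the letter at \<open>i\<close> in the order of rows
that is in force there, so comparing codes lexicographically compares words letter by letter.
\<close>

definition row_code :: "nat set \<Rightarrow> nat \<Rightarrow> (nat \<Rightarrow> nat) \<Rightarrow> nat list" where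
  "row_code K n f = map (\<lambda>i. card (springer_rows K n f i)) [1..<Suc n]"

text \<open>
At the first difference \<open>i\<close> the two words have the same remaining lengths, hence the same order of rows.
Since the letter of \<open>g\<close> does not precede that of \<open>f\<close>, it comes later.
\<close>

lemma row_code_less:
  assumes K: "finite K" and f: "f \<in> words K \<beta> 0 n" and g: "g \<in> words K \<beta> 0 n"
    and avoid: "\<forall>i\<in>{0<..n}. g i \<notin> springer_rows K n f i"
    and differ: "\<exists>i\<in>{0<..n}. f i \<noteq> g i"
  shows "(row_code K n f, row_code K n g) \<in> lex less_than"
proof -
  define i where "i = (LEAST i. i \<in> {0<..n} \<and> f i \<noteq> g i)"
  have "\<exists>i. i \<in> {0<..n} \<and> f i \<noteq> g i" using differ by blast
  from LeastI_ex[OF this] have "i \<in> {0<..n} \<and> f i \<noteq> g i" unfolding i_def .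
  then have i: "i \<in> {0<..n}" "f i \<noteq> g i" by blast+
  have agree: "f p = g p" if "0 < p" "p < i" for p
    using not_less_Least[of p "\<lambda>i. i \<in> {0<..n} \<and> f i \<noteq> g i"] that i(1) by (auto simp: i_def)
  have same: "remaining n f p j = remaining n g p j" if "j \<in> K" "p \<in> {0<..i}" for p j
    using that i agree by (intro remaining_determined_by_prefix[OF f g]) auto
  have fK: "f i \<in> K" "g i \<in> K" using f g i by (auto simp: words_def)
  define \<beta>' where "\<beta>' = remaining n g i"
  have rows: "springer_rows K n f i = {j\<in>K. precedes \<beta>' j (f i)}"
    "springer_rows K n g i = {j\<in>K. precedes \<beta>' j (g i)}"
    using same[of _ i] i fK by (auto simp: springer_rows_def \<beta>'_def precedes_def)
  then have "precedes \<beta>' (f i) (g i)"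
    using avoid i fK precedes_total[of "g i" "f i" \<beta>'] by auto
  then have "springer_rows K n f i \<subset> springer_rows K n g i"
    using fK unfolding rows by (auto simp: precedes_def)
  then have less: "card (springer_rows K n f i) < card (springer_rows K n g i)"
    using K by (intro psubset_card_mono) (auto simp: springer_rows_def)
  have prefix: "map (\<lambda>p. card (springer_rows K n f p)) [1..<i]
      = map (\<lambda>p. card (springer_rows K n g p)) [1..<i]"
  proof (intro map_cong refl)
    fix p assume "p \<in> set [1..<i]"
    then have p: "0 < p" "p < i" by auto
    have "f p \<in> K" using f p i by (auto simp: words_def)
    then have "springer_rows K n f p = springer_rows K n g p"
      using same[of _ p] p agree[OF p] by (auto simp: springer_rows_def precedes_def)
    then show "card (springer_rows K n f p) = card (springer_rows K n g p)" by simp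
  qed
  have upt: "[1..<Suc n] = [1..<i] @ i # [Suc i..<Suc n]"
    using i upt_add_eq_append[of 1 i "Suc n - i"] by (simp add: upt_conv_Cons)
  show ?thesis
    unfolding row_code_def upt map_append list.map prefix
    using less by (auto simp: lex_conv)
qed

text \<open>
Evaluating the relation at the point of the word \<open>w t\<close> involves only coefficients of words with a
smaller code and the coefficient of \<open>t\<close> itself, the latter with a nonzero factor.
\<close>

lemma springer_polys_pointwise_independent:
  assumes K: "finite K" and T: "finite T" and w: "\<And>t. t \<in> T \<Longrightarrow> w t \<in> words K \<beta> 0 n"
    and distinct: "\<And>s t. s \<in> T \<Longrightarrow> t \<in> T \<Longrightarrow> s \<noteq> t \<Longrightarrow> \<exists>i\<in>{0<..n}. w s i \<noteq> w t i"
    and c: "\<And>t. t \<in> T \<Longrightarrow> c t \<in> polys_in (Zvar ` K)"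
    and rel: "(\<Sum>t\<in>T. c t * springer_poly K n (w t)) \<in> word_vanishing K \<beta> n"
    and z: "inj_on z K" "constrained K \<beta> z" and t: "t \<in> T"
  shows "eval_poly (case_indet z y) (c t) = 0"
proof -
  have "wf (inv_image (lex less_than) (\<lambda>t. row_code K n (w t)))" by auto
  then show ?thesis using t
  proof (induction t rule: wf_induct_rule)
    case (less t)
    define a where "a = word_point z (w t)"
    have ev: "eval_poly a (c s) = eval_poly (case_indet z y) (c s)" if "s \<in> T" for s
      using c[OF that] by (rule eval_cong) (auto simp: a_def word_point_def)
    have "0 = (\<Sum>s\<in>T. eval_poly a (c s) * eval_poly a (springer_poly K n (w s)))"
      using rel w[OF less.prems] z by (simp add: word_vanishing_def eval_simps a_def)
    also have "\<dots> = (\<Sum>s\<in>T. if s = t then eval_poly a (c t) * eval_poly a (springer_poly K n (w t)) else 0)"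
    proof (intro sum.cong refl)
      fix s assume s: "s \<in> T"
      have "eval_poly a (springer_poly K n (w s)) = 0 \<or> eval_poly a (c s) = 0" if "s \<noteq> t"
      proof (rule ccontr)
        assume "\<not> ?thesis"
        then have nz: "eval_poly a (springer_poly K n (w s)) \<noteq> 0" "eval_poly a (c s) \<noteq> 0" by auto
        have "(row_code K n (w s), row_code K n (w t)) \<in> lex less_than"
          using nz(1) eval_springer_poly_nonzero_iff[OF K z(1) w[OF less.prems]]
          unfolding a_def
          by (intro row_code_less[OF K w[OF s] w[OF less.prems]] distinct s less.prems that) auto
        then show False using less.IH[of s] s nz(2) ev by simp
      qed
      then show "eval_poly a (c s) * eval_poly a (springer_poly K n (w s)) =
          (if s = t then eval_poly a (c t) * eval_poly a (springer_poly K n (w t)) else 0)" by auto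
    qed
    also have "\<dots> = eval_poly a (c t) * eval_poly a (springer_poly K n (w t))"
      using T less.prems by simp
    finally show ?case
      using eval_springer_poly_nonzero_iff[OF K z(1) w[OF less.prems], of "w t"] ev[OF less.prems]
      by (simp add: a_def not_own_row)
  qed
qed

definition z_rel :: "nat set \<Rightarrow> (nat \<Rightarrow> nat) \<Rightarrow> polynomial" where
  "z_rel K \<beta> = (\<Sum>j\<in>K. of_nat (\<beta> j) * Var (Zvar j))"

lemma of_nat_eq_Const: "of_nat m = Const (of_nat m)"
  by (simp add: Const_def)

lemma z_rel_in_polys: "z_rel K \<beta> \<in> polys_in (Zvar ` K)"
  unfolding z_rel_def of_nat_eq_Const
  by (intro subring_sum subring_mult subring_polys_in) (auto intro: Const_in_polys Var_in_polys)

lemma ideal_multiples: "is_subring C \<Longrightarrow> u \<in> C \<Longrightarrow> is_ideal C {q * u | q. q \<in> C}"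
  unfolding is_ideal_def
  by (auto simp: subring_intros left_diff_distrib[symmetric] mult.assoc[symmetric]
      intro: subring_intros exI[of _ 0])

text \<open>
Substituting \<open>z\<^sub>j - m\<close> for \<open>z\<^sub>j\<close>, where \<open>m\<close> is the mean value \<open>(\<Sum> \<beta>\<^sub>i z\<^sub>i) / (\<Sum> \<beta>\<^sub>i)\<close>, does not change a
polynomial modulo the relation \<open>\<Sum> \<beta>\<^sub>i z\<^sub>i\<close>, and it pulls evaluation back to the hyperplane of that
relation. The substituted polynomial \<open>p'\<close> is characterised by its values at all assignments.
\<close>

lemma trace_zero_projection:
  fixes K :: "nat set" and \<beta> :: "nat \<Rightarrow> nat"
  defines "V \<equiv> Zvar ` K"
  defines "shift \<equiv> \<lambda>a v. a v - (\<Sum>j\<in>K. of_nat (\<beta> j) * a (Zvar j)) / of_nat (\<Sum>j\<in>K. \<beta> j)"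
  assumes p: "p \<in> polys_in V"
  shows "\<exists>p'\<in>polys_in V. p - p' \<in> {q * z_rel K \<beta> | q. q \<in> polys_in V} \<and>
           (\<forall>a. eval_poly a p' = eval_poly (shift a) p)"
proof -
  define I where "I = {q * z_rel K \<beta> | q. q \<in> polys_in V}"
  define u where "u = Const (1 / of_nat (\<Sum>j\<in>K. \<beta> j))"
  note C = subring_polys_in[of V]
  have uC: "u \<in> polys_in V" unfolding u_def by (rule Const_in_polys)
  have rC: "z_rel K \<beta> \<in> polys_in V" unfolding V_def by (rule z_rel_in_polys)
  have I: "is_ideal (polys_in V) I"
    unfolding I_def by (rule ideal_multiples[OF C rC])
  have uI: "u * z_rel K \<beta> \<in> I" using uC by (auto simp: I_def)
  have "p \<in> adjoin (range Const \<union> Var ` V)" using p unfolding polys_in_eq_adjoin .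
  then have "\<exists>p'\<in>polys_in V. p - p' \<in> I \<and> (\<forall>a. eval_poly a p' = eval_poly (shift a) p)"
  proof induction
    case (adjoin_base p)
    then consider c where "p = Const c" | v where "v \<in> V" "p = Var v" by blast
    then show ?case
    proof cases
      case 1
      then show ?thesis
        by (intro bexI[of _ p]) (auto simp: ideal_zero[OF I] eval_simps Const_in_polys)
    next
      case 2
      show ?thesis
        by (intro bexI[of _ "p - u * z_rel K \<beta>"] conjI allI subring_diff[OF C] subring_mult[OF C] uC rC)
           (use 2 uI in \<open>auto simp: eval_simps u_def z_rel_def shift_def of_nat_eq_Const
              intro: Var_in_polys simp flip: of_nat_sum\<close>)
    qed
  next
    case adjoin_one
    show ?case
      by (intro bexI[of _ 1]) (auto simp: ideal_zero[OF I] eval_simps subring_one[OF C])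
  next
    case (adjoin_diff p q)
    then obtain p' q' where pq: "p' \<in> polys_in V" "q' \<in> polys_in V" "p - p' \<in> I" "q - q' \<in> I"
      "\<forall>a. eval_poly a p' = eval_poly (shift a) p" "\<forall>a. eval_poly a q' = eval_poly (shift a) q"
      by blast
    have "(p - p') - (q - q') \<in> I" by (rule ideal_diff[OF I pq(3,4)])
    also have "(p - p') - (q - q') = (p - q) - (p' - q')" by simp
    finally show ?case using pq
      by (intro bexI[of _ "p' - q'"]) (auto simp only: eval_simps intro: subring_diff[OF C])
  next
    case (adjoin_mult p q)
    then obtain p' q' where pq: "p' \<in> polys_in V" "q' \<in> polys_in V" "p - p' \<in> I" "q - q' \<in> I"
      "\<forall>a. eval_poly a p' = eval_poly (shift a) p" "\<forall>a. eval_poly a q' = eval_poly (shift a) q"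
      by blast
    have "p \<in> polys_in V" using adjoin_mult unfolding polys_in_eq_adjoin by blast
    then have "p * (q - q') + (p - p') * q' \<in> I"
      by (rule ideal_add[OF I ideal_mult[OF I _ pq(4)] ideal_mult_right[OF I pq(2,3)]])
    also have "p * (q - q') + (p - p') * q' = p * q - p' * q'" by (simp add: algebra_simps)
    finally show ?case using pq
      by (intro bexI[of _ "p' * q'"]) (auto simp only: eval_simps intro: subring_mult[OF C])
  qed
  then show ?thesis unfolding I_def .
qed

text \<open>
Translation by the mean value preserves injectivity, so the substituted polynomial vanishes at every
injective assignment and is zero.
\<close>

lemma vanishing_on_generic_trace_zero:
  assumes K: "finite K" and p: "p \<in> polys_in (Zvar ` K)"
    and zero: "\<And>z. inj_on z K \<Longrightarrow> constrained K \<beta> z \<Longrightarrow> eval_poly (case_indet z (\<lambda>_. 0)) p = 0"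
  shows "\<exists>q\<in>polys_in (Zvar ` K). p = q * z_rel K \<beta>"
proof -
  \<comment> \<open>If all \<open>\<beta> j\<close> are \<open>0\<close>, the relation is zero, and division by \<open>0\<close> makes the mean \<open>0\<close>.\<close>
  define mean where "mean = (\<lambda>a. (\<Sum>j\<in>K. of_nat (\<beta> j) * a (Zvar j)) / of_nat (\<Sum>j\<in>K. \<beta> j) :: complex)"
  obtain p' where p': "p' \<in> polys_in (Zvar ` K)"
    "p - p' \<in> {q * z_rel K \<beta> | q. q \<in> polys_in (Zvar ` K)}"
    "\<And>a. eval_poly a p' = eval_poly (\<lambda>v. a v - mean a) p"
    using trace_zero_projection[OF p, of \<beta>] unfolding mean_def by blast
  have "p' = 0"
  proof (rule polynomial_identity)
    show "finite (Zvar ` K)" "p' \<in> polys_in (Zvar ` K)" using K p' by auto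
    fix a :: "indet \<Rightarrow> complex" assume a: "inj_on a (Zvar ` K)"
    define z where "z = (\<lambda>j. a (Zvar j) - mean a)"
    have "inj_on z K" using a by (auto simp: z_def inj_on_def)
    moreover have "constrained K \<beta> z"
    proof -
      have "(\<Sum>j\<in>K. of_nat (\<beta> j) * z j) =
          (\<Sum>j\<in>K. of_nat (\<beta> j) * a (Zvar j)) - of_nat (\<Sum>j\<in>K. \<beta> j) * mean a"
        by (simp add: z_def right_diff_distrib sum_subtractf sum_distrib_right)
      also have "\<dots> = 0"
      proof (cases "(\<Sum>j\<in>K. \<beta> j) = 0")
        case True
        then have "\<forall>j\<in>K. \<beta> j = 0" using K by simp
        then show ?thesis by simp
      next
        case False
        then have "of_nat (\<Sum>j\<in>K. \<beta> j) \<noteq> (0::complex)" by (simp only: of_nat_eq_0_iff not_False_eq_True)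
        moreover have "s - N * (s / N) = 0" if "N \<noteq> 0" for s N :: complex using that by simp
        ultimately show ?thesis unfolding mean_def by blast
      qed
      finally show ?thesis by (simp add: constrained_def)
    qed
    ultimately have "eval_poly (case_indet z (\<lambda>_. 0)) p = 0" by (rule zero)
    moreover have "eval_poly (\<lambda>v. a v - mean a) p = eval_poly (case_indet z (\<lambda>_. 0)) p"
      by (rule eval_cong[OF p]) (auto simp: z_def)
    ultimately show "eval_poly a p' = 0" using p'(3) by simp
  qed
  then show ?thesis using p'(2) by auto
qed


section \<open>Tableaux, words and the variety\<close>

abbreviation rows :: "nat list \<Rightarrow> nat set" where
  "rows \<alpha> \<equiv> {1..length \<alpha>}"

text \<open>
The word of a tableau: the letter at \<open>i\<close> is the row that contains the entry \<open>i\<close>.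
\<close>

definition row_word :: "nat list \<Rightarrow> (nat \<times> nat \<Rightarrow> nat) \<Rightarrow> nat \<Rightarrow> nat" where
  "row_word \<alpha> T i = fst (inv_into (diagram \<alpha>) T i)"

lemma diagram_eq_Sigma: "diagram \<alpha> = (SIGMA r:rows \<alpha>. {1..part \<alpha> r})"
  by (auto simp: diagram_def)

lemma sum_part: "(\<Sum>j\<in>rows \<alpha>. part \<alpha> j) = sum_list \<alpha>"
proof -
  have "(\<Sum>j\<in>rows \<alpha>. part \<alpha> j) = (\<Sum>i\<in>{0..<length \<alpha>}. \<alpha> ! i)"
    by (rule sum.reindex_bij_witness[of _ Suc "\<lambda>i. i - 1"]) (auto simp: part_def)
  then show ?thesis by (simp add: sum_list_sum_nth)
qed

lemma finite_RSCT: "finite (RSCT n \<alpha>)"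
proof (rule finite_subset)
  show "RSCT n \<alpha> \<subseteq> (\<Pi>\<^sub>E b\<in>diagram \<alpha>. {1..n})"
    by (auto simp: RSCT_def PiE_def bij_betw_def)
  show "finite (\<Pi>\<^sub>E b\<in>diagram \<alpha>. {1..n})"
    by (intro finite_PiE) (auto simp: diagram_eq_Sigma)
qed

lemma row_word_entry:
  assumes "T \<in> RSCT n \<alpha>" "(r, c) \<in> diagram \<alpha>"
  shows "row_word \<alpha> T (T (r, c)) = r"
  using assms by (simp add: row_word_def RSCT_def bij_betw_def inv_into_f_f)

lemma RSCT_entry_of:
  assumes "T \<in> RSCT n \<alpha>" "i \<in> {1..n}"
  obtains r c where "(r, c) \<in> diagram \<alpha>" "T (r, c) = i" "row_word \<alpha> T i = r"
proof -
  have "i \<in> T ` diagram \<alpha>" using assms by (simp add: RSCT_def bij_betw_def)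
  then obtain r c where "(r, c) \<in> diagram \<alpha>" "T (r, c) = i" by auto
  with that row_word_entry[OF assms(1)] show thesis by metis
qed

lemma RSCT_decreasing:
  "T \<in> RSCT n \<alpha> \<Longrightarrow> (r, c) \<in> diagram \<alpha> \<Longrightarrow> (r, c') \<in> diagram \<alpha> \<Longrightarrow> c < c' \<Longrightarrow> T (r, c') < T (r, c)"
  unfolding RSCT_def by blast

lemma remaining_row_word:
  assumes T: "T \<in> RSCT n \<alpha>" and j: "j \<in> rows \<alpha>" and i: "1 \<le> i"
  shows "remaining n (row_word \<alpha> T) i j = card {c\<in>{1..part \<alpha> j}. i \<le> T (j, c)}"
proof -
  have inj: "inj_on T (diagram \<alpha>)" and im: "T ` diagram \<alpha> = {1..n}"
    using T by (auto simp: RSCT_def bij_betw_def)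
  have "{p\<in>{i..n}. row_word \<alpha> T p = j} = (\<lambda>c. T (j, c)) ` {c\<in>{1..part \<alpha> j}. i \<le> T (j, c)}"
  proof (intro equalityI subsetI)
    fix p assume p: "p \<in> {p\<in>{i..n}. row_word \<alpha> T p = j}"
    then have "p \<in> {1..n}" using i by auto
    from RSCT_entry_of[OF T this] obtain r c
      where "(r, c) \<in> diagram \<alpha>" "T (r, c) = p" "row_word \<alpha> T p = r" .
    then show "p \<in> (\<lambda>c. T (j, c)) ` {c\<in>{1..part \<alpha> j}. i \<le> T (j, c)}"
      using p by (auto simp: diagram_def)
  next
    fix p assume "p \<in> (\<lambda>c. T (j, c)) ` {c\<in>{1..part \<alpha> j}. i \<le> T (j, c)}"
    then obtain c where c: "c \<in> {1..part \<alpha> j}" "i \<le> T (j, c)" "p = T (j, c)" by auto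
    then have d: "(j, c) \<in> diagram \<alpha>" using j by (auto simp: diagram_def)
    then have "T (j, c) \<in> {1..n}" using im by blast
    then show "p \<in> {p\<in>{i..n}. row_word \<alpha> T p = j}"
      using c row_word_entry[OF T d] by auto
  qed
  moreover have "inj_on (\<lambda>c. T (j, c)) {c\<in>{1..part \<alpha> j}. i \<le> T (j, c)}"
    using j by (auto intro!: inj_onI dest!: inj_onD[OF inj] simp: diagram_def)
  ultimately show ?thesis unfolding remaining_def by (simp add: card_image)
qed

text \<open>
As rows decrease, the entries \<open>\<ge> i\<close> of a row fill an initial segment of its boxes.
\<close>

lemma le_entry_iff:
  assumes T: "T \<in> RSCT n \<alpha>" and d: "(j, c) \<in> diagram \<alpha>" and i: "1 \<le> i"
  shows "i \<le> T (j, c) \<longleftrightarrow> c \<le> remaining n (row_word \<alpha> T) i j"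
proof -
  have j: "j \<in> rows \<alpha>" and c: "c \<in> {1..part \<alpha> j}" using d by (auto simp: diagram_def)
  define A where "A = {c\<in>{1..part \<alpha> j}. i \<le> T (j, c)}"
  have fin: "finite A" by (simp add: A_def)
  have dec: "T (j, c2) < T (j, c1)" if "c1 < c2" "1 \<le> c1" "c2 \<le> part \<alpha> j" for c1 c2
    using that j by (intro RSCT_decreasing[OF T]) (auto simp: diagram_def)
  have "c \<le> card A \<longleftrightarrow> i \<le> T (j, c)"
  proof
    assume "i \<le> T (j, c)"
    then have "i \<le> T (j, d)" if "d \<in> {1..c}" for d
      using that c dec[of d c] by (cases "d = c") auto
    then have "{1..c} \<subseteq> A" using c by (auto simp: A_def)
    from card_mono[OF fin this] show "c \<le> card A" by simp
  next
    assume le: "c \<le> card A"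
    show "i \<le> T (j, c)"
    proof (rule ccontr)
      assume not: "\<not> i \<le> T (j, c)"
      have "d < c" if "d \<in> A" for d
      proof (rule ccontr)
        assume "\<not> d < c"
        then have "T (j, d) \<le> T (j, c)"
          using that c dec[of c d] by (cases "d = c") (auto simp: A_def)
        then show False using not that by (auto simp: A_def)
      qed
      then have "A \<subseteq> {1..<c}" by (auto simp: A_def)
      from card_mono[OF _ this] show False using le c by auto
    qed
  qed
  then show ?thesis using remaining_row_word[OF T j i] by (simp add: A_def)
qed

lemma remaining_le_part:
  assumes T: "T \<in> RSCT n \<alpha>" and j: "j \<in> rows \<alpha>" and i: "1 \<le> i"
  shows "remaining n (row_word \<alpha> T) i j \<le> part \<alpha> j"
proof -
  have "card {c\<in>{1..part \<alpha> j}. i \<le> T (j, c)} \<le> card {1..part \<alpha> j}" by (rule card_mono) auto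
  then show ?thesis unfolding remaining_row_word[OF assms] by simp
qed

text \<open>
Together with the row, the column of an entry can be recovered from the word. This makes the map from
tableaux to words injective.
\<close>

lemma column_of_entry:
  assumes T: "T \<in> RSCT n \<alpha>" and d: "(r, c) \<in> diagram \<alpha>"
  shows "remaining n (row_word \<alpha> T) (T (r, c)) r = c"
proof -
  let ?m = "remaining n (row_word \<alpha> T) (T (r, c)) r"
  have r: "r \<in> rows \<alpha>" and c: "1 \<le> c" using d by (auto simp: diagram_def)
  have i: "1 \<le> T (r, c)" using T d by (force simp: RSCT_def bij_betw_def)
  have le: "c \<le> ?m" using le_entry_iff[OF T d i] by simp
  then have m: "(r, ?m) \<in> diagram \<alpha>"
    using remaining_le_part[OF T r i] r c by (auto simp: diagram_def)
  have "T (r, c) \<le> T (r, ?m)" using le_entry_iff[OF T m i] by simp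
  then have "\<not> c < ?m" using RSCT_decreasing[OF T d m] by auto
  with le show ?thesis by simp
qed

lemma row_word_in_words:
  assumes T: "T \<in> RSCT n \<alpha>"
  shows "row_word \<alpha> T \<in> words (rows \<alpha>) (part \<alpha>) 0 n"
proof -
  have "row_word \<alpha> T i \<in> rows \<alpha>" if i: "i \<in> {0<..n}" for i
  proof -
    have "i \<in> {1..n}" using i by auto
    from RSCT_entry_of[OF T this] show ?thesis by (auto simp: diagram_def)
  qed
  moreover have "card {i\<in>{0<..n}. row_word \<alpha> T i = j} = part \<alpha> j" if j: "j \<in> rows \<alpha>" for j
  proof -
    have "T (j, c) \<in> {1..n}" if "c \<in> {1..part \<alpha> j}" for c
      using that j T by (auto simp: RSCT_def bij_betw_def diagram_def)
    then have "{c\<in>{1..part \<alpha> j}. 1 \<le> T (j, c)} = {1..part \<alpha> j}" by auto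
    moreover have "{0<..n} = {1..n}" by auto
    ultimately show ?thesis
      using remaining_row_word[OF T j, of 1] by (simp add: remaining_def)
  qed
  ultimately show ?thesis by (simp add: words_def)
qed

lemma row_word_inj:
  assumes T: "T \<in> RSCT n \<alpha>" and U: "U \<in> RSCT n \<alpha>"
    and eq: "\<And>i. i \<in> {0<..n} \<Longrightarrow> row_word \<alpha> T i = row_word \<alpha> U i"
  shows "T = U"
proof (rule extensionalityI)
  show "T \<in> extensional (diagram \<alpha>)" "U \<in> extensional (diagram \<alpha>)"
    using T U by (auto simp: RSCT_def)
  fix b assume b: "b \<in> diagram \<alpha>"
  obtain r c where rc: "b = (r, c)" by (cases b)
  define i where "i = T (r, c)"
  have i: "i \<in> {1..n}" using T b by (auto simp: i_def rc RSCT_def bij_betw_def)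
  obtain r' c' where u: "(r', c') \<in> diagram \<alpha>" "U (r', c') = i" "row_word \<alpha> U i = r'"
    using RSCT_entry_of[OF U i] .
  have r': "r' = r" using u(3) eq[of i] i row_word_entry[OF T, of r c] b by (auto simp: rc i_def)
  have "{p\<in>{i..n}. row_word \<alpha> T p = r} = {p\<in>{i..n}. row_word \<alpha> U p = r}"
    using eq i by auto
  then have "remaining n (row_word \<alpha> T) i r = remaining n (row_word \<alpha> U) i r"
    by (simp add: remaining_def)
  then have "c' = c"
    using column_of_entry[OF T, of r c] column_of_entry[OF U u(1)] b u(2)
    by (simp add: rc i_def r')
  then show "T b = U b" using u(2) by (simp add: rc i_def r')
qed

lemma remaining_strict:
  assumes "i < i'" "i \<in> {0<..n}" "f i = r"
  shows "remaining n f i' r < remaining n f i r"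
  unfolding remaining_def
proof (rule psubset_card_mono)
  have "i \<in> {p\<in>{i..n}. f p = r}" "i \<notin> {p\<in>{i'..n}. f p = r}" using assms by auto
  moreover have "{p\<in>{i'..n}. f p = r} \<subseteq> {p\<in>{i..n}. f p = r}" using assms(1) by auto
  ultimately show "{p\<in>{i'..n}. f p = r} \<subset> {p\<in>{i..n}. f p = r}" by blast
qed simp

text \<open>
The tableau of a word has the entry \<open>i\<close> in row \<open>f i\<close>, in the column given by the number of
positions from \<open>i\<close> on that carry the same letter.
\<close>

lemma row_word_surj:
  assumes \<alpha>: "strong_composition n \<alpha>" and f: "f \<in> words (rows \<alpha>) (part \<alpha>) 0 n"
  shows "\<exists>T\<in>RSCT n \<alpha>. \<forall>i\<in>{0<..n}. row_word \<alpha> T i = f i"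
proof -
  define box where "box = (\<lambda>i. (f i, remaining n f i (f i)))"
  have inj: "inj_on box {1..n}"
  proof (rule inj_onI)
    fix i i' assume "i \<in> {1..n}" "i' \<in> {1..n}" "box i = box i'"
    then show "i = i'"
      using remaining_strict[of i i' n f "f i"] remaining_strict[of i' i n f "f i"]
      by (cases i i' rule: linorder_cases) (auto simp: box_def)
  qed
  have sub: "box ` {1..n} \<subseteq> diagram \<alpha>"
  proof
    fix b assume "b \<in> box ` {1..n}"
    then obtain i where i: "i \<in> {1..n}" "b = box i" by auto
    have r: "f i \<in> rows \<alpha>" using f i by (simp add: words_def)
    have "{p\<in>{i..n}. f p = f i} \<subseteq> {p\<in>{0<..n}. f p = f i}" using i by auto
    then have "remaining n f i (f i) \<le> card {p\<in>{0<..n}. f p = f i}"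
      unfolding remaining_def by (intro card_mono) auto
    also have "\<dots> = part \<alpha> (f i)" using f r by (simp add: words_def)
    finally have "remaining n f i (f i) \<le> part \<alpha> (f i)" .
    moreover have "i \<in> {p\<in>{i..n}. f p = f i}" using i by auto
    then have "0 < remaining n f i (f i)"
      unfolding remaining_def by (auto simp: card_gt_0_iff)
    ultimately show "b \<in> diagram \<alpha>" using r i by (auto simp: diagram_def box_def)
  qed
  have "card (diagram \<alpha>) = n"
    using \<alpha> sum_part[of \<alpha>] by (simp add: diagram_eq_Sigma strong_composition_def)
  then have "card (box ` {1..n}) = card (diagram \<alpha>)" using card_image[OF inj] by simp
  then have im: "box ` {1..n} = diagram \<alpha>"
    using sub by (intro card_subset_eq) (auto simp: diagram_eq_Sigma)
  define T where "T = restrict (inv_into {1..n} box) (diagram \<alpha>)"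
  have Tbox: "T (box i) = i" if "i \<in> {1..n}" for i
    using that im inj by (auto simp: T_def inv_into_f_f)
  have "bij_betw T (diagram \<alpha>) {1..n}"
    unfolding T_def using bij_betw_inv_into[of box "{1..n}" "diagram \<alpha>"] inj im
    by (simp add: bij_betw_def)
  moreover have "T (r, c') < T (r, c)"
    if d: "(r, c) \<in> diagram \<alpha>" "(r, c') \<in> diagram \<alpha>" and lt: "c < c'" for r c c'
  proof -
    obtain i i' where i: "i \<in> {1..n}" "box i = (r, c)" and i': "i' \<in> {1..n}" "box i' = (r, c')"
      using d im by (metis imageE)
    have "\<not> i \<le> i'"
      using remaining_strict[of i i' n f r] i i' lt by (cases "i = i'") (auto simp: box_def)
    then show ?thesis using Tbox[OF i(1)] Tbox[OF i'(1)] i(2) i'(2) by simp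
  qed
  ultimately have T: "T \<in> RSCT n \<alpha>" by (auto simp: RSCT_def T_def)
  have "row_word \<alpha> T i = f i" if i: "i \<in> {0<..n}" for i
  proof -
    have "i \<in> {1..n}" using i by auto
    then have "box i \<in> diagram \<alpha>" "T (box i) = i" using im Tbox by auto
    then show ?thesis using row_word_entry[OF T, of "f i" "remaining n f i (f i)"]
      by (simp add: box_def)
  qed
  with T show ?thesis by blast
qed

text \<open>
Let \<open>i\<close> stand in column \<open>c\<close> of row \<open>r\<close>, and let \<open>m\<close> be the number of entries \<open>\<ge> i\<close> in row \<open>j\<close>. The
larger entries of row \<open>j\<close> reach beyond column \<open>c\<close> iff \<open>m > c\<close>. Otherwise an inversion must come from
column \<open>c\<close> itself, which requires \<open>m = c\<close> and \<open>j < r\<close>. As \<open>c\<close> is the number of entries \<open>\<ge> i\<close> in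
row \<open>r\<close>, this is the order of rows used for words.
\<close>

lemma springer_inversions_eq:
  assumes T: "T \<in> RSCT n \<alpha>"
  shows "springer_inversions \<alpha> T =
    (SIGMA i:{0<..n}. springer_rows (rows \<alpha>) n (row_word \<alpha> T) i)"
proof -
  have inj: "inj_on T (diagram \<alpha>)" and im: "T ` diagram \<alpha> = {1..n}"
    using T by (auto simp: RSCT_def bij_betw_def)
  have key: "(\<exists>c'. (j, c') \<in> diagram \<alpha> \<and> T (r, c) < T (j, c') \<and> (c' = c \<and> j < r \<or> c < c')) \<longleftrightarrow>
      j \<in> springer_rows (rows \<alpha>) n (row_word \<alpha> T) (T (r, c))"
    if d: "(r, c) \<in> diagram \<alpha>" for r c j
  proof -
    define m where "m = remaining n (row_word \<alpha> T) (T (r, c)) j"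
    have i: "1 \<le> T (r, c)" using d im by force
    have row: "row_word \<alpha> T (T (r, c)) = r" by (rule row_word_entry[OF T d])
    have col: "remaining n (row_word \<alpha> T) (T (r, c)) r = c" by (rule column_of_entry[OF T d])
    have strict: "T (r, c) < T (j, c') \<longleftrightarrow> c' \<le> m \<and> (j, c') \<noteq> (r, c)"
      if "(j, c') \<in> diagram \<alpha>" for c'
      using le_entry_iff[OF T that i] inj_onD[OF inj _ that d] by (auto simp: m_def less_le)
    have "j \<in> springer_rows (rows \<alpha>) n (row_word \<alpha> T) (T (r, c)) \<longleftrightarrow>
        j \<in> rows \<alpha> \<and> (c < m \<or> m = c \<and> j < r)"
      by (simp add: springer_rows_def precedes_def row col m_def)
    moreover have "(\<exists>c'. (j, c') \<in> diagram \<alpha> \<and> T (r, c) < T (j, c') \<and> (c' = c \<and> j < r \<or> c < c'))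
        \<longleftrightarrow> j \<in> rows \<alpha> \<and> (c < m \<or> m = c \<and> j < r)"
    proof
      assume "\<exists>c'. (j, c') \<in> diagram \<alpha> \<and> T (r, c) < T (j, c') \<and> (c' = c \<and> j < r \<or> c < c')"
      then obtain c' where "(j, c') \<in> diagram \<alpha>" "c' \<le> m" "c' = c \<and> j < r \<or> c < c'"
        using strict by blast
      then show "j \<in> rows \<alpha> \<and> (c < m \<or> m = c \<and> j < r)" by (auto simp: diagram_def)
    next
      assume R: "j \<in> rows \<alpha> \<and> (c < m \<or> m = c \<and> j < r)"
      then have "m \<le> part \<alpha> j" using remaining_le_part[OF T _ i] by (simp add: m_def)
      then have dm: "(j, m) \<in> diagram \<alpha>" using R d by (auto simp: diagram_def)
      show "\<exists>c'. (j, c') \<in> diagram \<alpha> \<and> T (r, c) < T (j, c') \<and> (c' = c \<and> j < r \<or> c < c')"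
        by (intro exI[of _ m]) (use dm strict[OF dm] R in auto)
    qed
    ultimately show ?thesis by blast
  qed
  have "(i, j) \<in> springer_inversions \<alpha> T \<longleftrightarrow>
      i \<in> {0<..n} \<and> j \<in> springer_rows (rows \<alpha>) n (row_word \<alpha> T) i" for i j
  proof -
    have "(i, j) \<in> springer_inversions \<alpha> T \<longleftrightarrow> (\<exists>r c. (r, c) \<in> diagram \<alpha> \<and> T (r, c) = i \<and>
        (\<exists>c'. (j, c') \<in> diagram \<alpha> \<and> T (r, c) < T (j, c') \<and> (c' = c \<and> j < r \<or> c < c')))"
      unfolding springer_inversions_def by blast
    also have "\<dots> \<longleftrightarrow> (\<exists>r c. (r, c) \<in> diagram \<alpha> \<and> T (r, c) = i) \<and>
        j \<in> springer_rows (rows \<alpha>) n (row_word \<alpha> T) i"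
      using key by blast
    also have "(\<exists>r c. (r, c) \<in> diagram \<alpha> \<and> T (r, c) = i) \<longleftrightarrow> i \<in> T ` diagram \<alpha>" by force
    also have "\<dots> \<longleftrightarrow> i \<in> {0<..n}" unfolding im by auto
    finally show ?thesis .
  qed
  then show ?thesis by auto
qed

lemma springer_monomial_poly_eq:
  assumes "T \<in> RSCT n \<alpha>"
  shows "springer_monomial_poly \<alpha> T = springer_poly (rows \<alpha>) n (row_word \<alpha> T)"
  unfolding springer_monomial_poly_def springer_poly_def springer_prod_def springer_inversions_eq[OF assms]
  by (subst prod.Sigma) (auto simp: springer_rows_def)

lemma springer_poly_cong:
  assumes "\<And>i. i \<in> {0<..n} \<Longrightarrow> f i = g i"
  shows "springer_poly K n f = springer_poly K n g"
proof -
  have "springer_rows K n f i = springer_rows K n g i" if "i \<in> {0<..n}" for i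
  proof -
    have "{p\<in>{i..n}. f p = j} = {p\<in>{i..n}. g p = j}" for j using assms that by auto
    then show ?thesis using assms[OF that] by (simp add: springer_rows_def precedes_def remaining_def)
  qed
  then show ?thesis unfolding springer_poly_def springer_prod_def by (auto intro!: prod.cong)
qed

text \<open>
The word of the identity permutation: the position \<open>p\<close> carries the index of its block.
\<close>

lemma block_word:
  assumes \<alpha>: "strong_composition n \<alpha>"
  obtains b where "b \<in> words (rows \<alpha>) (part \<alpha>) 0 n"
    "\<And>p. p \<in> {0<..n} \<Longrightarrow> p \<in> block \<alpha> (b p)"
    "\<And>j p. j \<in> rows \<alpha> \<Longrightarrow> p \<in> block \<alpha> j \<Longrightarrow> p \<in> {0<..n} \<and> b p = j"
proof -
  define s where "s = (\<lambda>i. sum_list (take i \<alpha>))"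
  have s_Suc: "s (Suc i) = s i + \<alpha> ! i" if "i < length \<alpha>" for i
    using that by (simp add: s_def take_Suc_conv_app_nth)
  have mono: "s i \<le> s j" if "i \<le> j" for i j
  proof -
    have "take j \<alpha> = take i \<alpha> @ drop i (take j \<alpha>)"
      using that append_take_drop_id[of i "take j \<alpha>"] by (simp add: min_def)
    then show ?thesis unfolding s_def by (metis le_add1 sum_list_append)
  qed
  have s_n: "s (length \<alpha>) = n" and s_0: "s 0 = 0"
    using \<alpha> by (auto simp: s_def strong_composition_def)
  have block: "block \<alpha> j = {s (j - 1)<..s j}" for j by (simp add: block_def s_def)
  define b where "b = (\<lambda>p. LEAST i. p \<le> s i)"
  have b: "b p \<in> rows \<alpha> \<and> p \<in> block \<alpha> (b p)" if p: "p \<in> {0<..n}" for p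
  proof -
    have ex: "p \<le> s (length \<alpha>)" using p s_n by simp
    have 1: "p \<le> s (b p)" unfolding b_def using ex by (rule LeastI)
    have 2: "b p \<le> length \<alpha>" unfolding b_def using ex by (rule Least_le)
    have 3: "b p \<noteq> 0" using 1 p s_0 by (cases "b p") auto
    then have "\<not> p \<le> s (b p - 1)"
      unfolding b_def by (intro not_less_Least) simp
    then show ?thesis using 1 2 3 by (simp add: block)
  qed
  have in_block: "p \<in> {0<..n} \<and> b p = j" if j: "j \<in> rows \<alpha>" and p: "p \<in> block \<alpha> j" for j p
  proof -
    have pn: "p \<in> {0<..n}" using p mono[of j "length \<alpha>"] s_n j by (auto simp: block)
    have "b p \<le> j" unfolding b_def using p by (intro Least_le) (simp add: block)
    moreover have "j \<le> b p"
    proof (rule ccontr)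
      assume "\<not> j \<le> b p"
      then have "s (b p) \<le> s (j - 1)" by (intro mono) auto
      then show False using b[OF pn] p by (auto simp: block)
    qed
    ultimately show ?thesis using pn by simp
  qed
  have "card {p\<in>{0<..n}. b p = j} = part \<alpha> j" if j: "j \<in> rows \<alpha>" for j
  proof -
    have "{p\<in>{0<..n}. b p = j} = block \<alpha> j" using in_block[OF j] b by auto
    moreover have "s j = s (j - 1) + part \<alpha> j"
      using s_Suc[of "j - 1"] j by (auto simp: part_def)
    ultimately show ?thesis by (simp add: block)
  qed
  then have "b \<in> words (rows \<alpha>) (part \<alpha>) 0 n" using b by (auto simp: words_def)
  with b in_block that show thesis by blast
qed

lemma last_in_block:
  assumes "strong_composition n \<alpha>" "j \<in> rows \<alpha>"
  shows "sum_list (take j \<alpha>) \<in> block \<alpha> j"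
proof -
  have "take j \<alpha> = take (j - 1) \<alpha> @ [\<alpha> ! (j - 1)]"
    using assms(2) take_Suc_conv_app_nth[of "j - 1" \<alpha>] by auto
  moreover have "0 < \<alpha> ! (j - 1)"
    using assms by (auto simp: strong_composition_def)
  ultimately show ?thesis by (simp add: block_def)
qed

lemma sum_over_word:
  fixes z :: "nat \<Rightarrow> complex"
  assumes "finite K" "g \<in> words K \<beta> 0 n"
  shows "(\<Sum>i\<in>{0<..n}. z (g i)) = (\<Sum>j\<in>K. of_nat (\<beta> j) * z j)"
proof -
  have "(\<Sum>i\<in>{0<..n}. z (g i)) = (\<Sum>j\<in>K. \<Sum>i\<in>{i\<in>{0<..n}. g i = j}. z (g i))"
    using assms by (intro sum.group[symmetric]) (auto simp: words_def)
  also have "\<dots> = (\<Sum>j\<in>K. of_nat (\<beta> j) * z j)"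
    using assms by (intro sum.cong refl) (simp add: words_def)
  finally show ?thesis .
qed

text \<open>
A permutation of coordinates turns the block word into another word with the same content; conversely,
by the next lemma, all words with this content arise.
\<close>

lemma Z_var_word:
  assumes \<alpha>: "strong_composition n \<alpha>" and P: "P \<in> Z_var n \<alpha>"
  obtains z g where "constrained (rows \<alpha>) (part \<alpha>) z" "g \<in> words (rows \<alpha>) (part \<alpha>) 0 n"
    "\<And>j. j \<in> rows \<alpha> \<Longrightarrow> z_coord \<alpha> (fst P) j = z j" "\<And>i. i \<in> {0<..n} \<Longrightarrow> snd P i = z (g i)"
proof -
  obtain h w where hw: "P = (h, perm_act w h)" "h \<in> ss n \<alpha>" "w permutes {1..n}"
    using P by (auto simp: Z_var_def)
  obtain z where z: "\<And>j p. j \<in> rows \<alpha> \<Longrightarrow> p \<in> block \<alpha> j \<Longrightarrow> h p = z j"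
    using hw(2) by (auto simp: ss_def)
  obtain b where b: "b \<in> words (rows \<alpha>) (part \<alpha>) 0 n"
    "\<And>p. p \<in> {0<..n} \<Longrightarrow> p \<in> block \<alpha> (b p)"
    "\<And>j p. j \<in> rows \<alpha> \<Longrightarrow> p \<in> block \<alpha> j \<Longrightarrow> p \<in> {0<..n} \<and> b p = j"
    using block_word[OF \<alpha>] by metis
  have eq: "{0<..n} = {1..n}" by auto
  have hb: "h p = z (b p)" if "p \<in> {0<..n}" for p
    using that b(1,2) by (intro z) (auto simp: words_def)
  let ?v = "inv_into UNIV w"
  have v: "?v permutes {0<..n}" unfolding eq by (rule permutes_inv[OF hw(3)])
  have vin: "?v i \<in> {0<..n}" if "i \<in> {0<..n}" for i using permutes_in_image[OF v] that by blast
  have "card {i\<in>{0<..n}. b (?v i) = j} = card {p\<in>{0<..n}. b p = j}" for j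
  proof (rule bij_betw_same_card[of ?v])
    have "?v ` {i\<in>{0<..n}. b (?v i) = j} = {p\<in>{0<..n}. b p = j}"
    proof (intro equalityI subsetI)
      fix p assume p: "p \<in> {p\<in>{0<..n}. b p = j}"
      have "?v (w p) = p" by (rule permutes_inverses(2)[OF hw(3)])
      moreover have "w p \<in> {0<..n}" using p permutes_in_image[OF hw(3)] unfolding eq by blast
      ultimately show "p \<in> ?v ` {i\<in>{0<..n}. b (?v i) = j}"
        using p by (intro image_eqI[of _ _ "w p"]) auto
    qed (use vin in auto)
    then show "bij_betw ?v {i\<in>{0<..n}. b (?v i) = j} {p\<in>{0<..n}. b p = j}"
      using permutes_inj[OF v] by (auto simp: bij_betw_def intro: inj_on_subset)
  qed
  then have "(\<lambda>i. b (?v i)) \<in> words (rows \<alpha>) (part \<alpha>) 0 n"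
    using b(1) vin unfolding words_def by auto
  moreover have "constrained (rows \<alpha>) (part \<alpha>) z"
  proof -
    have "0 = (\<Sum>p\<in>{0<..n}. h p)" using hw(2) by (simp add: ss_def tt_def eq)
    also have "\<dots> = (\<Sum>p\<in>{0<..n}. z (b p))" using hb by (intro sum.cong) auto
    finally show ?thesis using sum_over_word[OF _ b(1), of z] by (simp add: constrained_def)
  qed
  moreover have "z_coord \<alpha> (fst P) j = z j" if "j \<in> rows \<alpha>" for j
    using z[OF that last_in_block[OF \<alpha> that]] by (simp add: z_coord_def hw(1))
  moreover have "snd P i = z (b (?v i))" if "i \<in> {0<..n}" for i
    using hb[OF vin[OF that]] by (simp add: hw(1) perm_act_def)
  ultimately show thesis using that by blast
qed

lemma word_Z_var:
  assumes \<alpha>: "strong_composition n \<alpha>"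
    and z: "constrained (rows \<alpha>) (part \<alpha>) z" and g: "g \<in> words (rows \<alpha>) (part \<alpha>) 0 n"
  obtains P where "P \<in> Z_var n \<alpha>"
    "\<And>j. j \<in> rows \<alpha> \<Longrightarrow> z_coord \<alpha> (fst P) j = z j" "\<And>i. i \<in> {0<..n} \<Longrightarrow> snd P i = z (g i)"
proof -
  obtain b where b: "b \<in> words (rows \<alpha>) (part \<alpha>) 0 n"
    "\<And>p. p \<in> {0<..n} \<Longrightarrow> p \<in> block \<alpha> (b p)"
    "\<And>j p. j \<in> rows \<alpha> \<Longrightarrow> p \<in> block \<alpha> j \<Longrightarrow> p \<in> {0<..n} \<and> b p = j"
    using block_word[OF \<alpha>] by metis
  have eq: "{0<..n} = {1..n}" by auto
  have "image_mset b (mset_set {0<..n}) = image_mset g (mset_set {0<..n})"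
  proof (rule multiset_eqI)
    fix j
    have "card {i\<in>{0<..n}. b i = j} = card {i\<in>{0<..n}. g i = j}"
    proof (cases "j \<in> rows \<alpha>")
      case True
      then show ?thesis using b(1) g by (simp add: words_def)
    next
      case False
      then have "{i\<in>{0<..n}. b i = j} = {}" "{i\<in>{0<..n}. g i = j} = {}"
        using b(1) g by (auto simp: words_def)
      then show ?thesis by (simp only:)
    qed
    moreover have "f -` {j} \<inter> {0<..n} = {i\<in>{0<..n}. f i = j}" for f :: "nat \<Rightarrow> nat" by auto
    ultimately show "count (image_mset b (mset_set {0<..n})) j = count (image_mset g (mset_set {0<..n})) j"
      by (simp add: count_image_mset)
  qed
  then obtain w where w: "w permutes {0<..n}" "\<forall>x\<in>{0<..n}. b x = g (w x)"
    using image_mset_eq_implies_permutes[of "{0<..n}" b g] by auto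
  define h where "h = (\<lambda>p. if p \<in> {0<..n} then z (b p) else 0)"
  have "(\<Sum>p\<in>{0<..n}. h p) = (\<Sum>p\<in>{0<..n}. z (b p))"
    by (intro sum.cong) (auto simp: h_def)
  also have "\<dots> = 0" using sum_over_word[OF _ b(1), of z] z by (simp add: constrained_def)
  finally have "h \<in> tt n" by (auto simp: tt_def eq h_def)
  moreover have hz: "h p = z j" if "j \<in> rows \<alpha>" "p \<in> block \<alpha> j" for j p
    using b(3)[OF that] by (simp add: h_def)
  ultimately have h: "h \<in> ss n \<alpha>" by (auto simp: ss_def)
  show thesis
  proof
    show "(h, perm_act w h) \<in> Z_var n \<alpha>" using h w(1) by (auto simp: Z_var_def eq)
    show "z_coord \<alpha> (fst (h, perm_act w h)) j = z j" if "j \<in> rows \<alpha>" for j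
      using hz[OF that last_in_block[OF \<alpha> that]] by (simp add: z_coord_def)
    show "snd (h, perm_act w h) i = z (g i)" if i: "i \<in> {0<..n}" for i
    proof -
      have "inv_into UNIV w i \<in> {0<..n}"
        using permutes_in_image[OF permutes_inv[OF w(1)]] i by blast
      then show ?thesis
        using w(2) permutes_inverses(1)[OF w(1), of i] by (simp add: perm_act_def h_def)
    qed
  qed
qed

lemma vanishing_on_Z_var_iff:
  assumes \<alpha>: "strong_composition n \<alpha>" and p: "p \<in> polys_in (zx_indets (rows \<alpha>) n)"
  shows "(\<forall>P\<in>Z_var n \<alpha>. eval_at \<alpha> P p = 0) \<longleftrightarrow> p \<in> word_vanishing (rows \<alpha>) (part \<alpha>) n"
proof -
  have same: "eval_at \<alpha> P p = eval_poly (word_point z g) p"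
    if "\<And>j. j \<in> rows \<alpha> \<Longrightarrow> z_coord \<alpha> (fst P) j = z j" "\<And>i. i \<in> {0<..n} \<Longrightarrow> snd P i = z (g i)"
    for P z g
    unfolding eval_at_def word_point_def using that
    by (intro eval_cong[OF p]) (auto simp: zx_indets_def)
  show ?thesis
  proof
    assume L: "\<forall>P\<in>Z_var n \<alpha>. eval_at \<alpha> P p = 0"
    have "eval_poly (word_point z g) p = 0"
      if z: "constrained (rows \<alpha>) (part \<alpha>) z" and g: "g \<in> words (rows \<alpha>) (part \<alpha>) 0 n" for z g
      using word_Z_var[OF \<alpha> z g] same L by metis
    then show "p \<in> word_vanishing (rows \<alpha>) (part \<alpha>) n" using p by (simp add: word_vanishing_def)
  next
    assume R: "p \<in> word_vanishing (rows \<alpha>) (part \<alpha>) n"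
    show "\<forall>P\<in>Z_var n \<alpha>. eval_at \<alpha> P p = 0"
    proof
      fix P assume "P \<in> Z_var n \<alpha>"
      from Z_var_word[OF \<alpha> this] obtain z g where zg:
        "constrained (rows \<alpha>) (part \<alpha>) z" "g \<in> words (rows \<alpha>) (part \<alpha>) 0 n"
        "\<And>j. j \<in> rows \<alpha> \<Longrightarrow> z_coord \<alpha> (fst P) j = z j" "\<And>i. i \<in> {0<..n} \<Longrightarrow> snd P i = z (g i)"
        by blast
      have "eval_poly (word_point z g) p = 0" using R zg(1,2) unfolding word_vanishing_def by blast
      with same[OF zg(3,4)] show "eval_at \<alpha> P p = 0" by simp
    qed
  qed
qed


section \<open>The coordinate ring as a module\<close>

lemma poly_ring_sel [simp]:
  "carrier (poly_ring V) = polys_in V" "x \<otimes>\<^bsub>poly_ring V\<^esub> y = x * y" "x \<oplus>\<^bsub>poly_ring V\<^esub> y = x + y"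
  "\<one>\<^bsub>poly_ring V\<^esub> = 1" "\<zero>\<^bsub>poly_ring V\<^esub> = 0"
  by (simp_all add: poly_ring_def polys_in_def)

lemma cring_poly_ring: "cring (poly_ring V)"
proof (rule cringI)
  note C = subring_polys_in[of V]
  show "abelian_group (poly_ring V)"
  proof (rule abelian_groupI)
    fix x assume "x \<in> carrier (poly_ring V)"
    then show "\<exists>y\<in>carrier (poly_ring V). y \<oplus>\<^bsub>poly_ring V\<^esub> x = \<zero>\<^bsub>poly_ring V\<^esub>"
      using subring_uminus[OF C] by (intro bexI[of _ "- x"]) auto
  qed (auto simp: subring_intros[OF C] add_ac)
  show "comm_monoid (poly_ring V)"
    by (rule comm_monoidI) (auto simp: subring_intros[OF C] mult_ac)
qed (simp add: distrib_right)

lemma ideal_poly_ring: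
  assumes I: "is_ideal (polys_in V) I"
  shows "ideal I (poly_ring V)"
proof (rule idealI)
  interpret cring "poly_ring V" by (rule cring_poly_ring)
  show "ring (poly_ring V)" by unfold_locales
  show "subgroup I (add_monoid (poly_ring V))"
  proof (rule add.subgroupI)
    show "\<ominus>\<^bsub>poly_ring V\<^esub> a \<in> I" if "a \<in> I" for a
    proof -
      have "\<ominus>\<^bsub>poly_ring V\<^esub> a = - a"
        using that ideal_subset[OF I] subring_uminus[OF subring_polys_in]
        by (intro minus_equality) auto
      then show ?thesis using that ideal_uminus[OF I] by simp
    qed
  qed (use ideal_subset[OF I] ideal_zero[OF I] ideal_add[OF I] in auto)
qed (use ideal_mult[OF I] ideal_mult_right[OF I] in auto)

text \<open>
The two quotient constructions are now combined into the maps \<open>to_S\<close> and \<open>to_A\<close> from polynomials to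
\<open>S(\<ss>\<^sup>*)\<close> and \<open>\<A>\<close>. Their kernels are known, so the statement about modules reduces to
the results about polynomials modulo the vanishing ideal.
\<close>

locale composition =
  fixes n :: nat and \<alpha> :: "nat list"
  assumes strong: "strong_composition n \<alpha>"
begin

abbreviation "Z_polys \<equiv> polys_in (Zvar ` rows \<alpha>)"
abbreviation "ZX_polys \<equiv> polys_in (zx_indets (rows \<alpha>) n)"
abbreviation "vanishing \<equiv> word_vanishing (rows \<alpha>) (part \<alpha>) n"
abbreviation "pz \<equiv> poly_z \<alpha>"
abbreviation "pzx \<equiv> poly_zx n \<alpha>"
abbreviation "z_ideal \<equiv> Idl\<^bsub>pz\<^esub> {z_relation \<alpha>}"

definition to_S :: "polynomial \<Rightarrow> polynomial set" where
  "to_S p = z_ideal +>\<^bsub>pz\<^esub> p"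

definition to_A :: "polynomial \<Rightarrow> polynomial set set" where
  "to_A p = A_proj n \<alpha> (st_class n \<alpha> p)"

lemma poly_zx_eq: "pzx = poly_ring (zx_indets (rows \<alpha>) n)"
  by (simp add: poly_zx_def zx_indets_def)

lemma carrier_pz [simp]: "carrier pz = Z_polys" and carrier_pzx [simp]: "carrier pzx = ZX_polys"
  by (simp_all add: poly_z_def poly_zx_eq)

lemma pz_simps [simp]:
  "x \<otimes>\<^bsub>pz\<^esub> y = x * y" "x \<oplus>\<^bsub>pz\<^esub> y = x + y" "\<one>\<^bsub>pz\<^esub> = 1" "\<zero>\<^bsub>pz\<^esub> = 0"
  by (simp_all add: poly_z_def)

lemma pzx_simps [simp]:
  "x \<otimes>\<^bsub>pzx\<^esub> y = x * y" "x \<oplus>\<^bsub>pzx\<^esub> y = x + y" "\<one>\<^bsub>pzx\<^esub> = 1" "\<zero>\<^bsub>pzx\<^esub> = 0"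
  by (simp_all add: poly_zx_eq)

lemma cring_pz: "cring pz" and cring_pzx: "cring pzx"
  by (simp_all add: poly_z_def poly_zx_eq cring_poly_ring)

lemma Z_polys_subset: "Z_polys \<subseteq> ZX_polys"
  by (intro polys_in_mono) (auto simp: zx_indets_def)

lemma z_relation_eq: "z_relation \<alpha> = z_rel (rows \<alpha>) (part \<alpha>)"
  by (simp add: z_relation_def z_rel_def)

lemma z_relation_in_Z_polys: "z_relation \<alpha> \<in> Z_polys"
  unfolding z_relation_eq by (rule z_rel_in_polys)

lemma z_ideal_eq: "z_ideal = {q * z_relation \<alpha> | q. q \<in> Z_polys}"
proof -
  interpret cring pz by (rule cring_pz)
  have "z_ideal = PIdl\<^bsub>pz\<^esub> (z_relation \<alpha>)"
    using z_relation_in_Z_polys by (intro cgenideal_eq_genideal[symmetric]) simp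
  then show ?thesis by (simp add: cgenideal_def)
qed

lemma z_ideal: "ideal z_ideal pz"
proof -
  interpret cring pz by (rule cring_pz)
  show ?thesis using z_relation_in_Z_polys by (intro genideal_ideal) simp
qed

lemma relations_vanish: "z_relation \<alpha> \<in> vanishing" "x_relation n \<in> vanishing"
proof -
  have "z_relation \<alpha> \<in> ZX_polys" using z_relation_in_Z_polys Z_polys_subset by blast
  then show "z_relation \<alpha> \<in> vanishing"
    by (simp add: word_vanishing_def z_relation_def word_point_def eval_simps of_nat_eq_Const
        constrained_def)
  have "x_relation n \<in> ZX_polys" unfolding x_relation_def
    by (intro subring_sum subring_polys_in) (auto simp: zx_indets_def intro!: Var_in_polys)
  moreover have "{1..n} = {0<..n}" by auto
  ultimately show "x_relation n \<in> vanishing"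
    using sum_over_word[of "rows \<alpha>" _ "part \<alpha>" n]
    by (simp add: word_vanishing_def x_relation_def word_point_def eval_simps constrained_def)
qed

lemma ideal_vanishing: "ideal vanishing pzx"
  unfolding poly_zx_eq by (intro ideal_poly_ring ideal_word_vanishing)

lemma st_ideal: "ideal (st_ideal n \<alpha>) pzx" and st_ideal_subset: "st_ideal n \<alpha> \<subseteq> vanishing"
proof -
  interpret cring pzx by (rule cring_pzx)
  have "vanishing \<subseteq> ZX_polys" by (auto simp: word_vanishing_def)
  then have "{z_relation \<alpha>, x_relation n} \<subseteq> carrier pzx" using relations_vanish by auto
  then show "ideal (st_ideal n \<alpha>) pzx" unfolding st_ideal_def by (rule genideal_ideal)
  show "st_ideal n \<alpha> \<subseteq> vanishing"
    unfolding st_ideal_def using relations_vanish by (intro genideal_minimal ideal_vanishing) auto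
qed

lemma st_class_hom: "ring_hom_cring pzx (coord_st n \<alpha>) (st_class n \<alpha>)"
proof -
  have "st_class n \<alpha> = (+>\<^bsub>pzx\<^esub>) (st_ideal n \<alpha>)" by (auto simp: st_class_def)
  then show ?thesis
    using ideal.rcos_ring_hom_cring[OF st_ideal cring_pzx] by (simp add: coord_st_def)
qed

lemma carrier_coord_st: "carrier (coord_st n \<alpha>) = st_class n \<alpha> ` ZX_polys"
  by (auto simp: coord_st_def FactRing_def A_RCOSETS_def' st_class_def)

lemma st_class_eq: "st_class n \<alpha> p = {i + p | i. i \<in> st_ideal n \<alpha>}"
  by (auto simp: st_class_def a_r_coset_def')

text \<open>
All elements of a coset differ by elements of the ideal of the two linear relations, and these vanish on
\<open>Z\<^sub>\<alpha>\<close>, so one representative decides.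
\<close>

lemma class_vanishes_iff:
  assumes p: "p \<in> ZX_polys"
  shows "st_class n \<alpha> p \<in> vanishing_ideal_Z n \<alpha> \<longleftrightarrow> p \<in> vanishing"
proof -
  note I = ideal_word_vanishing[of "rows \<alpha>" n "part \<alpha>"]
  have "0 \<in> st_ideal n \<alpha>"
    using additive_subgroup.zero_closed[OF ideal.axioms(1)[OF st_ideal]] by simp
  then have self: "p \<in> st_class n \<alpha> p" unfolding st_class_eq by force
  have mem: "q \<in> ZX_polys \<and> (q \<in> vanishing \<longleftrightarrow> p \<in> vanishing)" if "q \<in> st_class n \<alpha> p" for q
  proof -
    obtain i where i: "i \<in> vanishing" "q = i + p"
      using \<open>q \<in> st_class n \<alpha> p\<close> st_ideal_subset unfolding st_class_eq by blast
    then show ?thesis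
      using ideal_add[OF I i(1), of p] ideal_diff[OF I, of q i] p
        subring_add[OF subring_polys_in, of i _ p] ideal_subset[OF I i(1)] by auto
  qed
  have "st_class n \<alpha> p \<in> carrier (coord_st n \<alpha>)" using p by (auto simp: carrier_coord_st)
  then have "st_class n \<alpha> p \<in> vanishing_ideal_Z n \<alpha> \<longleftrightarrow>
      (\<forall>q\<in>st_class n \<alpha> p. \<forall>P\<in>Z_var n \<alpha>. eval_at \<alpha> P q = 0)"
    by (simp add: vanishing_ideal_Z_def)
  also have "\<dots> \<longleftrightarrow> (\<forall>q\<in>st_class n \<alpha> p. q \<in> vanishing)"
    using mem vanishing_on_Z_var_iff[OF strong] by blast
  also have "\<dots> \<longleftrightarrow> p \<in> vanishing" using self mem by blast
  finally show ?thesis .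
qed

lemma vanishing_ideal_Z_eq: "vanishing_ideal_Z n \<alpha> = st_class n \<alpha> ` vanishing"
proof (intro equalityI subsetI)
  fix f assume f: "f \<in> vanishing_ideal_Z n \<alpha>"
  then have "f \<in> st_class n \<alpha> ` ZX_polys"
    unfolding vanishing_ideal_Z_def carrier_coord_st by blast
  then show "f \<in> st_class n \<alpha> ` vanishing" using f class_vanishes_iff by blast
next
  fix f assume "f \<in> st_class n \<alpha> ` vanishing"
  then obtain p where "p \<in> vanishing" "f = st_class n \<alpha> p" by blast
  moreover from this have "p \<in> ZX_polys" by (simp add: word_vanishing_def)
  ultimately show "f \<in> vanishing_ideal_Z n \<alpha>" using class_vanishes_iff by blast
qed

lemma ideal_vanishing_Z: "ideal (vanishing_ideal_Z n \<alpha>) (coord_st n \<alpha>)"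
proof -
  interpret cring pzx by (rule cring_pzx)
  show ?thesis
    using ring_ideal_imp_quot_ideal[OF st_ideal ideal_vanishing]
    by (simp add: vanishing_ideal_Z_eq coord_st_def st_class_def)
qed

lemma cring_A: "cring (A_ring n \<alpha>)"
  unfolding A_ring_def using st_class_hom ideal_vanishing_Z
  by (intro ideal.quotient_is_cring) (auto simp: ring_hom_cring_def)

lemma to_A_hom: "ring_hom_cring pzx (A_ring n \<alpha>) to_A"
proof -
  have cr: "cring (coord_st n \<alpha>)" using st_class_hom by (simp add: ring_hom_cring_def)
  have "A_proj n \<alpha> = (+>\<^bsub>coord_st n \<alpha>\<^esub>) (vanishing_ideal_Z n \<alpha>)" by (auto simp: A_proj_def)
  then have "A_proj n \<alpha> \<in> ring_hom (coord_st n \<alpha>) (A_ring n \<alpha>)"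
    using ideal.rcos_ring_hom[OF ideal_vanishing_Z] by (simp add: A_ring_def)
  moreover have "st_class n \<alpha> \<in> ring_hom pzx (coord_st n \<alpha>)"
    using st_class_hom by (simp add: ring_hom_cring_def ring_hom_cring_axioms_def)
  ultimately have "A_proj n \<alpha> \<circ> st_class n \<alpha> \<in> ring_hom pzx (A_ring n \<alpha>)"
    by (rule ring_hom_trans[rotated])
  moreover have "A_proj n \<alpha> \<circ> st_class n \<alpha> = to_A" by (auto simp: to_A_def)
  ultimately show ?thesis
    using cring_pzx cring_A by (simp add: ring_hom_cring_def ring_hom_cring_axioms_def)
qed

lemma carrier_A: "carrier (A_ring n \<alpha>) = to_A ` ZX_polys"
  by (auto simp: A_ring_def FactRing_def A_RCOSETS_def' carrier_coord_st to_A_def A_proj_def)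

lemma zero_A: "\<zero>\<^bsub>A_ring n \<alpha>\<^esub> = vanishing_ideal_Z n \<alpha>"
  by (simp add: A_ring_def FactRing_def)

lemma to_A_zero_iff:
  assumes p: "p \<in> ZX_polys"
  shows "to_A p = \<zero>\<^bsub>A_ring n \<alpha>\<^esub> \<longleftrightarrow> p \<in> vanishing"
proof -
  interpret I: ideal "vanishing_ideal_Z n \<alpha>" "coord_st n \<alpha>" by (rule ideal_vanishing_Z)
  have "st_class n \<alpha> p \<in> carrier (coord_st n \<alpha>)" using p by (auto simp: carrier_coord_st)
  then have "to_A p = vanishing_ideal_Z n \<alpha> \<longleftrightarrow> st_class n \<alpha> p \<in> vanishing_ideal_Z n \<alpha>"
    unfolding to_A_def A_proj_def
    using I.rcos_const_imp_mem I.a_rcos_zero[OF ideal_vanishing_Z] by blast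
  then show ?thesis using class_vanishes_iff[OF p] by (simp add: zero_A)
qed

lemma to_A_eq_iff:
  assumes p: "p \<in> ZX_polys" and q: "q \<in> ZX_polys"
  shows "to_A p = to_A q \<longleftrightarrow> p - q \<in> vanishing"
proof -
  interpret h: ring_hom_cring pzx "A_ring n \<alpha>" to_A by (rule to_A_hom)
  have d: "p - q \<in> ZX_polys" by (rule subring_diff[OF subring_polys_in p q])
  have "to_A p = to_A (p - q) \<oplus>\<^bsub>A_ring n \<alpha>\<^esub> to_A q"
    using h.hom_add[of "p - q" q] d q by simp
  moreover have "to_A q \<in> carrier (A_ring n \<alpha>)" "to_A (p - q) \<in> carrier (A_ring n \<alpha>)"
    using d q by (auto simp: carrier_A)
  ultimately have "to_A p = to_A q \<longleftrightarrow> to_A (p - q) = \<zero>\<^bsub>A_ring n \<alpha>\<^esub>"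
    using h.S.add.l_cancel_one' by (metis h.S.add.r_cancel_one' h.S.l_zero h.S.add.right_cancel h.S.zero_closed)
  then show ?thesis using to_A_zero_iff[OF d] by simp
qed

lemma Sym_s_eq: "Sym_s \<alpha> = pz Quot z_ideal"
  by (simp add: Sym_s_def)

lemma to_S_hom: "ring_hom_cring pz (Sym_s \<alpha>) to_S"
proof -
  have "to_S = (+>\<^bsub>pz\<^esub>) z_ideal" by (auto simp: to_S_def)
  then show ?thesis
    using ideal.rcos_ring_hom_cring[OF z_ideal cring_pz] by (simp add: Sym_s_eq)
qed

lemma carrier_S: "carrier (Sym_s \<alpha>) = to_S ` Z_polys"
  by (auto simp: Sym_s_eq FactRing_def A_RCOSETS_def' to_S_def)

lemma to_S_zero: "p \<in> z_ideal \<Longrightarrow> to_S p = \<zero>\<^bsub>Sym_s \<alpha>\<^esub>"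
proof -
  interpret cring pz by (rule cring_pz)
  show "p \<in> z_ideal \<Longrightarrow> to_S p = \<zero>\<^bsub>Sym_s \<alpha>\<^esub>"
    using a_rcos_zero[OF z_ideal] by (simp add: to_S_def Sym_s_eq FactRing_def)
qed

text \<open>
Polynomials in \<open>z\<close> that agree modulo the linear relation have the same class in \<open>\<A>\<close>, so the image that
defines the structure map is indeed a singleton.
\<close>

lemma structure_map_to_S:
  assumes p: "p \<in> Z_polys"
  shows "A_structure_map n \<alpha> (to_S p) = to_A p"
proof -
  note I = ideal_word_vanishing[of "rows \<alpha>" n "part \<alpha>"]
  have "to_A q = to_A p" if "q \<in> to_S p" for q
  proof -
    obtain i where i: "i \<in> z_ideal" "q = i + p"
      using \<open>q \<in> to_S p\<close> by (auto simp: to_S_def a_r_coset_def')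
    obtain r where r: "r \<in> Z_polys" "i = r * z_relation \<alpha>" using i(1) unfolding z_ideal_eq by blast
    have "i \<in> vanishing"
      unfolding r(2) using r(1) Z_polys_subset relations_vanish(1) by (intro ideal_mult[OF I]) blast+
    then have "q - p \<in> vanishing" by (simp add: i(2))
    moreover have "q \<in> Z_polys"
      unfolding i(2) r(2) by (intro subring_add subring_mult subring_polys_in r p z_relation_in_Z_polys)
    ultimately show ?thesis using p Z_polys_subset by (subst to_A_eq_iff) auto
  qed
  moreover have "p \<in> to_S p"
  proof -
    have "0 \<in> z_ideal" unfolding z_ideal_eq
      using subring_zero[OF subring_polys_in, of "Zvar ` rows \<alpha>"] by force
    then show ?thesis by (force simp: to_S_def a_r_coset_def')
  qed
  ultimately have "to_A ` to_S p = {to_A p}" by blast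
  then show ?thesis by (simp add: A_structure_map_def to_A_def)
qed

lemma A_module_sel [simp]:
  "carrier (A_module n \<alpha>) = carrier (A_ring n \<alpha>)" "\<zero>\<^bsub>A_module n \<alpha>\<^esub> = \<zero>\<^bsub>A_ring n \<alpha>\<^esub>"
  "x \<oplus>\<^bsub>A_module n \<alpha>\<^esub> y = x \<oplus>\<^bsub>A_ring n \<alpha>\<^esub> y"
  "c \<odot>\<^bsub>A_module n \<alpha>\<^esub> a = A_structure_map n \<alpha> c \<otimes>\<^bsub>A_ring n \<alpha>\<^esub> a"
  by (simp_all add: A_module_def)

lemma finsum_A_module: "finsum (A_module n \<alpha>) f T = finsum (A_ring n \<alpha>) f T"
  by (simp add: finsum_def finprod_def A_module_def)

lemma smult_to:
  assumes "c \<in> Z_polys" "p \<in> ZX_polys"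
  shows "to_S c \<odot>\<^bsub>A_module n \<alpha>\<^esub> to_A p = to_A (c * p)"
proof -
  interpret h: ring_hom_cring pzx "A_ring n \<alpha>" to_A by (rule to_A_hom)
  show ?thesis using assms Z_polys_subset h.hom_mult[of c p] by (auto simp: structure_map_to_S)
qed

lemma module_A: "module (Sym_s \<alpha>) (A_module n \<alpha>)"
proof (rule moduleI)
  interpret h: ring_hom_cring pzx "A_ring n \<alpha>" to_A by (rule to_A_hom)
  interpret g: ring_hom_cring pz "Sym_s \<alpha>" to_S by (rule to_S_hom)
  have str: "A_structure_map n \<alpha> c \<in> carrier (A_ring n \<alpha>)" if "c \<in> carrier (Sym_s \<alpha>)" for c
    using that Z_polys_subset by (auto simp: carrier_S carrier_A structure_map_to_S)
  show "cring (Sym_s \<alpha>)" by unfold_locales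
  show "abelian_group (A_module n \<alpha>)"
  proof (rule abelian_groupI)
    show "\<exists>y\<in>carrier (A_module n \<alpha>). y \<oplus>\<^bsub>A_module n \<alpha>\<^esub> x = \<zero>\<^bsub>A_module n \<alpha>\<^esub>"
      if "x \<in> carrier (A_module n \<alpha>)" for x
      using that h.S.l_neg[of x] h.S.a_inv_closed[of x] by (metis A_module_sel(1-3))
  qed (auto simp: h.S.a_ac)
  fix a x assume a: "a \<in> carrier (Sym_s \<alpha>)" and x: "x \<in> carrier (A_module n \<alpha>)"
  show "a \<odot>\<^bsub>A_module n \<alpha>\<^esub> x \<in> carrier (A_module n \<alpha>)" using str[OF a] x by simp
  show "a \<odot>\<^bsub>A_module n \<alpha>\<^esub> (x \<oplus>\<^bsub>A_module n \<alpha>\<^esub> y)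
      = a \<odot>\<^bsub>A_module n \<alpha>\<^esub> x \<oplus>\<^bsub>A_module n \<alpha>\<^esub> a \<odot>\<^bsub>A_module n \<alpha>\<^esub> y"
    if "y \<in> carrier (A_module n \<alpha>)" for y
    using str[OF a] x that by (simp add: h.S.r_distr)
  obtain p where p: "p \<in> Z_polys" "a = to_S p" using a by (auto simp: carrier_S)
  have pX: "p \<in> ZX_polys" using p Z_polys_subset by blast
  fix b assume b: "b \<in> carrier (Sym_s \<alpha>)"
  obtain q where q: "q \<in> Z_polys" "b = to_S q" using b by (auto simp: carrier_S)
  have qX: "q \<in> ZX_polys" using q Z_polys_subset by blast
  note C = subring_polys_in[of "Zvar ` rows \<alpha>"]
  have "a \<oplus>\<^bsub>Sym_s \<alpha>\<^esub> b = to_S (p + q)" using p q g.hom_add[of p q] by simp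
  then have add: "A_structure_map n \<alpha> (a \<oplus>\<^bsub>Sym_s \<alpha>\<^esub> b)
      = A_structure_map n \<alpha> a \<oplus>\<^bsub>A_ring n \<alpha>\<^esub> A_structure_map n \<alpha> b"
    using p q pX qX h.hom_add[of p q] subring_add[OF C] by (simp add: structure_map_to_S)
  have "a \<otimes>\<^bsub>Sym_s \<alpha>\<^esub> b = to_S (p * q)" using p q g.hom_mult[of p q] by simp
  then have mult: "A_structure_map n \<alpha> (a \<otimes>\<^bsub>Sym_s \<alpha>\<^esub> b)
      = A_structure_map n \<alpha> a \<otimes>\<^bsub>A_ring n \<alpha>\<^esub> A_structure_map n \<alpha> b"
    using p q pX qX h.hom_mult[of p q] subring_mult[OF C] by (simp add: structure_map_to_S)
  show "(a \<oplus>\<^bsub>Sym_s \<alpha>\<^esub> b) \<odot>\<^bsub>A_module n \<alpha>\<^esub> x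
      = a \<odot>\<^bsub>A_module n \<alpha>\<^esub> x \<oplus>\<^bsub>A_module n \<alpha>\<^esub> b \<odot>\<^bsub>A_module n \<alpha>\<^esub> x"
    using str[OF a] str[OF b] x by (simp add: add h.S.l_distr)
  show "(a \<otimes>\<^bsub>Sym_s \<alpha>\<^esub> b) \<odot>\<^bsub>A_module n \<alpha>\<^esub> x = a \<odot>\<^bsub>A_module n \<alpha>\<^esub> (b \<odot>\<^bsub>A_module n \<alpha>\<^esub> x)"
    using str[OF a] str[OF b] x by (simp add: mult h.S.m_assoc)
next
  interpret h: ring_hom_cring pzx "A_ring n \<alpha>" to_A by (rule to_A_hom)
  interpret g: ring_hom_cring pz "Sym_s \<alpha>" to_S by (rule to_S_hom)
  fix x assume x: "x \<in> carrier (A_module n \<alpha>)"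
  have "\<one>\<^bsub>Sym_s \<alpha>\<^esub> = to_S 1" using g.hom_one by simp
  then have "A_structure_map n \<alpha> \<one>\<^bsub>Sym_s \<alpha>\<^esub> = \<one>\<^bsub>A_ring n \<alpha>\<^esub>"
    using h.hom_one subring_one[OF subring_polys_in] by (simp add: structure_map_to_S)
  then show "\<one>\<^bsub>Sym_s \<alpha>\<^esub> \<odot>\<^bsub>A_module n \<alpha>\<^esub> x = x" using x by simp
qed

lemma linear_combination_to_A:
  assumes T: "finite T" and c: "\<And>t. t \<in> T \<Longrightarrow> c t \<in> Z_polys" and b: "\<And>t. t \<in> T \<Longrightarrow> b t \<in> ZX_polys"
  shows "(\<Oplus>\<^bsub>A_module n \<alpha>\<^esub>t\<in>T. to_S (c t) \<odot>\<^bsub>A_module n \<alpha>\<^esub> to_A (b t)) = to_A (\<Sum>t\<in>T. c t * b t)"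
proof -
  interpret h: ring_hom_cring pzx "A_ring n \<alpha>" to_A by (rule to_A_hom)
  note C = subring_polys_in[of "zx_indets (rows \<alpha>) n"]
  have cb: "c t * b t \<in> ZX_polys" if "t \<in> T" for t
    using c[OF that] b[OF that] Z_polys_subset by (intro subring_mult[OF C]) auto
  show ?thesis using T cb c b
  proof (induction T)
    case empty
    show ?case using h.hom_zero by (simp add: finsum_A_module)
  next
    case (insert t T)
    have in_A: "to_S (c s) \<odot>\<^bsub>A_module n \<alpha>\<^esub> to_A (b s) \<in> carrier (A_ring n \<alpha>)" if "s \<in> insert t T" for s
      using insert.prems that by (auto simp: smult_to carrier_A simp del: A_module_sel)
    have IH: "(\<Oplus>\<^bsub>A_module n \<alpha>\<^esub>t\<in>T. to_S (c t) \<odot>\<^bsub>A_module n \<alpha>\<^esub> to_A (b t)) = to_A (\<Sum>t\<in>T. c t * b t)"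
      using insert by auto
    have S: "(\<Sum>t\<in>T. c t * b t) \<in> ZX_polys" using insert.prems by (intro subring_sum[OF C]) auto
    have "(\<Oplus>\<^bsub>A_module n \<alpha>\<^esub>t\<in>insert t T. to_S (c t) \<odot>\<^bsub>A_module n \<alpha>\<^esub> to_A (b t))
        = (to_S (c t) \<odot>\<^bsub>A_module n \<alpha>\<^esub> to_A (b t)) \<oplus>\<^bsub>A_ring n \<alpha>\<^esub> to_A (\<Sum>t\<in>T. c t * b t)"
      unfolding IH[symmetric] finsum_A_module
      using insert.hyps in_A by (intro h.S.finsum_insert) auto
    also have "\<dots> = to_A (c t * b t + (\<Sum>t\<in>T. c t * b t))"
      using insert.prems S h.hom_add[of "c t * b t" "\<Sum>t\<in>T. c t * b t"]
      by (simp add: smult_to del: A_module_sel)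
    finally show ?case using insert.hyps by simp
  qed
qed

end

theorem theorem3p12:
  fixes n :: nat and \<alpha> :: "nat list"
  assumes "strong_composition n \<alpha>"
  shows "finite_module_basis (Sym_s \<alpha>) (A_module n \<alpha>)
           (\<lambda>\<Upsilon>. A_proj n \<alpha> (springer_monomial n \<alpha> \<Upsilon>)) (RSCT n \<alpha>)"
proof -
  interpret composition n \<alpha> by unfold_locales (rule assms)
  let ?P = "springer_monomial_poly \<alpha>"
  have basis: "A_proj n \<alpha> (springer_monomial n \<alpha> \<Upsilon>) = to_A (?P \<Upsilon>)" for \<Upsilon>
    by (simp add: springer_monomial_def to_A_def)
  have P: "?P \<Upsilon> \<in> ZX_polys" if "\<Upsilon> \<in> RSCT n \<alpha>" for \<Upsilon>
    unfolding springer_monomial_poly_eq[OF that] by (rule springer_poly_in_polys)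
  note fin = finite_RSCT[of n \<alpha>]
  have part_sum: "(\<Sum>j\<in>rows \<alpha>. part \<alpha> j) = n"
    using assms unfolding sum_part strong_composition_def by blast
  have words_RSCT: "springer_poly (rows \<alpha>) n ` words (rows \<alpha>) (part \<alpha>) 0 n = ?P ` RSCT n \<alpha>"
  proof (intro equalityI subsetI)
    fix p assume "p \<in> springer_poly (rows \<alpha>) n ` words (rows \<alpha>) (part \<alpha>) 0 n"
    then obtain f where f: "f \<in> words (rows \<alpha>) (part \<alpha>) 0 n" "p = springer_poly (rows \<alpha>) n f" by blast
    obtain \<Upsilon> where "\<Upsilon> \<in> RSCT n \<alpha>" "\<forall>i\<in>{0<..n}. row_word \<alpha> \<Upsilon> i = f i"
      using row_word_surj[OF assms f(1)] by blast
    then show "p \<in> ?P ` RSCT n \<alpha>"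
      using springer_poly_cong[of n f "row_word \<alpha> \<Upsilon>"] springer_monomial_poly_eq[of \<Upsilon> n \<alpha>]
      by (intro image_eqI[of _ _ \<Upsilon>]) (auto simp: f(2))
  next
    fix p assume "p \<in> ?P ` RSCT n \<alpha>"
    then obtain \<Upsilon> where \<Upsilon>: "\<Upsilon> \<in> RSCT n \<alpha>" "p = ?P \<Upsilon>" by blast
    then show "p \<in> springer_poly (rows \<alpha>) n ` words (rows \<alpha>) (part \<alpha>) 0 n"
      using row_word_in_words[OF \<Upsilon>(1)] springer_monomial_poly_eq[OF \<Upsilon>(1)] by blast
  qed
  have spans: "\<exists>c\<in>RSCT n \<alpha> \<rightarrow> carrier (Sym_s \<alpha>).
      a = (\<Oplus>\<^bsub>A_module n \<alpha>\<^esub>\<Upsilon>\<in>RSCT n \<alpha>. c \<Upsilon> \<odot>\<^bsub>A_module n \<alpha>\<^esub> to_A (?P \<Upsilon>))"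
    if a: "a \<in> carrier (A_module n \<alpha>)" for a
  proof -
    obtain p where p: "p \<in> ZX_polys" "a = to_A p"
      using a unfolding A_module_sel carrier_A by blast
    obtain v where v: "v \<in> lin_span Z_polys (?P ` RSCT n \<alpha>)" "p - v \<in> vanishing"
      using springer_polys_span[OF finite_atLeastAtMost part_sum p(1)] unfolding words_RSCT by blast
    obtain c where c: "c \<in> RSCT n \<alpha> \<rightarrow> Z_polys" "v = (\<Sum>\<Upsilon>\<in>RSCT n \<alpha>. c \<Upsilon> * ?P \<Upsilon>)"
      using span_eq_sum[OF subring_polys_in fin v(1)] by blast
    have "v \<in> ZX_polys" unfolding c(2)
      using c(1) P Z_polys_subset by (intro subring_sum subring_mult subring_polys_in) blast+
    then have "a = to_A v" using to_A_eq_iff[OF p(1)] v(2) p(2) by blast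
    also have "\<dots> = (\<Oplus>\<^bsub>A_module n \<alpha>\<^esub>\<Upsilon>\<in>RSCT n \<alpha>. to_S (c \<Upsilon>) \<odot>\<^bsub>A_module n \<alpha>\<^esub> to_A (?P \<Upsilon>))"
      unfolding c(2) using c(1) P by (intro linear_combination_to_A[symmetric] fin) blast+
    finally show ?thesis
      using c(1) unfolding carrier_S by (intro bexI[of _ "\<lambda>\<Upsilon>. to_S (c \<Upsilon>)"]) blast+
  qed
  have independent: "c \<Upsilon> = \<zero>\<^bsub>Sym_s \<alpha>\<^esub>"
    if c: "c \<in> RSCT n \<alpha> \<rightarrow> carrier (Sym_s \<alpha>)" and \<Upsilon>: "\<Upsilon> \<in> RSCT n \<alpha>" and
      rel: "(\<Oplus>\<^bsub>A_module n \<alpha>\<^esub>\<Upsilon>\<in>RSCT n \<alpha>. c \<Upsilon> \<odot>\<^bsub>A_module n \<alpha>\<^esub> to_A (?P \<Upsilon>)) = \<zero>\<^bsub>A_module n \<alpha>\<^esub>"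
    for c \<Upsilon>
  proof -
    have "\<forall>\<Upsilon>\<in>RSCT n \<alpha>. \<exists>p. p \<in> Z_polys \<and> c \<Upsilon> = to_S p" using c unfolding carrier_S by blast
    then obtain p where p: "\<And>\<Upsilon>. \<Upsilon> \<in> RSCT n \<alpha> \<Longrightarrow> p \<Upsilon> \<in> Z_polys"
      "\<And>\<Upsilon>. \<Upsilon> \<in> RSCT n \<alpha> \<Longrightarrow> c \<Upsilon> = to_S (p \<Upsilon>)" by metis
    define v where "v = (\<Sum>\<Upsilon>\<in>RSCT n \<alpha>. p \<Upsilon> * ?P \<Upsilon>)"
    have vX: "v \<in> ZX_polys" unfolding v_def
      using p(1) P Z_polys_subset by (intro subring_sum subring_mult subring_polys_in) blast+
    interpret M: module "Sym_s \<alpha>" "A_module n \<alpha>" by (rule module_A)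
    have "(\<Oplus>\<^bsub>A_module n \<alpha>\<^esub>\<Upsilon>\<in>RSCT n \<alpha>. c \<Upsilon> \<odot>\<^bsub>A_module n \<alpha>\<^esub> to_A (?P \<Upsilon>))
        = (\<Oplus>\<^bsub>A_module n \<alpha>\<^esub>\<Upsilon>\<in>RSCT n \<alpha>. to_S (p \<Upsilon>) \<odot>\<^bsub>A_module n \<alpha>\<^esub> to_A (?P \<Upsilon>))"
    proof (rule M.M.finsum_cong'[OF refl])
      have "to_A (?P \<Upsilon>) \<in> carrier (A_module n \<alpha>)" "to_S (p \<Upsilon>) \<in> carrier (Sym_s \<alpha>)"
        if "\<Upsilon> \<in> RSCT n \<alpha>" for \<Upsilon> using P[OF that] p(1)[OF that] unfolding A_module_sel carrier_A carrier_S by blast+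
      then show "(\<lambda>\<Upsilon>. to_S (p \<Upsilon>) \<odot>\<^bsub>A_module n \<alpha>\<^esub> to_A (?P \<Upsilon>)) \<in> RSCT n \<alpha> \<rightarrow> carrier (A_module n \<alpha>)"
        using M.smult_closed by blast
      show "c \<Upsilon> \<odot>\<^bsub>A_module n \<alpha>\<^esub> to_A (?P \<Upsilon>) = to_S (p \<Upsilon>) \<odot>\<^bsub>A_module n \<alpha>\<^esub> to_A (?P \<Upsilon>)"
        if "\<Upsilon> \<in> RSCT n \<alpha>" for \<Upsilon> using p(2)[OF that] by simp
    qed
    also have "\<dots> = to_A v" unfolding v_def using p(1) P by (intro linear_combination_to_A fin)
    finally have "v \<in> vanishing" using rel to_A_zero_iff[OF vX] by simp
    then have rel': "(\<Sum>\<Upsilon>\<in>RSCT n \<alpha>. p \<Upsilon> * springer_poly (rows \<alpha>) n (row_word \<alpha> \<Upsilon>)) \<in> vanishing"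
      by (simp add: v_def springer_monomial_poly_eq)
    have "\<exists>q\<in>Z_polys. p \<Upsilon> = q * z_rel (rows \<alpha>) (part \<alpha>)"
    proof (rule vanishing_on_generic_trace_zero[OF _ p(1)[OF \<Upsilon>]])
      fix z assume z: "inj_on z (rows \<alpha>)" "constrained (rows \<alpha>) (part \<alpha>) z"
      show "eval_poly (case_indet z (\<lambda>_. 0)) (p \<Upsilon>) = 0"
        by (rule springer_polys_pointwise_independent[OF _ fin row_word_in_words _ p(1) rel' z \<Upsilon>])
           (use row_word_inj in blast)+
    qed simp
    then have "p \<Upsilon> \<in> {q * z_relation \<alpha> | q. q \<in> Z_polys}" unfolding z_relation_eq by blast
    then have "p \<Upsilon> \<in> z_ideal" unfolding z_ideal_eq .
    then show ?thesis using to_S_zero p(2)[OF \<Upsilon>] by simp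
  qed
  have closed: "(\<lambda>\<Upsilon>. to_A (?P \<Upsilon>)) \<in> RSCT n \<alpha> \<rightarrow> carrier (A_module n \<alpha>)"
    using P unfolding A_module_sel carrier_A by blast
  show ?thesis
    unfolding finite_module_basis_def basis
    using module_A fin closed spans independent by blast
qed

end
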